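(* Let $F_0$ and $F_1$ be spectral measures on $\mathbb{R}^d\setminus\{0\}$ having positive densities $f_0$ and $f_1$ with respect to Lebesgue measure. Suppose that: (a) there exist constants $c,k_0,\eta>0$ such that $f_0(\lambda)\ge c\,|\lambda|^{-\eta}$ for all $\lambda\in\mathbb{R}^d$ with $|\lambda|>k_0$; (b) there exists an entire function $\phi_0$ on $\mathbb{C}^d$ of finite exponential type such that $f_0(\lambda)\asymp|\phi_0(\lambda)|^2$ as $|\lambda|\to\infty$, $\lambda\in\mathbb{R}^d$. If there exists a finite constant $k>0$ such that $$\int_{|\lambda|>k}\left(\frac{f_1(\lambda)-f_0(\lambda)}{f_0(\lambda)}\right)^2 d\lambda<\infty,$$ then the centered Gaussian random fields with stationary increments having spectral measures $F_0$ and $F_1$ are locally equivalent.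
   Context: A spectral measure is a non-negative symmetric Borel measure $F$ on $\mathbb{R}^d\setminus\{0\}$ with $\int_{\mathbb{R}^d}\frac{|\lambda|^2}{1+|\lambda|^2}F(d\lambda)<\infty$. The centered Gaussian random field (GRF) with stationary increments and spectral measure $F$ is the real-valued centered Gaussian field $X=\{X_t:t\in\mathbb{R}^d\}$ with $X_0=0$ and $$\mathbf{E}(X_tX_s)=\int_{\mathbb{R}^d}\big(e^{i\langle t,\lambda\rangle}-1\big)\big(e^{-i\langle s,\lambda\rangle}-1\big)F(d\lambda).$$ The Lebesgue density of $F$, if it exists, is called the spectral density. For $D\subseteq\mathbb{R}^d$, two GRFs are equivalent on $D$ if they induce mutually absolutely continuous measures on $(\mathbb{R}^D,\mathcal{B}(\mathbb{R}^D))$, where $\mathcal{B}(\mathbb{R}^D)$ is the $\sigma$-field generated by the cylinder subsets of $\mathbb{R}^D$. They are locally equivalent if they are equivalent on every bounded subset of $\mathbb{R}^d$. An entire function $\varphi$ on $\mathbb{C}^d$ is of finite exponential type if $\limsup_{r\to\infty}\frac1r\max_{\|z\|=r}\log|\varphi(z)|<\infty$. $f(\lambda)\asymp g(\lambda)$ as $|\lambda|\to\infty$ means there are constants $c_1,c_2,R>0$ with $c_1g(\lambda)\le f(\lambda)\le c_2g(\lambda)$ for all $|\lambda|>R$. *)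

theory Defs
  imports "HOL-Probability.Probability"
begin

section \<open>Spectral measures\<close>

definition spectral_measure :: "(real ^ 'n) measure \<Rightarrow> bool" where
  "spectral_measure F \<longleftrightarrow>
     sets F = sets (restrict_space borel (- {0})) \<and>
     (\<forall>A\<in>sets F. emeasure F (uminus ` A) = emeasure F A) \<and>
     (\<integral>\<^sup>+ x. ennreal ((norm x)\<^sup>2 / (1 + (norm x)\<^sup>2)) \<partial>F) < \<infinity>"

definition spectral_density :: "(real ^ 'n) measure \<Rightarrow> (real ^ 'n \<Rightarrow> real) \<Rightarrow> bool" where
  "spectral_density F f \<longleftrightarrow>
     f \<in> borel_measurable (restrict_space borel (- {0})) \<and>
     (\<forall>x. x \<noteq> 0 \<longrightarrow> 0 \<le> f x) \<and>
     F = density (restrict_space lborel (- {0})) (\<lambda>x. ennreal (f x))"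


section \<open>Gaussian random fields\<close>

text \<open>The degenerate law at 0 counts as Gaussian.\<close>

definition centered_gaussian_rv :: "'w measure \<Rightarrow> ('w \<Rightarrow> real) \<Rightarrow> bool" where
  "centered_gaussian_rv M Y \<longleftrightarrow>
     Y \<in> borel_measurable M \<and>
     ((AE w in M. Y w = 0) \<or>
      (\<exists>\<sigma>>0. distributed M lborel Y (\<lambda>x. ennreal (normal_density 0 \<sigma> x))))"

definition centered_gaussian_field :: "'w measure \<Rightarrow> ('t \<Rightarrow> 'w \<Rightarrow> real) \<Rightarrow> bool" where
  "centered_gaussian_field M X \<longleftrightarrow>
     prob_space M \<and>
     (\<forall>t. X t \<in> borel_measurable M) \<and>
     (\<forall>T a. finite T \<longrightarrow> centered_gaussian_rv M (\<lambda>w. \<Sum>t\<in>T. a t * X t w))"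

definition stationary_increments_GRF ::
  "'w measure \<Rightarrow> (real ^ 'n \<Rightarrow> 'w \<Rightarrow> real) \<Rightarrow> (real ^ 'n) measure \<Rightarrow> bool" where
  "stationary_increments_GRF M X F \<longleftrightarrow>
     centered_gaussian_field M X \<and>
     (AE w in M. X 0 w = 0) \<and>
     (\<forall>t s. complex_of_real (LINT w|M. X t w * X s w) =
        (LINT x|F. (exp (\<i> * complex_of_real (t \<bullet> x)) - 1) *
                   (exp (- \<i> * complex_of_real (s \<bullet> x)) - 1)))"

text \<open>
  Functions on \<open>D\<close> are represented by their extensional extensions, so the law of the
  field on \<open>D\<close> lives on the product space over \<open>D\<close>, whose sigma-algebra is
  the one generated by the cylinder sets. The two fields may be defined on different
  probability spaces.
\<close>

definition field_law :: "'w measure \<Rightarrow> ('t \<Rightarrow> 'w \<Rightarrow> real) \<Rightarrow> 't set \<Rightarrow> ('t \<Rightarrow> real) measure" where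
  "field_law M X D = distr M (PiM D (\<lambda>_. borel)) (\<lambda>w. \<lambda>t\<in>D. X t w)"

definition equivalent_on ::
  "'t set \<Rightarrow> 'v measure \<Rightarrow> ('t \<Rightarrow> 'v \<Rightarrow> real) \<Rightarrow> 'w measure \<Rightarrow> ('t \<Rightarrow> 'w \<Rightarrow> real) \<Rightarrow> bool" where
  "equivalent_on D M X N Y \<longleftrightarrow>
     absolutely_continuous (field_law M X D) (field_law N Y D) \<and>
     absolutely_continuous (field_law N Y D) (field_law M X D)"

definition locally_equivalent ::
  "'v measure \<Rightarrow> (real ^ 'n \<Rightarrow> 'v \<Rightarrow> real) \<Rightarrow> 'w measure \<Rightarrow> (real ^ 'n \<Rightarrow> 'w \<Rightarrow> real) \<Rightarrow> bool" where
  "locally_equivalent M X N Y \<longleftrightarrow> (\<forall>D. bounded D \<longrightarrow> equivalent_on D M X N Y)"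


section \<open>Entire functions of finite exponential type\<close>

text \<open>Holomorphy in several variables: a complex-linear Frechet derivative at every point.\<close>

definition entire :: "(complex ^ 'n \<Rightarrow> complex) \<Rightarrow> bool" where
  "entire \<phi> \<longleftrightarrow>
     (\<forall>z. \<exists>L. (\<phi> has_derivative L) (at z) \<and> (\<forall>c v. L (c *s v) = c * L v))"

text \<open>Unlike \<^const>\<open>ln\<close>, this has value \<open>-\<infinity>\<close> at 0.\<close>

definition log_norm :: "complex \<Rightarrow> ereal" where
  "log_norm z = (if z = 0 then - \<infinity> else ereal (ln (norm z)))"

definition finite_exponential_type :: "(complex ^ 'n \<Rightarrow> complex) \<Rightarrow> bool" where
  "finite_exponential_type \<phi> \<longleftrightarrow>
     Limsup at_top (\<lambda>r::real. ereal (1 / r) * (SUP z\<in>sphere 0 r. log_norm (\<phi> z))) < \<infinity>"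

definition of_real_vec :: "real ^ 'n \<Rightarrow> complex ^ 'n" where
  "of_real_vec x = (\<chi> i. complex_of_real (x $ i))"

definition asymp_at_infinity :: "(real ^ 'n \<Rightarrow> real) \<Rightarrow> (real ^ 'n \<Rightarrow> real) \<Rightarrow> bool" where
  "asymp_at_infinity f g \<longleftrightarrow>
     (\<exists>c1>0. \<exists>c2>0. \<exists>R>0. \<forall>x. norm x > R \<longrightarrow> c1 * g x \<le> f x \<and> f x \<le> c2 * g x)"

end

theory Submission
  imports Defs "HOL-Complex_Analysis.Complex_Analysis" "HOL-Real_Asymp.Real_Asymp"
begin

text \<open>
  Fix a ball containing \<open>D\<close>. The linear functionals of the fields with parameters in the ball
  correspond to trigonometric polynomials, and their variances to the squared norms in \<open>L\<^sup>2(F0)\<close> and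
  \<open>L\<^sup>2(F1)\<close>. Multiplying a trigonometric polynomial by \<open>\<phi>0\<close> gives an entire function of bounded
  exponential type, so its square is bounded pointwise by its \<open>L\<^sup>2(F0)\<close> norm: the reproducing kernel
  \<open>S(x, x)\<close> satisfies \<open>S(x, x) f0(x) \<le> C\<close> at infinity, and the lower bound on \<open>f0\<close> gives
  \<open>S(x, x) \<le> C |x|\<^sup>2\<close> on bounded sets. The square integrability of \<open>(f1 - f0) / f0\<close> then makes the
  difference of the two forms Hilbert--Schmidt with respect to the first, while positivity of \<open>f1\<close> makes the
  two norms equivalent. After simultaneous diagonalization of the covariances of finitely many field values, the
  two laws are products of one-dimensional normal laws with variances \<open>1\<close> and \<open>\<sigma> i\<close>, where
  \<open>\<sigma> i\<close> lies in a fixed interval and \<open>\<Sum>i. (\<sigma> i - 1)\<^sup>2\<close> is bounded. Hence absolute continuity holds with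
  constants uniform over all cylinder sets, and it extends to the generated sigma-algebra by approximation.
\<close>


section \<open>Functions of exponential type\<close>

text \<open>The obstacle is uniformity: constants must not depend on the finite set
  \<open>T\<close>, the coefficients or the number of coordinates, since cylinder sets of all
  dimensions are compared at once. The growth bound of a trigonometric polynomial contains the sum
  of the \<open>\<bar>c t\<bar>\<close>; the estimates for exponential type use such a prefactor
  only as a finiteness condition, and only the type, fixed by the radius of the ball, survives. A
  second obstacle is the origin: \<open>f0\<close> is bounded below only for
  \<open>norm x > k0\<close>, so the L2 norm does not directly see the polynomial there, and a bound
  must be carried across this gap. Spectral measures integrate only \<open>(norm x)\<^sup>2\<close>
  near 0, so a factor \<open>norm x\<close> has to be gained from the vanishing of the polynomial at
  0. Far out no polynomial loss is allowed: multiplication by the entire function turns the weight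
  into Lebesgue measure, whose translation invariance gives a bound uniform in the point. For the
  laws, the first-order terms in \<open>\<sigma> i - 1\<close> cancel in a fractional moment of the
  likelihood ratio, which is why only the sum of squares matters.\<close>

text \<open>The sector has opening pi/2, hence critical order 2, while \<open>F\<close> grows with
  order 1. Damping by \<open>exp (- \<epsilon> * (w + 1) powr (3/2))\<close> makes the arc of a
  large disc harmless, the maximum principle applies to the truncated sector, and
  \<open>\<epsilon>\<close> tends to 0.\<close>

lemma phragmen_lindelof_sector:
  fixes F :: "complex \<Rightarrow> complex"
  assumes hol: "F holomorphic_on {w. \<bar>Im w\<bar> < Re w}"
    and cont: "continuous_on {w. \<bar>Im w\<bar> \<le> Re w} F"
    and growth: "\<And>w. \<bar>Im w\<bar> \<le> Re w \<Longrightarrow> norm (F w) \<le> A * exp (\<tau> * norm w)"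
    and bd: "\<And>w. \<bar>Im w\<bar> = Re w \<Longrightarrow> norm (F w) \<le> M"
    and M: "M > 0" and w0: "\<bar>Im w0\<bar> \<le> Re w0"
  shows "norm (F w0) \<le> M"
proof -
  define c where "c = cos (3 * pi / 8)"
  have c0: "c > 0" unfolding c_def by (rule cos_gt_zero) (use pi_gt_zero in auto)
  \<comment> \<open>An exponent strictly between the growth order 1 and the critical order 2:
    \<open>3/2 * pi/4 = 3 * pi/8\<close> is below pi/2, so the real part of \<open>P\<close> stays
    positive. The shift by 1 keeps the base off the branch cut at the vertex.\<close>
  define P where "P = (\<lambda>w::complex. (w + 1) powr (of_real (3/2)))"
  have ReP: "Re (P w) \<ge> c * norm w powr (3/2)" if w: "\<bar>Im w\<bar> \<le> Re w" for w
  proof -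
    have nz: "w + 1 \<noteq> 0" using w by (auto simp: complex_eq_iff)
    have re: "Re (w+1) > 0" using w by auto
    have arg: "\<bar>Arg (w+1)\<bar> \<le> pi/4"
    proof -
      have "Arg (w+1) = arctan (Im (w+1) / Re (w+1))"
        using re by (rule arg_conv_arctan)
      moreover have "\<bar>Im (w+1) / Re (w+1)\<bar> \<le> 1"
        using w re by (auto simp: divide_simps abs_if split: if_splits)
      ultimately show ?thesis
        using arctan_le_iff[of "Im (w+1) / Re (w+1)" 1] arctan_le_iff[of "-1" "Im (w+1) / Re (w+1)"]
        unfolding arctan_minus arctan_one by linarith
    qed
    have "Re (P w) = norm (w+1) powr (3/2) * cos (3/2 * Arg (w+1))"
      using nz unfolding P_def powr_def
      by (simp add: Re_exp Ln_Arg exp_of_real[symmetric] algebra_simps powr_def del: exp_of_real)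
    moreover have "cos (3/2 * Arg (w+1)) \<ge> c"
    proof -
      have "\<bar>3/2 * Arg (w+1)\<bar> \<le> 3*pi/8" using arg by (simp add: abs_mult)
      hence "cos (3*pi/8) \<le> cos \<bar>3/2 * Arg (w+1)\<bar>"
        by (intro cos_monotone_0_pi_le) auto
      thus ?thesis unfolding c_def cos_abs_real .
    qed
    moreover have "norm w \<le> norm (w+1)"
      unfolding cmod_def using w by (intro real_sqrt_le_mono) (auto simp: power2_eq_square algebra_simps)
    hence "norm w powr (3/2) \<le> norm (w+1) powr (3/2)" by (intro powr_mono2) auto
    ultimately show ?thesis
      using c0 mult_mono[of "norm w powr (3/2)" "norm (w+1) powr (3/2)" c "cos (3/2 * Arg (w+1))"]
      by (simp add: mult.commute)
  qed
  have key: "norm (F w0) * exp (- \<epsilon> * Re (P w0)) \<le> M" if e: "\<epsilon> > 0" for \<epsilon>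
  proof -
    have "((\<lambda>R. A * exp (\<tau> * R) * exp (- \<epsilon> * c * R powr (3/2))) \<longlongrightarrow> 0) at_top"
    proof -
      have "\<epsilon> * c > 0" using e c0 by simp
      moreover have "((\<lambda>R. exp (\<tau> * R - d * R powr (3/2))) \<longlongrightarrow> 0) at_top" if "d > 0" for \<tau> d :: real
        using that by real_asymp
      ultimately have "((\<lambda>R. exp (\<tau> * R - (\<epsilon> * c) * R powr (3/2))) \<longlongrightarrow> 0) at_top" for \<tau>
        by blast
      from tendsto_mult_right_zero[OF this, of A \<tau>] show ?thesis
        by (simp add: mult.assoc mult_exp_exp)
    qed
    hence "eventually (\<lambda>R. A * exp (\<tau> * R) * exp (- \<epsilon> * c * R powr (3/2)) < M) at_top"
      using M by (rule order_tendstoD)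
    moreover have "eventually (\<lambda>R. R > norm w0) at_top" by (rule eventually_gt_at_top)
    ultimately have "eventually (\<lambda>R. R > norm w0 \<and> A * exp (\<tau> * R) * exp (- \<epsilon> * c * R powr (3/2)) < M) at_top"
      by eventually_elim auto
    then obtain R where R: "R > norm w0" "A * exp (\<tau> * R) * exp (- \<epsilon> * c * R powr (3/2)) < M"
      using eventually_happens'[OF trivial_limit_at_top_linorder] by blast
    define S where "S = {w. \<bar>Im w\<bar> \<le> Re w} \<inter> cball 0 R"
    define E where "E = (\<lambda>w. F w * exp (- of_real \<epsilon> * P w))"
    have nE: "norm (E w) = norm (F w) * exp (- \<epsilon> * Re (P w))" for w
      unfolding E_def by (simp add: norm_mult)
    have clS: "closed S" unfolding S_def
      by (intro closed_Int closed_cball closed_Collect_le continuous_intros)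
    have opn: "open {w. \<bar>Im w\<bar> < Re w}"
      by (intro open_Collect_less continuous_intros)
    have int: "interior S \<subseteq> {w. \<bar>Im w\<bar> < Re w}"
    proof
      fix w assume "w \<in> interior S"
      then obtain r where r: "r > 0" "cball w r \<subseteq> S" by (auto simp: mem_interior_cball)
      have "w - of_real r \<in> cball w r" using r by (simp add: dist_norm)
      with r have "w - of_real r \<in> S" by auto
      thus "w \<in> {w. \<bar>Im w\<bar> < Re w}" using r by (auto simp: S_def)
    qed
    have dom: "w + 1 \<notin> \<real>\<^sub>\<le>\<^sub>0" if "\<bar>Im w\<bar> \<le> Re w" for w
      using that by (auto simp: complex_nonpos_Reals_iff)
    have "norm (E w0) \<le> M"
    proof (rule maximum_modulus_frontier[of E S])
      show "E holomorphic_on interior S"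
        unfolding E_def P_def using int dom
        by (intro holomorphic_intros holomorphic_on_subset[OF hol]) auto
      have "continuous_on S F" by (rule continuous_on_subset[OF cont]) (auto simp: S_def)
      moreover have "continuous_on S P" unfolding P_def
        by (intro continuous_intros) (use dom in \<open>auto simp: S_def\<close>)
      ultimately show "continuous_on (closure S) E"
        unfolding E_def using clS by (simp add: continuous_intros)
      show "bounded S" unfolding S_def by (simp add: bounded_Int)
      show "w0 \<in> S" using R w0 by (auto simp: S_def)
    next
      fix z assume z: "z \<in> frontier S"
      have zS: "z \<in> S" using z clS frontier_subset_closed by blast
      have zA: "\<bar>Im z\<bar> \<le> Re z" using zS by (auto simp: S_def)
      have Pz: "Re (P z) \<ge> c * norm z powr (3/2)" using ReP[OF zA] .
      have "\<not> (\<bar>Im z\<bar> < Re z \<and> norm z < R)"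
      proof
        assume *: "\<bar>Im z\<bar> < Re z \<and> norm z < R"
        have "z \<in> {w. \<bar>Im w\<bar> < Re w} \<inter> ball 0 R" using * by auto
        moreover have "{w. \<bar>Im w\<bar> < Re w} \<inter> ball 0 R \<subseteq> S" by (auto simp: S_def)
        ultimately have "z \<in> interior S" using opn by (meson interior_maximal open_Int open_ball subsetD)
        thus False using z by (simp add: frontier_def)
      qed
      then consider "\<bar>Im z\<bar> = Re z" | "norm z = R" using zS by (force simp: S_def)
      thus "norm (E z) \<le> M"
      proof cases
        case 1
        have "exp (- \<epsilon> * Re (P z)) \<le> 1" using Pz e c0
          by (smt (verit) exp_le_one_iff mult_minus_left powr_ge_zero zero_le_mult_iff)
        hence "norm (F z) * exp (- \<epsilon> * Re (P z)) \<le> norm (F z) * 1"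
          by (intro mult_left_mono) auto
        thus ?thesis using bd[OF 1] nE by simp
      next
        case 2
        have "\<epsilon> * (c * R powr (3/2)) \<le> \<epsilon> * Re (P z)" using Pz 2 e by (intro mult_left_mono) auto
        hence "exp (- \<epsilon> * Re (P z)) \<le> exp (- \<epsilon> * c * R powr (3/2))" by simp
        moreover have "norm (F z) \<le> A * exp (\<tau> * R)" using growth[OF zA] 2 by simp
        ultimately have "norm (E z) \<le> A * exp (\<tau> * R) * exp (- \<epsilon> * c * R powr (3/2))"
          unfolding nE by (intro mult_mono) (auto intro: order_trans[OF norm_ge_zero])
        thus ?thesis using R by simp
      qed
    qed
    thus ?thesis using nE by simp
  qed
  have "((\<lambda>\<epsilon>. norm (F w0) * exp (- \<epsilon> * Re (P w0))) \<longlongrightarrow> norm (F w0) * exp (- 0 * Re (P w0))) (at_right 0)"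
    by (intro tendsto_intros)
  moreover have "eventually (\<lambda>\<epsilon>. norm (F w0) * exp (- \<epsilon> * Re (P w0)) \<le> M) (at_right 0)"
    using eventually_at_right_less[of 0] by eventually_elim (rule key)
  ultimately have "norm (F w0) * exp (- 0 * Re (P w0)) \<le> M"
    by (rule tendsto_upperbound) simp
  thus ?thesis by simp
qed

text \<open>The factor \<open>exp (\<i> * \<tau> * w)\<close> has modulus
  \<open>exp (- \<tau> * Im w)\<close>, which cancels the growth on the imaginary axis. Each
  quadrant is a sector of opening pi/2, which gives boundedness with a constant depending on
  \<open>A\<close>; a second maximum principle then replaces this constant by \<open>M\<close>. The
  disappearance of \<open>A\<close> is the point of the lemma.\<close>

lemma phragmen_lindelof_halfplane:
  fixes F :: "complex \<Rightarrow> complex"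
  assumes hol: "F holomorphic_on {w. Im w > 0}"
    and cont: "continuous_on {w. Im w \<ge> 0} F"
    and growth: "\<And>w. Im w \<ge> 0 \<Longrightarrow> norm (F w) \<le> A * exp (\<tau> * norm w)"
    and bd: "\<And>x. norm (F (of_real x)) \<le> M"
    and M: "M > 0" and tau: "\<tau> \<ge> 0" and w0: "Im w0 \<ge> 0"
  shows "norm (F w0) \<le> M * exp (\<tau> * Im w0)"
proof -
  define G where "G = (\<lambda>w. F w * exp (\<i> * of_real \<tau> * w))"
  have nG: "norm (G w) = norm (F w) * exp (- \<tau> * Im w)" for w
    unfolding G_def by (simp add: norm_mult)
  have A0: "A \<ge> 0" using growth[of 0] by (simp add: order_trans[OF norm_ge_zero])
  have holG: "G holomorphic_on {w. Im w > 0}" unfolding G_def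
    by (intro holomorphic_intros hol)
  have contG: "continuous_on {w. Im w \<ge> 0} G" unfolding G_def
    by (intro continuous_intros cont)
  have Gle: "norm (G w) \<le> norm (F w)" if "Im w \<ge> 0" for w
    unfolding nG using that tau by (intro mult_right_le_one_le) auto
  have growthG: "norm (G w) \<le> A * exp (\<tau> * norm w)" if "Im w \<ge> 0" for w
    using Gle[OF that] growth[OF that] by linarith
  have bdG: "norm (G (of_real x)) \<le> M" for x using bd[of x] Gle[of "of_real x"] by simp
  have imG: "norm (G (\<i> * of_real y)) \<le> A" if "y \<ge> 0" for y
  proof -
    have "norm (G (\<i> * of_real y)) \<le> (A * exp (\<tau> * y)) * exp (- \<tau> * y)"
      unfolding nG using growth[of "\<i> * of_real y"] that by (intro mult_mono) (auto simp: norm_mult A0)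
    thus ?thesis by (simp add: mult.assoc mult_exp_exp)
  qed
  define K where "K = max A M"
  have K0: "K > 0" using M by (simp add: K_def)
  \<comment> \<open>Multiplication by \<open>1 + \<i>\<close> or \<open>-1 + \<i>\<close> turns the
    sector around the positive axis into the right or left quadrant of the upper half-plane.\<close>
  have sector: "norm (G (d * z)) \<le> K"
    if d: "d = 1 + \<i> \<or> d = -1 + \<i>" and z: "\<bar>Im z\<bar> \<le> Re z" for d z
  proof (rule phragmen_lindelof_sector[of "\<lambda>z. G (d * z)" A "\<tau> * norm d" K z, OF _ _ _ _ K0 z])
    have Im0: "Im (d * z) > 0" if "\<bar>Im z\<bar> < Re z" for z using d that by (auto simp: abs_less_iff)
    have Im1: "Im (d * z) \<ge> 0" if "\<bar>Im z\<bar> \<le> Re z" for z using d that by (auto simp: abs_le_iff)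
    show "(\<lambda>z. G (d * z)) holomorphic_on {w. \<bar>Im w\<bar> < Re w}"
      using Im0 by (intro holomorphic_on_compose_gen[of "\<lambda>z. d * z" _ G "{w. Im w > 0}", unfolded o_def] holomorphic_intros holG) auto
    show "continuous_on {w. \<bar>Im w\<bar> \<le> Re w} (\<lambda>z. G (d * z))"
      using Im1 by (intro continuous_on_compose2[OF contG] continuous_intros) auto
    show "norm (G (d * w)) \<le> A * exp (\<tau> * norm d * norm w)" if "\<bar>Im w\<bar> \<le> Re w" for w
      using growthG[OF Im1[OF that]] by (simp add: norm_mult mult.assoc)
    show "norm (G (d * w)) \<le> K" if w: "\<bar>Im w\<bar> = Re w" for w
    proof -
      have "Im (d * w) = 0 \<or> Re (d * w) = 0" using d w by (auto simp: abs_if split: if_splits)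
      thus ?thesis
      proof
        assume "Im (d * w) = 0"
        hence "d * w = of_real (Re (d * w))" by (simp add: complex_eq_iff)
        thus ?thesis using bdG[of "Re (d * w)"] unfolding K_def by simp
      next
        assume "Re (d * w) = 0"
        hence "d * w = \<i> * of_real (Im (d * w))" by (simp add: complex_eq_iff)
        thus ?thesis using imG[of "Im (d * w)"] Im1[of w] w unfolding K_def by simp
      qed
    qed
  qed
  have GK: "norm (G w) \<le> K" if w: "Im w \<ge> 0" for w
  proof (cases "Re w \<ge> 0")
    case True
    define z where "z = w / (1 + \<i>)"
    have nz: "1 + \<i> \<noteq> 0" by (simp add: complex_eq_iff)
    have "z = Complex ((Re w + Im w)/2) ((Im w - Re w)/2)"
      unfolding z_def using nz by (simp add: divide_eq_eq) (simp add: complex_eq_iff field_simps)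
    hence "\<bar>Im z\<bar> \<le> Re z" using w True by (auto simp: abs_le_iff)
    from sector[OF _ this, of "1 + \<i>"] show ?thesis using nz by (simp add: z_def)
  next
    case False
    define z where "z = w / (-1 + \<i>)"
    have nz: "-1 + \<i> \<noteq> 0" by (simp add: complex_eq_iff)
    have "z = Complex ((Im w - Re w)/2) ((- Re w - Im w)/2)"
      unfolding z_def using nz by (simp add: divide_eq_eq) (simp add: complex_eq_iff field_simps)
    hence "\<bar>Im z\<bar> \<le> Re z" using w False by (auto simp: abs_le_iff)
    from sector[OF _ this, of "-1 + \<i>"] show ?thesis using nz by (simp add: z_def)
  qed
  have key: "norm (G w0) \<le> M * norm (1 - \<i> * of_real \<epsilon> * w0)" if e: "\<epsilon> > 0" for \<epsilon>
  proof -
    \<comment> \<open>\<open>q\<close> has modulus at least 1 on the closed upper half-plane and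
      grows linearly, so division by it beats the crude bound \<open>K\<close> on a large arc and
      does not increase the boundary values on the real line.\<close>
    define q where "q = (\<lambda>w. 1 - \<i> * of_real \<epsilon> * w)"
    have req: "Re (q w) \<ge> 1" if "Im w \<ge> 0" for w using that e by (simp add: q_def)
    have q1: "norm (q w) \<ge> 1" if "Im w \<ge> 0" for w using req[OF that] complex_Re_le_cmod[of "q w"] by linarith
    have q0: "q w \<noteq> 0" if "Im w \<ge> 0" for w using q1[OF that] by auto
    \<comment> \<open>On the arc \<open>norm (q z) \<ge> \<epsilon> * R - 1\<close>, which this
      radius makes at least \<open>K / M\<close>.\<close>
    define R where "R = norm w0 + (K / M + 1) / \<epsilon>"
    have R: "R \<ge> norm w0" "\<epsilon> * R \<ge> K / M + 1"
    proof -
      have "\<epsilon> * R = \<epsilon> * norm w0 + \<epsilon> * ((K / M + 1) / \<epsilon>)" by (simp only: R_def distrib_left)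
      also have "\<epsilon> * ((K / M + 1) / \<epsilon>) = K / M + 1" using e by simp
      finally show "\<epsilon> * R \<ge> K / M + 1" using e by simp
      show "R \<ge> norm w0" using e K0 M by (simp add: R_def)
    qed
    define S where "S = {w. Im w \<ge> 0} \<inter> cball 0 R"
    have clS: "closed S" unfolding S_def
      by (intro closed_Int closed_cball closed_Collect_le continuous_intros)
    have opn: "open {w. Im w > 0}" by (intro open_Collect_less continuous_intros)
    have int: "interior S \<subseteq> {w. Im w > 0}"
    proof
      fix w assume "w \<in> interior S"
      then obtain r where r: "r > 0" "cball w r \<subseteq> S" by (auto simp: mem_interior_cball)
      have "w - \<i> * of_real r \<in> cball w r" using r by (simp add: dist_norm norm_mult)
      with r have "w - \<i> * of_real r \<in> S" by auto
      thus "w \<in> {w. Im w > 0}" using r by (auto simp: S_def)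
    qed
    have "norm (G w0 / q w0) \<le> M"
    proof (rule maximum_modulus_frontier[of "\<lambda>w. G w / q w" S])
      show "(\<lambda>w. G w / q w) holomorphic_on interior S"
      proof (intro holomorphic_intros holomorphic_on_subset[OF holG int])
        show "q holomorphic_on interior S" unfolding q_def by (intro holomorphic_intros)
        show "\<And>z. z \<in> interior S \<Longrightarrow> q z \<noteq> 0" using int q0 by force
      qed
      have "continuous_on S G" by (rule continuous_on_subset[OF contG]) (auto simp: S_def)
      moreover have "continuous_on S q" unfolding q_def by (intro continuous_intros)
      ultimately show "continuous_on (closure S) (\<lambda>w. G w / q w)"
        using clS q0 by (auto intro!: continuous_intros simp: S_def)
      show "bounded S" unfolding S_def by (simp add: bounded_Int)
      show "w0 \<in> S" using R w0 by (auto simp: S_def)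
    next
      fix z assume z: "z \<in> frontier S"
      have zS: "z \<in> S" using z clS frontier_subset_closed by blast
      hence im: "Im z \<ge> 0" by (auto simp: S_def)
      have "\<not> (Im z > 0 \<and> norm z < R)"
      proof
        assume *: "Im z > 0 \<and> norm z < R"
        have "z \<in> {w. Im w > 0} \<inter> ball 0 R" using * by auto
        moreover have "{w. Im w > 0} \<inter> ball 0 R \<subseteq> S" by (auto simp: S_def)
        ultimately have "z \<in> interior S" using opn by (meson interior_maximal open_Int open_ball subsetD)
        thus False using z by (simp add: frontier_def)
      qed
      then consider "Im z = 0" | "norm z = R" using zS by (force simp: S_def)
      thus "norm (G z / q z) \<le> M"
      proof cases
        case 1
        hence "z = of_real (Re z)" by (simp add: complex_eq_iff)
        hence "norm (G z) \<le> M" using bdG[of "Re z"] by simp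
        moreover have "norm (G z) / norm (q z) \<le> norm (G z) / 1"
          using q1[OF im] by (intro divide_left_mono) auto
        ultimately show ?thesis by (simp add: norm_divide)
      next
        case 2
        have "norm (q z) \<ge> norm (\<i> * of_real \<epsilon> * z) - 1"
          unfolding q_def using norm_triangle_ineq2[of "\<i> * of_real \<epsilon> * z" 1] by (simp add: norm_minus_commute)
        moreover have "norm (\<i> * of_real \<epsilon> * z) = \<epsilon> * R" using 2 e by (simp add: norm_mult)
        ultimately have "norm (q z) \<ge> K / M" using R by linarith
        hence "M * norm (q z) \<ge> K" using M by (simp add: divide_simps mult.commute split: if_splits)
        hence "norm (G z) \<le> M * norm (q z)" using GK[OF im] by linarith
        thus ?thesis using q0[OF im] by (simp add: norm_divide divide_simps)
      qed
    qed
    thus ?thesis using q0[OF w0] by (simp add: norm_divide divide_simps q_def split: if_splits)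
  qed
  have "((\<lambda>\<epsilon>. M * norm (1 - \<i> * of_real \<epsilon> * w0)) \<longlongrightarrow> M * norm (1 - \<i> * of_real 0 * w0)) (at_right 0)"
    by (intro tendsto_intros)
  moreover have "eventually (\<lambda>\<epsilon>. norm (G w0) \<le> M * norm (1 - \<i> * of_real \<epsilon> * w0)) (at_right 0)"
    using eventually_at_right_less[of 0] by eventually_elim (rule key)
  ultimately have "norm (G w0) \<le> M * norm (1 - \<i> * of_real 0 * w0)"
    by (rule tendsto_lowerbound) simp
  hence "norm (F w0) * exp (- \<tau> * Im w0) \<le> M" using nG by simp
  hence "norm (F w0) * exp (- \<tau> * Im w0) * exp (\<tau> * Im w0) \<le> M * exp (\<tau> * Im w0)"
    by (intro mult_right_mono) auto
  thus ?thesis by (simp add: mult.assoc mult_exp_exp)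
qed

text \<open>The half-plane estimate is applied to
  \<open>(w / (w + e)) ^ m * H w / (w + e) ^ N\<close>, whose pole \<open>- e\<close> lies below the
  real axis. The division by \<open>(w + e) ^ N\<close> absorbs the polynomial growth. The power
  \<open>m\<close> gains \<open>3/4\<close> per factor on the uncontrolled segment, where the ratio
  is at most \<open>1 / sqrt 2\<close>, and costs \<open>5/4\<close> per factor when it is undone on
  the circle of radius \<open>4 * r\<close>.\<close>

lemma exp_type_bound_upper:
  fixes H :: "complex \<Rightarrow> complex"
  assumes hol: "H holomorphic_on UNIV"
    and growth: "\<And>w. norm (H w) \<le> A * exp (\<tau> * norm w)"
    and r: "r > 0" and B: "B > 0" and tau: "\<tau> \<ge> 0"
    and bd: "\<And>x. \<bar>x\<bar> \<ge> r \<Longrightarrow> norm (H (of_real x)) \<le> B * \<bar>x\<bar> ^ N"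
    and S: "\<And>x. \<bar>x\<bar> \<le> r \<Longrightarrow> norm (H (of_real x)) \<le> S"
    and w: "norm w = 4 * r" "Im w \<ge> 0"
  shows "norm (H w) \<le> (5 * r) ^ N * exp (4 * r * \<tau>) * ((5/4) ^ m * B + (5/4) ^ m * (3/4) ^ m * S / r ^ N)"
proof -
  define e where "e = \<i> * complex_of_real r"
  define F where "F = (\<lambda>w. (w / (w + e)) ^ m * H w / (w + e) ^ N)"
  have S0: "S \<ge> 0" using S[of 0] r by (simp add: order_trans[OF norm_ge_zero])
  have ne: "norm (w + e) \<ge> r" if "Im w \<ge> 0" for w
    using abs_Im_le_cmod[of "w + e"] that r by (simp add: e_def)
  have nz: "w + e \<noteq> 0" if "Im w \<ge> 0" for w using ne[OF that] r by auto
  have le1: "norm (w / (w + e)) \<le> 1" if "Im w \<ge> 0" for w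
  proof -
    have "norm w \<le> norm (w + e)" unfolding cmod_def using that r
      by (intro real_sqrt_le_mono) (auto simp: e_def power2_eq_square algebra_simps)
    thus ?thesis using nz[OF that] by (simp add: norm_divide divide_simps)
  qed
  have nF: "norm (F w) = norm (w / (w + e)) ^ m * norm (H w) / norm (w + e) ^ N" for w
    by (simp add: F_def norm_mult norm_divide norm_power)
  define M where "M = B + (3/4) ^ m * S / r ^ N"
  have M0: "M > 0" using B S0 r by (simp add: M_def add_pos_nonneg)
  have "norm (F w) \<le> M * exp (\<tau> * Im w)"
  proof (rule phragmen_lindelof_halfplane[of F "A / r ^ N" \<tau> M])
    show "F holomorphic_on {w. Im w > 0}" unfolding F_def
      by (intro holomorphic_intros holomorphic_on_subset[OF hol]) (use nz in auto)
    show "continuous_on {w. 0 \<le> Im w} F" unfolding F_def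
      by (intro continuous_intros continuous_on_subset[OF holomorphic_on_imp_continuous_on[OF hol]])
         (use nz in auto)
    show "norm (F w) \<le> A / r ^ N * exp (\<tau> * norm w)" if "Im w \<ge> 0" for w
    proof -
      have "norm (w / (w + e)) ^ m * norm (H w) \<le> 1 * (A * exp (\<tau> * norm w))"
        using le1[OF that] growth[of w] by (intro mult_mono power_le_one) auto
      moreover have "r ^ N \<le> norm (w + e) ^ N" using ne[OF that] r by (intro power_mono) auto
      ultimately have "norm (F w) \<le> 1 * (A * exp (\<tau> * norm w)) / r ^ N" unfolding nF
        using r by (intro frac_le) (auto intro: order_trans[OF norm_ge_zero growth])
      thus ?thesis by simp
    qed
    show "norm (F (of_real x)) \<le> M" for x
    proof (cases "\<bar>x\<bar> \<ge> r")
      case True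
      have "norm (of_real x / (of_real x + e)) ^ m * norm (H (of_real x)) \<le> 1 * (B * \<bar>x\<bar> ^ N)"
        using le1[of "of_real x"] bd[OF True] by (intro mult_mono power_le_one) auto
      moreover have "\<bar>x\<bar> ^ N \<le> norm (of_real x + e) ^ N"
        using abs_Re_le_cmod[of "of_real x + e"] by (intro power_mono) (auto simp: e_def)
      moreover have "\<bar>x\<bar> ^ N > 0" using True r by auto
      ultimately have "norm (F (of_real x)) \<le> 1 * (B * \<bar>x\<bar> ^ N) / \<bar>x\<bar> ^ N" unfolding nF
        using B by (intro frac_le) auto
      also have "\<dots> = B" using \<open>\<bar>x\<bar> ^ N > 0\<close> by simp
      also have "B \<le> M" using S0 r by (simp add: M_def)
      finally show ?thesis .
    next
      case False
      have "norm (of_real x / (of_real x + e)) \<le> 3/4"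
      proof -
        have "x\<^sup>2 \<le> r\<^sup>2" using False r by (simp add: abs_le_square_iff[symmetric])
        moreover have "(4/3 * \<bar>x\<bar>)\<^sup>2 = 16/9 * x\<^sup>2" by (simp add: power_mult_distrib power_divide)
        ultimately have "(4/3 * \<bar>x\<bar>)\<^sup>2 \<le> x\<^sup>2 + r\<^sup>2" using zero_le_power2[of r] by linarith
        hence "4/3 * \<bar>x\<bar> \<le> sqrt (x\<^sup>2 + r\<^sup>2)" by (rule real_le_rsqrt)
        moreover have "norm (of_real x + e) = sqrt (x\<^sup>2 + r\<^sup>2)" by (simp add: e_def cmod_def)
        moreover have "norm (of_real x + e) > 0" using nz[of "of_real x"] by simp
        ultimately show ?thesis by (simp add: norm_divide pos_divide_le_eq del: zero_less_norm_iff)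
      qed
      hence "norm (of_real x / (of_real x + e)) ^ m * norm (H (of_real x)) \<le> (3/4)^m * S"
        using S[of x] False by (intro mult_mono power_mono) auto
      moreover have "r ^ N \<le> norm (of_real x + e) ^ N" using ne[of "of_real x"] r by (intro power_mono) auto
      ultimately have "norm (F (of_real x)) \<le> (3/4)^m * S / r ^ N" unfolding nF
        using r S0 by (intro frac_le) auto
      thus ?thesis using B by (simp add: M_def)
    qed
  qed (use M0 tau w in auto)
  moreover have "exp (\<tau> * Im w) \<le> exp (4 * r * \<tau>)"
    using abs_Im_le_cmod[of w] w tau mult_left_mono[of "Im w" "4 * r" \<tau>] by (simp add: mult.commute)
  ultimately have Fle: "norm (F w) \<le> M * exp (4 * r * \<tau>)"
    using M0 by (meson mult_left_mono less_imp_le order_trans)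
  have w0: "w \<noteq> 0" using w r by auto
  have nwe: "norm (w + e) \<le> 5 * r" using norm_triangle_ineq[of w e] w r by (simp add: e_def norm_mult)
  have "H w = F w * ((w + e) / w) ^ m * (w + e) ^ N"
    using nz[OF w(2)] w0 by (simp add: F_def power_divide)
  hence "norm (H w) = norm (F w) * (norm (w + e) / norm w) ^ m * norm (w + e) ^ N"
    by (simp add: norm_mult norm_power norm_divide)
  also have "\<dots> \<le> (M * exp (4 * r * \<tau>)) * (5/4) ^ m * (5 * r) ^ N"
  proof (intro mult_mono power_mono Fle nwe)
    show "norm (w + e) / norm w \<le> 5 / 4" using nwe w r by (simp add: divide_simps)
  qed (use M0 r in auto)
  finally show ?thesis by (simp add: M_def algebra_simps)
qed

text \<open>A crude but soft substitute for the harmonic measure of a gap: the maximum over the disc is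
  compared with itself, and the factor \<open>(w / (w + i r)) ^ m\<close> makes the contribution of the
  uncontrolled segment small because \<open>5/4 * 3/4 < 1\<close>.\<close>

lemma exp_type_bound:
  fixes \<tau> r :: real and N :: nat
  assumes r: "r > 0" and tau: "\<tau> \<ge> 0"
  obtains C where "C > 0"
    "\<And>(H :: complex \<Rightarrow> complex) A B w. H holomorphic_on UNIV \<Longrightarrow> (\<And>w. norm (H w) \<le> A * exp (\<tau> * norm w)) \<Longrightarrow> B \<ge> 0 \<Longrightarrow>
      (\<And>x. \<bar>x\<bar> \<ge> r \<Longrightarrow> norm (H (complex_of_real x)) \<le> B * \<bar>x\<bar> ^ N) \<Longrightarrow> norm w \<le> 4 * r \<Longrightarrow>
      norm (H w) \<le> C * B"
proof -
  define K where "K = 5 ^ N * exp (4 * r * \<tau>)"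
  \<comment> \<open>\<open>m\<close>, and with it \<open>C\<close>, depends only on
    \<open>r\<close>, \<open>\<tau>\<close> and \<open>N\<close>. The bound 1/2 lets the maximum
    \<open>S\<close> over the disc be absorbed into the left-hand side.\<close>
  have "((\<lambda>m. K * (15/16) ^ m) \<longlongrightarrow> K * 0) sequentially"
    by (intro tendsto_intros LIMSEQ_realpow_zero) auto
  hence "eventually (\<lambda>m. K * (15/16) ^ m < 1/2) sequentially"
    by (rule order_tendstoD) auto
  then obtain m where m: "K * (15/16) ^ m < 1/2" by (auto simp: eventually_sequentially)
  define C where "C = 2 * (K * r ^ N * (5/4) ^ m)"
  have C0: "C > 0" using r by (simp add: C_def K_def)
  have main: "norm (H w) \<le> C * B" if H: "H holomorphic_on UNIV" "\<And>w. norm (H w) \<le> A * exp (\<tau> * norm w)"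
    "B > 0" "\<And>x. \<bar>x\<bar> \<ge> r \<Longrightarrow> norm (H (complex_of_real x)) \<le> B * \<bar>x\<bar> ^ N" "norm w \<le> 4 * r"
    for H :: "complex \<Rightarrow> complex" and A B w
  proof -
    have contH: "continuous_on X H" for X
      using H(1) holomorphic_on_imp_continuous_on continuous_on_subset by blast
    have "\<exists>z\<in>cball 0 (4 * r). \<forall>y\<in>cball 0 (4 * r). norm (H y) \<le> norm (H z)"
      using r by (intro continuous_attains_sup continuous_intros contH) auto
    then obtain z where "z \<in> cball 0 (4 * r)" "\<forall>y\<in>cball 0 (4 * r). norm (H y) \<le> norm (H z)" by blast
    hence z: "\<And>y. norm y \<le> 4 * r \<Longrightarrow> norm (H y) \<le> norm (H z)" "norm z \<le> 4 * r" by simp_all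
    define S where "S = norm (H z)"
    \<comment> \<open>The estimate covers only the upper half of the circle; the reflected function
      transfers it to the lower half.\<close>
    have up: "norm (H' w) \<le> K * r ^ N * (5/4) ^ m * B + 1/2 * S"
      if "H' = H \<or> H' = (\<lambda>w. H (- w))" "norm w = 4 * r" "Im w \<ge> 0" for H' w
    proof -
      have "norm (H' w) \<le> (5 * r) ^ N * exp (4 * r * \<tau>) * ((5/4) ^ m * B + (5/4) ^ m * (3/4) ^ m * S / r ^ N)"
      proof (rule exp_type_bound_upper[of H' A \<tau> r B])
        show "H' holomorphic_on UNIV"
        proof -
          have "(\<lambda>w. H (- w)) holomorphic_on UNIV"
            by (rule holomorphic_on_compose_gen[of "\<lambda>w. - w" UNIV H UNIV, unfolded o_def])
               (auto intro!: holomorphic_intros H(1))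
          thus ?thesis using that(1) H(1) by auto
        qed
        show "norm (H' w) \<le> A * exp (\<tau> * norm w)" for w
          using that(1) H(2)[of w] H(2)[of "-w"] by auto
        show "norm (H' (of_real x)) \<le> B * \<bar>x\<bar> ^ N" if "r \<le> \<bar>x\<bar>" for x
          using \<open>H' = H \<or> _\<close> H(4)[of x] H(4)[of "-x"] that by auto
        show "norm (H' (of_real x)) \<le> S" if "\<bar>x\<bar> \<le> r" for x
          using \<open>H' = H \<or> _\<close> z(1)[of "of_real x"] z(1)[of "- of_real x"] that r by (auto simp: S_def)
      qed (use r tau H that in auto)
      also have "(5/4) ^ m * (3/4) ^ m = (15/16::real) ^ m" by (simp add: power_mult_distrib[symmetric])
      also have "(5 * r) ^ N * exp (4 * r * \<tau>) * ((5/4) ^ m * B + (15/16) ^ m * S / r ^ N)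
          = K * r ^ N * (5/4) ^ m * B + K * (15/16) ^ m * S"
        using r by (simp add: K_def power_mult_distrib distrib_left)
      also have "K * (15/16) ^ m * S \<le> 1/2 * S"
        using m by (intro mult_right_mono) (auto simp: S_def)
      finally show ?thesis by simp
    qed
    have circ: "norm (H w) \<le> K * r ^ N * (5/4) ^ m * B + 1/2 * S" if "norm w = 4 * r" for w
      using up[of H w] up[of "\<lambda>w. H (- w)" "- w"] that by (cases "Im w \<ge> 0") auto
    have "norm (H z) \<le> K * r ^ N * (5/4) ^ m * B + 1/2 * S"
    proof (rule maximum_modulus_frontier[of H "cball 0 (4 * r)"])
      show "norm (H w) \<le> K * r ^ N * (5/4) ^ m * B + 1/2 * S" if "w \<in> frontier (cball 0 (4 * r))" for w
        using circ that r by (auto simp: frontier_cball)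
    qed (use z contH holomorphic_on_subset[OF H(1)] in auto)
    hence "S \<le> C * B" by (simp add: S_def C_def)
    thus ?thesis using z(1)[OF H(5)] by (simp add: S_def)
  qed
  show thesis
  proof (rule that[OF C0])
    fix H :: "complex \<Rightarrow> complex" and A B and w :: complex
    assume H: "H holomorphic_on UNIV" "\<And>w. norm (H w) \<le> A * exp (\<tau> * norm w)"
      "B \<ge> 0" "\<And>x. \<bar>x\<bar> \<ge> r \<Longrightarrow> norm (H (complex_of_real x)) \<le> B * \<bar>x\<bar> ^ N" "norm w \<le> 4 * r"
    \<comment> \<open>The half-plane estimate needs a positive boundary bound, so
      \<open>B = 0\<close> is reached as a limit.\<close>
    have "norm (H w) \<le> C * (B + e)" if e: "e > 0" for e
    proof (rule main[OF H(1,2) _ _ H(5)])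
      show "norm (H (of_real x)) \<le> (B + e) * \<bar>x\<bar> ^ N" if "r \<le> \<bar>x\<bar>" for x
        using H(4)[OF that] e mult_right_mono[of B "B + e" "\<bar>x\<bar> ^ N"] by auto
    qed (use e H(3) in auto)
    note le = this
    show "norm (H w) \<le> C * B"
    proof (rule field_le_epsilon)
      fix e :: real assume "e > 0"
      thus "norm (H w) \<le> C * B + e" using le[of "e / C"] C0 by (simp add: distrib_left)
    qed
  qed
qed

section \<open>Holomorphic functions with a parameter and averages over dilated boxes\<close>

text \<open>Cauchy's inequality on unit circles bounds the difference of the derivatives for two
  parameters by the difference of the functions, which is small by uniform continuity on a compact
  set; the variation in \<open>w\<close> alone is the continuity of one holomorphic
  derivative.\<close>

lemma continuous_on_deriv_parameter:
  fixes G :: "complex \<Rightarrow> 'b::euclidean_space \<Rightarrow> complex"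
  assumes hol: "\<And>v. (\<lambda>w. G w v) holomorphic_on UNIV"
    and cont: "continuous_on UNIV (\<lambda>(w, v). G w v)"
  shows "continuous_on UNIV (\<lambda>(w, v). deriv (\<lambda>w. G w v) w)"
proof -
  have "isCont (\<lambda>(w, v). deriv (\<lambda>w. G w v) w) (w0, v0)" for w0 v0
    unfolding continuous_at_eps_delta
  proof (intro allI impI)
    fix e :: real assume e: "e > 0"
    have "isCont (deriv (\<lambda>w. G w v0)) w0"
      using holomorphic_deriv[OF hol[of v0]] holomorphic_on_imp_continuous_on continuous_on_eq_continuous_at open_UNIV
      by blast
    then obtain d1 where d1: "d1 > 0"
      "\<And>w. dist w w0 < d1 \<Longrightarrow> dist (deriv (\<lambda>w. G w v0) w) (deriv (\<lambda>w. G w v0) w0) < e/2"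
      using e unfolding continuous_at_eps_delta by (meson half_gt_zero)
    \<comment> \<open>Radius 2 leaves room for a centre at distance at most 1 from \<open>w0\<close>
      and a Cauchy circle of radius 1 around it.\<close>
    have "compact (cball w0 2 \<times> cball v0 1)" by (intro compact_Times) auto
    hence "uniformly_continuous_on (cball w0 2 \<times> cball v0 1) (\<lambda>(w, v). G w v)"
      by (intro compact_uniformly_continuous continuous_on_subset[OF cont]) auto
    then obtain d2 where d2: "d2 > 0"
      "\<And>p q. p \<in> cball w0 2 \<times> cball v0 1 \<Longrightarrow> q \<in> cball w0 2 \<times> cball v0 1 \<Longrightarrow> dist q p < d2 \<Longrightarrow>
         dist (case q of (w, v) \<Rightarrow> G w v) (case p of (w, v) \<Rightarrow> G w v) < e/4"
      using e unfolding uniformly_continuous_on_def by (metis zero_less_divide_iff zero_less_numeral)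
    define d where "d = min (min d1 d2) 1"
    have d0: "d > 0" using d1 d2 by (simp add: d_def)
    have "dist (deriv (\<lambda>w. G w v) w) (deriv (\<lambda>w. G w v0) w0) < e" if dist: "dist (w, v) (w0, v0) < d" for w v
    proof -
      have dw: "dist w w0 < d" "dist v v0 < d"
        using dist dist_fst_le[of "(w,v)" "(w0,v0)"] dist_snd_le[of "(w,v)" "(w0,v0)"] by auto
      have "norm ((deriv ^^ 1) (\<lambda>u. G u v - G u v0) w) \<le> fact 1 * (e/4) / 1 ^ 1"
      proof (rule Cauchy_inequality)
        show "(\<lambda>u. G u v - G u v0) holomorphic_on ball w 1"
          by (intro holomorphic_intros holomorphic_on_subset[OF hol]) auto
        show "continuous_on (cball w 1) (\<lambda>u. G u v - G u v0)"
          by (intro continuous_intros holomorphic_on_imp_continuous_on holomorphic_on_subset[OF hol]) auto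
        show "norm (G x v - G x v0) \<le> e/4" if "norm (w - x) = 1" for x
        proof -
          have "dist x w0 \<le> 2" using that dw dist_triangle[of x w0 w] by (simp add: dist_norm norm_minus_commute d_def)
          moreover have "dist v v0 < d2" "dist v v0 \<le> 1" using dw by (auto simp: d_def)
          ultimately show ?thesis using d2(2)[of "(x, v0)" "(x, v)"] by (auto simp: dist_Pair_Pair dist_commute dist_norm norm_minus_commute)
        qed
      qed auto
      moreover have "deriv (\<lambda>u. G u v - G u v0) w = deriv (\<lambda>u. G u v) w - deriv (\<lambda>u. G u v0) w"
        by (intro deriv_diff holomorphic_on_imp_differentiable_at[OF hol]) auto
      ultimately have "dist (deriv (\<lambda>u. G u v) w) (deriv (\<lambda>u. G u v0) w) \<le> e/4" by (simp add: dist_norm)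
      moreover have "dist (deriv (\<lambda>w. G w v0) w) (deriv (\<lambda>w. G w v0) w0) < e/2" using d1 dw by (auto simp: d_def)
      ultimately show ?thesis using e
        dist_triangle[of "deriv (\<lambda>u. G u v) w" "deriv (\<lambda>w. G w v0) w0" "deriv (\<lambda>w. G w v0) w"] by linarith
    qed
    thus "\<exists>d>0. \<forall>x'. dist x' (w0, v0) < d \<longrightarrow>
      dist (case x' of (w, v) \<Rightarrow> deriv (\<lambda>w. G w v) w) (case (w0, v0) of (w, v) \<Rightarrow> deriv (\<lambda>w. G w v) w) < e"
      using d0 by (intro exI[of _ d]) auto
  qed
  thus ?thesis by (auto simp: continuous_on_eq_continuous_at)
qed

lemma holomorphic_integral_parameter:
  fixes G :: "complex \<Rightarrow> 'b::euclidean_space \<Rightarrow> complex"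
  assumes hol: "\<And>v. (\<lambda>w. G w v) holomorphic_on UNIV"
    and cont: "continuous_on UNIV (\<lambda>(w, v). G w v)"
  shows "(\<lambda>w. integral (cbox a b) (G w)) holomorphic_on UNIV"
proof (rule leibniz_rule_holomorphic)
  show "((\<lambda>w. G w v) has_field_derivative deriv (\<lambda>w. G w v) w) (at w within UNIV)" for w v
    using holomorphic_derivI[OF hol open_UNIV] by auto
  show "G w integrable_on cbox a b" for w
    by (intro integrable_continuous continuous_on_compose2[OF cont, of _ "\<lambda>v. (w, v)", simplified] continuous_intros)
  show "continuous_on (UNIV \<times> cbox a b) (\<lambda>(w, v). deriv (\<lambda>w. G w v) w)"
    using continuous_on_deriv_parameter[OF assms] continuous_on_subset by blast
qed auto

lemma nn_integral_lborel_scaleR: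
  fixes f :: "'a::euclidean_space \<Rightarrow> ennreal"
  assumes [measurable]: "f \<in> borel_measurable borel" and c: "c \<noteq> 0"
  shows "(\<integral>\<^sup>+ x. f x \<partial>lborel) = ennreal (\<bar>c\<bar> ^ DIM('a)) * (\<integral>\<^sup>+ x. f (c *\<^sub>R x) \<partial>lborel)"
  by (subst lborel_affine[OF c, of 0])
     (simp add: nn_integral_density nn_integral_distr nn_integral_cmult)

text \<open>The average of \<open>g\<close> over the dilated boxes \<open>w E\<close> is an entire function of the dilation factor
  \<open>w\<close> alone; the weighted \<open>L\<^sup>2\<close> norm controls it for large real \<open>w\<close>, and at \<open>w = 0\<close> it is
  the value \<open>g 0\<close>.\<close>

lemma exp_type_value_at_0_bound:
  fixes \<tau> k0 :: real and N :: nat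
  assumes tau: "\<tau> \<ge> 0"
  obtains C where "C > 0"
    "\<And>(G :: complex \<Rightarrow> 'a::euclidean_space \<Rightarrow> complex) A B g.
      (\<And>v. (\<lambda>w. G w v) holomorphic_on UNIV) \<Longrightarrow> continuous_on UNIV (\<lambda>(w, v). G w v) \<Longrightarrow>
      (\<And>w v. norm (G w v) \<le> A * exp (\<tau> * norm w * norm v)) \<Longrightarrow>
      (\<And>x v. G (complex_of_real x) v = g (x *\<^sub>R v)) \<Longrightarrow> B \<ge> 0 \<Longrightarrow>
      (\<integral>\<^sup>+ x. ennreal ((norm (g x))\<^sup>2 / (1 + norm x) ^ (2 * N)) * indicator {x. norm x > k0} x \<partial>lborel) \<le> ennreal (B\<^sup>2) \<Longrightarrow>
      norm (g 0) \<le> C * B"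
proof -
  \<comment> \<open>The box from \<open>One\<close> to \<open>2 *\<^sub>R One\<close> has volume 1,
    so averages are plain integrals, and it avoids the origin: its points have norm between 1 and
    \<open>D\<close>. Large real dilations therefore move it completely out of the ball of radius
    \<open>k0\<close>.\<close>
  define a :: 'a where "a = One"
  define D where "D = 2 * real DIM('a)"
  define E where "E = cbox a (2 *\<^sub>R a)"
  have D1: "D \<ge> 1" unfolding D_def using DIM_positive[where 'a='a] by linarith
  have E_ge: "norm v \<ge> 1" and E_le: "norm v \<le> D" if "v \<in> E" for v
  proof -
    have b: "1 \<le> v \<bullet> i \<and> v \<bullet> i \<le> 2" if "i \<in> Basis" for i
      using \<open>v \<in> E\<close> that unfolding E_def a_def mem_box by (auto simp: inner_sum_left_Basis)
    obtain i :: 'a where i: "i \<in> Basis" using nonempty_Basis by blast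
    show "norm v \<ge> 1" using b[OF i] Basis_le_norm[OF i, of v] by linarith
    have "norm v \<le> (\<Sum>i\<in>Basis. \<bar>v \<bullet> i\<bar>)" by (rule norm_le_l1)
    also have "\<dots> \<le> (\<Sum>i\<in>(Basis :: 'a set). 2)" by (intro sum_mono) (use b in force)
    finally show "norm v \<le> D" by (simp add: D_def)
  qed
  have volE: "emeasure lborel E = 1" unfolding E_def a_def
    by (subst emeasure_lborel_cbox) (auto simp: inner_sum_left_Basis inner_diff_left)
  define r where "r = max 1 k0 + 1"
  have r: "r > 1" "r > k0" by (auto simp: r_def)
  have tD: "\<tau> * D \<ge> 0" using tau D1 by simp
  obtain C0 where C0: "C0 > 0"
    "\<And>(H :: complex \<Rightarrow> complex) A B w. H holomorphic_on UNIV \<Longrightarrow> (\<And>w. norm (H w) \<le> A * exp (\<tau> * D * norm w)) \<Longrightarrow> B \<ge> 0 \<Longrightarrow>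
      (\<And>x. \<bar>x\<bar> \<ge> r \<Longrightarrow> norm (H (complex_of_real x)) \<le> B * \<bar>x\<bar> ^ (2 * N)) \<Longrightarrow> norm w \<le> 4 * r \<Longrightarrow>
      norm (H w) \<le> C0 * B"
    using exp_type_bound[of r "\<tau> * D" "2 * N"] r tD by auto
  define C1 where "C1 = 1 + (2 * D) ^ (2 * N)"
  have C1: "C1 > 0" using D1 by (simp add: C1_def add_pos_nonneg)
  have main: "norm (g 0) \<le> C0 * C1 * B"
    if hol: "\<And>v. (\<lambda>w. G w v) holomorphic_on UNIV" and cont: "continuous_on UNIV (\<lambda>(w, v). G w v)"
      and growth: "\<And>w v. norm (G w v) \<le> A * exp (\<tau> * norm w * norm v)"
      and Gg: "\<And>x v. G (complex_of_real x) v = g (x *\<^sub>R v)" and B: "B > 0"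
      and int: "(\<integral>\<^sup>+ x. ennreal ((norm (g x))\<^sup>2 / (1 + norm x) ^ (2 * N)) * indicator {x. norm x > k0} x \<partial>lborel) \<le> ennreal (B\<^sup>2)"
    for G :: "complex \<Rightarrow> 'a \<Rightarrow> complex" and A B g
  proof -
    have contv: "continuous_on X (G w)" for X w
      by (rule continuous_on_subset[of UNIV])
         (intro continuous_on_compose2[OF cont, of _ "\<lambda>v. (w, v)", simplified] continuous_intros, simp)
    have "g = G 1" using Gg[of 1] by auto
    hence contg: "continuous_on X g" for X using contv by simp
    have gm [measurable]: "g \<in> borel_measurable borel" using contg by (rule borel_measurable_continuous_onI)
    have A0: "A \<ge> 0" using order_trans[OF norm_ge_zero growth[of 0 0]] by simp
    define H where "H = (\<lambda>w. integral E (G w))"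
    have intg: "G w integrable_on E" for w unfolding E_def by (intro integrable_continuous contv)
    have cont1: "measure lborel E = 1" using volE by (simp add: measure_def)
    have "norm (H 0) \<le> C0 * (C1 * B)"
    proof (rule C0(2)[of H A])
      show "H holomorphic_on UNIV" unfolding H_def E_def
        by (rule holomorphic_integral_parameter[OF hol cont])
      show "norm (H w) \<le> A * exp (\<tau> * D * norm w)" for w
      proof -
        have "norm (H w) \<le> integral E (\<lambda>v. A * exp (\<tau> * D * norm w))" unfolding H_def
        proof (rule integral_norm_bound_integral[OF intg])
          show "(\<lambda>v::'a. A * exp (\<tau> * D * norm w)) integrable_on E" unfolding E_def by (rule integrable_const)
          fix v assume v: "v \<in> E"
          have "\<tau> * norm w * norm v \<le> \<tau> * norm w * D" using E_le[OF v] tau by (intro mult_left_mono) auto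
          thus "norm (G w v) \<le> A * exp (\<tau> * D * norm w)"
            using growth[of w v] A0 by (smt (verit) exp_le_cancel_iff mult.commute mult.left_commute mult_left_mono)
        qed
        thus ?thesis using cont1 unfolding E_def by simp
      qed
      show "norm (H (of_real x)) \<le> C1 * B * \<bar>x\<bar> ^ (2 * N)" if x: "\<bar>x\<bar> \<ge> r" for x
      proof -
        define q where "q = (\<lambda>y. (norm (g y))\<^sup>2 / (1 + norm y) ^ (2 * N))"
        have qm [measurable]: "q \<in> borel_measurable borel" unfolding q_def by measurable
        have q0: "q y \<ge> 0" for y by (simp add: q_def)
        have qc: "continuous_on X q" for X unfolding q_def
          by (intro continuous_intros contg) (auto simp: add_nonneg_eq_0_iff)
        define c where "c = (2 * D) ^ (2 * N) * \<bar>x\<bar> ^ (2 * N)"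
        have ptw: "norm (G (of_real x) v) \<le> q (x *\<^sub>R v) / B + B * c" if v: "v \<in> E" for v
        proof -
          define P where "P = (1 + norm (x *\<^sub>R v)) ^ N"
          have P: "P > 0" unfolding P_def by (intro zero_less_power) (auto simp: add_pos_nonneg)
          have "1 * 1 \<le> \<bar>x\<bar> * D" using x r D1 by (intro mult_mono) auto
          moreover have "\<bar>x\<bar> * norm v \<le> \<bar>x\<bar> * D" using E_le[OF v] by (intro mult_left_mono) auto
          ultimately have "1 + \<bar>x\<bar> * norm v \<le> 2 * (\<bar>x\<bar> * D)" by linarith
          hence "1 + norm (x *\<^sub>R v) \<le> 2 * D * \<bar>x\<bar>" by (simp add: algebra_simps)
          hence "(1 + norm (x *\<^sub>R v)) ^ (2 * N) \<le> (2 * D * \<bar>x\<bar>) ^ (2 * N)" by (intro power_mono) auto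
          hence Pc: "P\<^sup>2 \<le> c" by (simp add: P_def c_def power_mult[symmetric] power_mult_distrib mult.commute)
          define n where "n = norm (g (x *\<^sub>R v))"
          have q: "q (x *\<^sub>R v) = (n / P)\<^sup>2"
            by (simp add: q_def n_def P_def power_divide power_mult[symmetric] mult.commute)
          \<comment> \<open>This replaces Cauchy-Schwarz pointwise: \<open>n\<close> is bounded by
            \<open>n\<^sup>2\<close> over \<open>P\<^sup>2 * B\<close> plus
            \<open>B * P\<^sup>2\<close>, and the integral of the first term is at most
            \<open>B\<close>.\<close>
          have "0 \<le> (n / P - B * P)\<^sup>2" by simp
          also have "\<dots> = (n / P)\<^sup>2 + B\<^sup>2 * P\<^sup>2 - 2 * B * n" using P by (simp add: power2_diff power_mult_distrib)
          finally have "2 * B * n \<le> (n / P)\<^sup>2 + B\<^sup>2 * P\<^sup>2" by simp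
          moreover have "0 \<le> B * n" using B by (simp add: n_def)
          ultimately have "B * n \<le> (n / P)\<^sup>2 + B\<^sup>2 * P\<^sup>2" by linarith
          also have "\<dots> \<le> q (x *\<^sub>R v) + B\<^sup>2 * c" unfolding q using Pc by (intro add_mono mult_left_mono) auto
          finally have "n \<le> (q (x *\<^sub>R v) + B\<^sup>2 * c) / B" using B by (simp add: pos_le_divide_eq mult.commute)
          also have "\<dots> = q (x *\<^sub>R v) / B + B * c" using B by (simp add: add_divide_distrib power2_eq_square)
          finally show ?thesis using Gg by (simp add: n_def)
        qed
        have qi: "(\<lambda>v. q (x *\<^sub>R v)) integrable_on E" unfolding E_def
          by (intro integrable_continuous continuous_on_compose2[OF qc[of UNIV]] continuous_intros) auto
        have "norm (H (of_real x)) \<le> integral E (\<lambda>v. q (x *\<^sub>R v) / B + B * c)" unfolding H_def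
          by (rule integral_norm_bound_integral[OF intg _ ptw])
             (auto intro!: integrable_add integrable_on_divide qi[unfolded E_def] integrable_const simp: E_def)
        also have "\<dots> = integral E (\<lambda>v. q (x *\<^sub>R v)) / B + B * c"
          by (subst integral_add) (use cont1[unfolded E_def] in \<open>auto intro!: integrable_on_divide qi[unfolded E_def] simp: E_def\<close>)
        also have "integral E (\<lambda>v. q (x *\<^sub>R v)) \<le> B\<^sup>2"
        proof -
          have x0: "x \<noteq> 0" using x r by auto
          have "ennreal (integral E (\<lambda>v. q (x *\<^sub>R v))) = (\<integral>\<^sup>+ v. ennreal (q (x *\<^sub>R v)) * indicator E v \<partial>lborel)"
          proof -
            have "((\<lambda>v. q (x *\<^sub>R v) * indicator E v) has_integral integral E (\<lambda>v. q (x *\<^sub>R v))) UNIV"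
            proof -
              have "(\<lambda>v. q (x *\<^sub>R v) * indicator E v) = (\<lambda>v. if v \<in> E then q (x *\<^sub>R v) else 0)"
                by (auto simp: indicator_def)
              thus ?thesis using qi by (simp only: has_integral_restrict_UNIV integrable_integral)
            qed
            from nn_integral_has_integral_lborel[OF _ _ this] show ?thesis
              using q0 by (simp add: ennreal_mult' ennreal_indicator[symmetric] E_def)
          qed
          also have "\<dots> \<le> (\<integral>\<^sup>+ v. ennreal (q (x *\<^sub>R v)) * indicator {y. norm y > k0} (x *\<^sub>R v) \<partial>lborel)"
          proof (intro nn_integral_mono mult_left_mono)
            fix v
            have "norm (x *\<^sub>R v) > k0" if v: "v \<in> E"
              using mult_mono[of r "\<bar>x\<bar>" 1 "norm v"] E_ge[OF v] x r by simp
            thus "indicator E v \<le> (indicator {y. norm y > k0} (x *\<^sub>R v) :: ennreal)"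
              by (auto simp: indicator_def)
          qed auto
          \<comment> \<open>The Jacobian of the substitution \<open>y = x *\<^sub>R v\<close> is at
            least 1 because \<open>\<bar>x\<bar> \<ge> r\<close>, so inserting it only enlarges the
            integral.\<close>
          also have "\<dots> \<le> ennreal (\<bar>x\<bar> ^ DIM('a)) * \<dots>"
          proof -
            have "1 \<le> ennreal (\<bar>x\<bar> ^ DIM('a))" using x r by simp
            from mult_right_mono[OF this] show ?thesis by simp
          qed
          also have "\<dots> = (\<integral>\<^sup>+ y. ennreal (q y) * indicator {y. norm y > k0} y \<partial>lborel)"
            by (rule nn_integral_lborel_scaleR[symmetric, OF _ x0]) measurable
          also have "\<dots> \<le> ennreal (B\<^sup>2)" using int unfolding q_def .
          finally show ?thesis by simp
        qed
        hence "integral E (\<lambda>v. q (x *\<^sub>R v)) / B + B * c \<le> B + B * c"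
          using B by (simp add: pos_divide_le_eq power2_eq_square)
        also have "\<dots> \<le> B * \<bar>x\<bar> ^ (2 * N) + B * c"
          using B x r by simp
        also have "\<dots> = C1 * B * \<bar>x\<bar> ^ (2 * N)" by (simp add: C1_def c_def algebra_simps)
        finally show ?thesis .
      qed
      show "0 \<le> C1 * B" using B C1 by simp
    qed (use r in auto)
    moreover have "H 0 = g 0"
    proof -
      have "G 0 v = g 0" for v using Gg[of 0 v] by simp
      hence "G 0 = (\<lambda>v. g 0)" by auto
      thus ?thesis using cont1 unfolding H_def E_def by simp
    qed
    ultimately show ?thesis by (simp add: mult.assoc)
  qed
  show thesis
  proof (rule that[of "C0 * C1"])
    show "C0 * C1 > 0" using C0 C1 by simp
    fix G :: "complex \<Rightarrow> 'a \<Rightarrow> complex" and A B g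
    assume *: "\<And>v. (\<lambda>w. G w v) holomorphic_on UNIV" "continuous_on UNIV (\<lambda>(w, v). G w v)"
      "\<And>w v. norm (G w v) \<le> A * exp (\<tau> * norm w * norm v)"
      "\<And>x v. G (complex_of_real x) v = g (x *\<^sub>R v)" "B \<ge> 0"
      "(\<integral>\<^sup>+ x. ennreal ((norm (g x))\<^sup>2 / (1 + norm x) ^ (2 * N)) * indicator {x. norm x > k0} x \<partial>lborel) \<le> ennreal (B\<^sup>2)"
    have "norm (g 0) \<le> C0 * C1 * (B + e)" if e: "e > 0" for e
    proof (rule main[OF *(1-4)])
      show "(\<integral>\<^sup>+ x. ennreal ((norm (g x))\<^sup>2 / (1 + norm x) ^ (2 * N)) * indicator {x. norm x > k0} x \<partial>lborel) \<le> ennreal ((B + e)\<^sup>2)"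
        using *(5) e by (intro order_trans[OF *(6)] ennreal_leI power_mono) auto
    qed (use *(5) e in auto)
    note le = this
    show "norm (g 0) \<le> C0 * C1 * B"
    proof (rule field_le_epsilon)
      fix e :: real assume "e > 0"
      thus "norm (g 0) \<le> C0 * C1 * B + e" using le[of "e / (C0 * C1)"] C0 C1 by (simp add: distrib_left)
    qed
  qed
qed

section \<open>Trigonometric polynomials\<close>

text \<open>The subtraction of 1 in each term mirrors \<open>X 0 = 0\<close> in the covariance; it
  makes the polynomial vanish at the origin.\<close>

definition trig_poly :: "'a set \<Rightarrow> ('a \<Rightarrow> real) \<Rightarrow> 'a::euclidean_space \<Rightarrow> complex" where
  "trig_poly T c x = (\<Sum>t\<in>T. of_real (c t) * (exp (\<i> * of_real (t \<bullet> x)) - 1))"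

text \<open>The holomorphic extension of \<open>trig_poly T c\<close> along the line through
  \<open>x0\<close> in direction \<open>v\<close>. Only the two inner products with real vectors
  enter, so complex vectors are avoided.\<close>

definition trig_line :: "'a set \<Rightarrow> ('a \<Rightarrow> real) \<Rightarrow> 'a::euclidean_space \<Rightarrow> complex \<Rightarrow> 'a \<Rightarrow> complex" where
  "trig_line T c x0 w v = (\<Sum>t\<in>T. of_real (c t) * (exp (\<i> * (of_real (t \<bullet> x0) + w * of_real (t \<bullet> v))) - 1))"

lemma trig_poly_0 [simp]: "trig_poly T c 0 = 0"
  by (simp add: trig_poly_def)

lemma continuous_trig_poly [continuous_intros]: "continuous_on X (trig_poly T c)"
  unfolding trig_poly_def by (intro continuous_intros)

lemma measurable_trig_poly [measurable]: "trig_poly T c \<in> borel_measurable borel"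
  by (intro borel_measurable_continuous_onI continuous_intros)

lemma trig_line_of_real: "trig_line T c x0 (of_real r) v = trig_poly T c (x0 + r *\<^sub>R v)"
  by (simp add: trig_line_def trig_poly_def inner_add_right)

lemma holomorphic_trig_line: "(\<lambda>w. trig_line T c x0 w v) holomorphic_on UNIV"
  unfolding trig_line_def by (intro holomorphic_intros)

lemma continuous_trig_line: "continuous_on UNIV (\<lambda>(w, v). trig_line T c x0 w v)"
  unfolding trig_line_def case_prod_unfold by (intro continuous_intros)

text \<open>The exponential type depends on the ball alone. The prefactor depends on the
  coefficients, but it enters later estimates only as the constant \<open>A\<close>, of which their
  conclusions are free.\<close>

lemma norm_trig_line_le:
  assumes T: "T \<subseteq> cball 0 \<rho>"
  shows "norm (trig_line T c x0 w v) \<le> (2 * (\<Sum>t\<in>T. \<bar>c t\<bar>)) * exp (\<rho> * norm w * norm v)"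
proof (cases "T = {}")
  case False
  then obtain t0 where "t0 \<in> T" by blast
  hence "norm t0 \<le> \<rho>" using T by auto
  hence \<rho>: "\<rho> \<ge> 0" using norm_ge_zero[of t0] by linarith
  have "norm (trig_line T c x0 w v) \<le> (\<Sum>t\<in>T. \<bar>c t\<bar> * (2 * exp (\<rho> * norm w * norm v)))"
    unfolding trig_line_def
  proof (intro sum_norm_le)
    fix t assume t: "t \<in> T"
    have "norm (exp (\<i> * (of_real (t \<bullet> x0) + w * of_real (t \<bullet> v)))) = exp (- (Im w * (t \<bullet> v)))"
      by simp
    also have "- (Im w * (t \<bullet> v)) \<le> norm w * (\<rho> * norm v)"
    proof -
      have "\<bar>t \<bullet> v\<bar> \<le> \<rho> * norm v"
        using Cauchy_Schwarz_ineq2[of t v] T t mult_right_mono[of "norm t" \<rho> "norm v"] by (auto simp: subset_iff)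
      hence "\<bar>Im w\<bar> * \<bar>t \<bullet> v\<bar> \<le> norm w * (\<rho> * norm v)"
        using abs_Im_le_cmod[of w] by (intro mult_mono) auto
      thus ?thesis by (simp add: abs_mult[symmetric])
    qed
    finally have "norm (exp (\<i> * (of_real (t \<bullet> x0) + w * of_real (t \<bullet> v)))) \<le> exp (\<rho> * norm w * norm v)"
      by (simp add: mult_ac)
    moreover have "1 \<le> exp (\<rho> * norm w * norm v)" using \<rho> by simp
    ultimately have "norm (exp (\<i> * (of_real (t \<bullet> x0) + w * of_real (t \<bullet> v))) - 1) \<le> 2 * exp (\<rho> * norm w * norm v)"
      using norm_triangle_ineq4[of "exp (\<i> * (of_real (t \<bullet> x0) + w * of_real (t \<bullet> v)))" 1]
      unfolding norm_one by linarith
    thus "norm (of_real (c t) * (exp (\<i> * (of_real (t \<bullet> x0) + w * of_real (t \<bullet> v))) - 1))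
        \<le> \<bar>c t\<bar> * (2 * exp (\<rho> * norm w * norm v))"
      unfolding norm_mult norm_of_real by (intro mult_left_mono) auto
  qed
  thus ?thesis by (simp add: sum_distrib_right sum_distrib_left mult_ac)
qed (simp add: trig_line_def)

lemma nn_integral_lborel_translate:
  fixes f :: "'a::euclidean_space \<Rightarrow> ennreal"
  assumes [measurable]: "f \<in> borel_measurable borel"
  shows "(\<integral>\<^sup>+ x. f (a + x) \<partial>lborel) = (\<integral>\<^sup>+ x. f x \<partial>lborel)"
proof -
  have "lborel = distr lborel borel (\<lambda>x. a + x)"
    using lborel_affine[of 1 a] by (simp add: density_1)
  hence "(\<integral>\<^sup>+ x. f x \<partial>lborel) = (\<integral>\<^sup>+ x. f x \<partial>distr lborel borel (\<lambda>x. a + x))" by simp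
  also have "\<dots> = (\<integral>\<^sup>+ x. f (a + x) \<partial>lborel)" by (rule nn_integral_distr) auto
  finally show ?thesis by simp
qed

section \<open>Pointwise bounds by weighted L2 norms\<close>

text \<open>The bound for the value at 0, recentred at \<open>x0\<close>. The polynomial weight
  survives the translation because \<open>1 + norm (x0 + y)\<close> is at most
  \<open>(1 + norm x0) * (1 + norm y)\<close>, whence the factor \<open>(1 + norm x0) ^ N\<close>.
  Two thresholds are kept since the excluded ball grows under recentring; \<open>C\<close> depends
  on them but not on \<open>x0\<close>.\<close>

lemma trig_poly_pointwise_bound:
  fixes \<rho> \<kappa> \<kappa>' :: real and N :: nat
  assumes rho: "\<rho> \<ge> 0"
  obtains C where "C > 0"
    "\<And>T c B (x0 :: 'a::euclidean_space). T \<subseteq> cball 0 \<rho> \<Longrightarrow> B \<ge> 0 \<Longrightarrow>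
      (\<And>y. norm y > \<kappa>' \<Longrightarrow> norm (x0 + y) > \<kappa>) \<Longrightarrow>
      (\<integral>\<^sup>+ x. ennreal ((norm (trig_poly T c x))\<^sup>2 / (1 + norm x) ^ (2 * N)) * indicator {x. norm x > \<kappa>} x \<partial>lborel) \<le> ennreal (B\<^sup>2) \<Longrightarrow>
      norm (trig_poly T c x0) \<le> C * (1 + norm x0) ^ N * B"
proof -
  obtain C where C: "C > 0"
    "\<And>(G :: complex \<Rightarrow> 'a \<Rightarrow> complex) A B g.
      (\<And>v. (\<lambda>w. G w v) holomorphic_on UNIV) \<Longrightarrow> continuous_on UNIV (\<lambda>(w, v). G w v) \<Longrightarrow>
      (\<And>w v. norm (G w v) \<le> A * exp (\<rho> * norm w * norm v)) \<Longrightarrow>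
      (\<And>x v. G (complex_of_real x) v = g (x *\<^sub>R v)) \<Longrightarrow> B \<ge> 0 \<Longrightarrow>
      (\<integral>\<^sup>+ x. ennreal ((norm (g x))\<^sup>2 / (1 + norm x) ^ (2 * N)) * indicator {x. norm x > \<kappa>'} x \<partial>lborel) \<le> ennreal (B\<^sup>2) \<Longrightarrow>
      norm (g 0) \<le> C * B"
  proof (rule exp_type_value_at_0_bound[OF rho, where 'a='a and ?k0.0=\<kappa>' and N=N], goal_cases)
    case (1 C)
    from 1(2,3) show ?case by (rule that)
  qed
  show thesis
  proof (rule that[OF C(1)])
    fix T :: "'a set" and c B and x0 :: 'a
    assume T: "T \<subseteq> cball 0 \<rho>" and B: "B \<ge> 0"
      and k: "\<And>y. norm y > \<kappa>' \<Longrightarrow> norm (x0 + y) > \<kappa>"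
      and int: "(\<integral>\<^sup>+ x. ennreal ((norm (trig_poly T c x))\<^sup>2 / (1 + norm x) ^ (2 * N)) * indicator {x. norm x > \<kappa>} x \<partial>lborel) \<le> ennreal (B\<^sup>2)"
    define P where "P = (1 + norm x0) ^ N"
    have P0: "P > 0" unfolding P_def by (intro zero_less_power) (simp add: add_pos_nonneg)
    have "norm (trig_poly T c (x0 + 0)) \<le> C * (P * B)"
    proof (rule C(2)[of "trig_line T c x0" _ "\<lambda>y. trig_poly T c (x0 + y)" "P * B", OF holomorphic_trig_line continuous_trig_line norm_trig_line_le[OF T] trig_line_of_real])
      show "0 \<le> P * B" using P0 B by simp
      have "(\<integral>\<^sup>+ y. ennreal ((norm (trig_poly T c (x0 + y)))\<^sup>2 / (1 + norm y) ^ (2 * N)) * indicator {y. norm y > \<kappa>'} y \<partial>lborel)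
        \<le> (\<integral>\<^sup>+ y. ennreal (P\<^sup>2) * (ennreal ((norm (trig_poly T c (x0 + y)))\<^sup>2 / (1 + norm (x0 + y)) ^ (2 * N)) * indicator {x. norm x > \<kappa>} (x0 + y)) \<partial>lborel)"
      proof (intro nn_integral_mono)
        fix y
        define n where "n = (norm (trig_poly T c (x0 + y)))\<^sup>2"
        have n0: "n \<ge> 0" by (simp add: n_def)
        have "1 + norm (x0 + y) \<le> (1 + norm x0) * (1 + norm y)"
          using norm_triangle_ineq[of x0 y] mult_nonneg_nonneg[OF norm_ge_zero[of x0] norm_ge_zero[of y]]
          unfolding ring_distribs by linarith
        hence "(1 + norm (x0 + y)) ^ (2 * N) \<le> ((1 + norm x0) * (1 + norm y)) ^ (2 * N)"
          by (intro power_mono) auto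
        also have "\<dots> = P\<^sup>2 * (1 + norm y) ^ (2 * N)"
          by (simp add: P_def power_mult_distrib power_mult[symmetric] mult.commute)
        finally have le: "(1 + norm (x0 + y)) ^ (2 * N) \<le> P\<^sup>2 * (1 + norm y) ^ (2 * N)" .
        have p1: "(1 + norm (x0 + y)) ^ (2 * N) > 0" and p2: "(1 + norm y) ^ (2 * N) > 0"
          by (intro zero_less_power add_pos_nonneg; simp)+
        have "n / (1 + norm y) ^ (2 * N) \<le> P\<^sup>2 * (n / (1 + norm (x0 + y)) ^ (2 * N))"
          using mult_left_mono[OF le n0] p1 p2 by (simp add: divide_simps mult_ac)
        hence "ennreal (n / (1 + norm y) ^ (2 * N)) \<le> ennreal (P\<^sup>2) * ennreal (n / (1 + norm (x0 + y)) ^ (2 * N))"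
          using p1 n0 by (subst ennreal_mult'[symmetric]) (auto intro: ennreal_leI)
        moreover have "indicator {y. norm y > \<kappa>'} y \<le> (indicator {x. norm x > \<kappa>} (x0 + y) :: ennreal)"
          using k[of y] by (auto simp: indicator_def)
        ultimately show "ennreal ((norm (trig_poly T c (x0 + y)))\<^sup>2 / (1 + norm y) ^ (2 * N)) * indicator {y. norm y > \<kappa>'} y
          \<le> ennreal (P\<^sup>2) * (ennreal ((norm (trig_poly T c (x0 + y)))\<^sup>2 / (1 + norm (x0 + y)) ^ (2 * N)) * indicator {x. norm x > \<kappa>} (x0 + y))"
          unfolding n_def mult.assoc[symmetric] by (rule mult_mono) auto
      qed
      also have "\<dots> = ennreal (P\<^sup>2) * (\<integral>\<^sup>+ x. ennreal ((norm (trig_poly T c x))\<^sup>2 / (1 + norm x) ^ (2 * N)) * indicator {x. norm x > \<kappa>} x \<partial>lborel)"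
        by (subst nn_integral_cmult, measurable)
           (subst nn_integral_lborel_translate[where f="\<lambda>x. ennreal ((norm (trig_poly T c x))\<^sup>2 / (1 + norm x) ^ (2 * N)) * indicator {x. norm x > \<kappa>} x"], measurable)
      also have "\<dots> \<le> ennreal (P\<^sup>2) * ennreal (B\<^sup>2)" using int by (intro mult_left_mono) auto
      also have "\<dots> = ennreal ((P * B)\<^sup>2)" by (simp add: ennreal_mult'[symmetric] power_mult_distrib)
      finally show "(\<integral>\<^sup>+ y. ennreal ((norm (trig_poly T c (x0 + y)))\<^sup>2 / (1 + norm y) ^ (2 * N)) * indicator {y. norm y > \<kappa>'} y \<partial>lborel) \<le> ennreal ((P * B)\<^sup>2)" .
    qed
    thus "norm (trig_poly T c x0) \<le> C * (1 + norm x0) ^ N * B" by (simp add: P_def mult.assoc)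
  qed
qed

definition sq_norm :: "('a \<Rightarrow> real) \<Rightarrow> 'a set \<Rightarrow> ('a \<Rightarrow> real) \<Rightarrow> 'a::euclidean_space \<Rightarrow> ennreal" where
  "sq_norm w T c x = ennreal ((norm (trig_poly T c x))\<^sup>2 * w x)"

lemma measurable_sq_norm [measurable]:
  "w \<in> borel_measurable borel \<Longrightarrow> sq_norm w T c \<in> borel_measurable borel"
  unfolding sq_norm_def by measurable

text \<open>Recentring with a threshold works only for base points in a fixed ball, since the
  excluded ball would otherwise grow with \<open>x\<close>. So there are two stages: the integral
  over \<open>norm x > k0\<close> first bounds the polynomial on the ball of radius
  \<open>k0\<close>; this bound fills the hole in the integral, and the second stage, without
  excluded ball, reaches every \<open>x\<close> with one constant.\<close>

lemma trig_poly_polynomial_growth: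
  fixes w :: "'a::euclidean_space \<Rightarrow> real"
  assumes w [measurable]: "w \<in> borel_measurable borel" and w0: "\<And>x. w x \<ge> 0"
    and low: "c0 > 0" "k0 > 0" "\<eta> > 0" "\<And>x. norm x > k0 \<Longrightarrow> w x \<ge> c0 * norm x powr (- \<eta>)"
    and rho: "\<rho> \<ge> 0"
  obtains C N where "C > 0"
    "\<And>T c B x. T \<subseteq> cball 0 \<rho> \<Longrightarrow> B \<ge> 0 \<Longrightarrow> (\<integral>\<^sup>+ x. sq_norm w T c x \<partial>lborel) \<le> ennreal (B\<^sup>2) \<Longrightarrow>
       norm (trig_poly T c x) \<le> C * (1 + norm x) ^ N * B"
proof -
  define N where "N = nat \<lceil>\<eta>\<rceil>"
  have N: "real N \<ge> \<eta>" unfolding N_def by linarith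
  define s where "s = sqrt c0"
  have s: "s > 0" "s\<^sup>2 = c0" using low by (auto simp: s_def)
  have wlow: "c0 / (1 + norm x) ^ (2 * N) \<le> w x" if x: "norm x > k0" for x
  proof -
    have "1 / (1 + norm x) ^ (2 * N) = (1 + norm x) powr (- real (2 * N))"
      using powr_realpow[of "1 + norm x" "2 * N"] by (simp add: powr_minus add_pos_nonneg divide_inverse)
    also have "\<dots> \<le> (1 + norm x) powr (- \<eta>)" using N by (intro powr_mono) auto
    also have "\<dots> \<le> norm x powr (- \<eta>)" using x low by (intro powr_mono2') auto
    finally have "c0 * (1 / (1 + norm x) ^ (2 * N)) \<le> c0 * norm x powr (- \<eta>)" using low by (intro mult_left_mono) auto
    thus ?thesis using low(4)[OF x] by simp
  qed
  obtain C1 where C1: "C1 > 0"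
    "\<And>T c B (x0 :: 'a). T \<subseteq> cball 0 \<rho> \<Longrightarrow> B \<ge> 0 \<Longrightarrow>
      (\<And>y. norm y > 2 * k0 \<Longrightarrow> norm (x0 + y) > k0) \<Longrightarrow>
      (\<integral>\<^sup>+ x. ennreal ((norm (trig_poly T c x))\<^sup>2 / (1 + norm x) ^ (2 * N)) * indicator {x. norm x > k0} x \<partial>lborel) \<le> ennreal (B\<^sup>2) \<Longrightarrow>
      norm (trig_poly T c x0) \<le> C1 * (1 + norm x0) ^ N * B"
  proof (rule trig_poly_pointwise_bound[OF rho, where 'a='a and \<kappa>="k0" and \<kappa>'="2 * k0" and N=N], goal_cases)
    case (1 C)
    from 1(2,3) show ?case by (rule that)
  qed
  \<comment> \<open>With threshold \<open>-1\<close> the indicators are 1 everywhere: no region is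
    excluded.\<close>
  obtain C2 where C2: "C2 > 0"
    "\<And>T c B (x0 :: 'a). T \<subseteq> cball 0 \<rho> \<Longrightarrow> B \<ge> 0 \<Longrightarrow>
      (\<And>y. norm y > -1 \<Longrightarrow> norm (x0 + y) > -1) \<Longrightarrow>
      (\<integral>\<^sup>+ x. ennreal ((norm (trig_poly T c x))\<^sup>2 / (1 + norm x) ^ (2 * N)) * indicator {x. norm x > -1} x \<partial>lborel) \<le> ennreal (B\<^sup>2) \<Longrightarrow>
      norm (trig_poly T c x0) \<le> C2 * (1 + norm x0) ^ N * B"
  proof (rule trig_poly_pointwise_bound[OF rho, where 'a='a and \<kappa>="-1" and \<kappa>'="-1" and N=N], goal_cases)
    case (1 C)
    from 1(2,3) show ?case by (rule that)
  qed
  define V where "V = measure lborel (cball 0 k0 :: 'a set)"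
  have V0: "V \<ge> 0" by (simp add: V_def)
  have [measurable]: "cball 0 k0 \<in> sets (borel :: 'a measure)" by (simp add: borel_closed)
  have V: "emeasure lborel (cball 0 k0 :: 'a set) = ennreal V"
    unfolding V_def using emeasure_lborel_cball_finite[of "0::'a" k0] by (simp add: emeasure_eq_ennreal_measure)
  \<comment> \<open>\<open>D * B\<close> bounds the polynomial on the ball of radius
    \<open>k0\<close>, and \<open>K\<^sup>2 * B\<^sup>2\<close> is the sum of the outer integral and
    the contribution of this ball of volume \<open>V\<close>.\<close>
  define D where "D = C1 * (1 + k0) ^ N / s"
  have D0: "D > 0" using C1 low s by (simp add: D_def)
  define K where "K = sqrt (1 / c0 + D\<^sup>2 * V)"
  have K0: "K > 0" "K\<^sup>2 = 1 / c0 + D\<^sup>2 * V" using low V0 D0 by (auto simp: K_def add_pos_nonneg)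
  show thesis
  proof (rule that[of "C2 * K" N])
    show "C2 * K > 0" using C2 K0 by simp
    fix T :: "'a set" and c B and x :: 'a
    assume T: "T \<subseteq> cball 0 \<rho>" and B: "B \<ge> 0" and int: "(\<integral>\<^sup>+ x. sq_norm w T c x \<partial>lborel) \<le> ennreal (B\<^sup>2)"
    let ?q = "\<lambda>x. ennreal ((norm (trig_poly T c x))\<^sup>2 / (1 + norm x) ^ (2 * N))"
    have far: "(\<integral>\<^sup>+ x. ?q x * indicator {x. norm x > k0} x \<partial>lborel) \<le> ennreal ((B / s)\<^sup>2)"
    proof -
      have "(\<integral>\<^sup>+ x. ?q x * indicator {x. norm x > k0} x \<partial>lborel) \<le> (\<integral>\<^sup>+ x. ennreal (1 / c0) * sq_norm w T c x \<partial>lborel)"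
      proof (intro nn_integral_mono)
        fix x
        show "?q x * indicator {x. norm x > k0} x \<le> ennreal (1 / c0) * sq_norm w T c x"
        proof (cases "norm x > k0")
          case True
          have "(norm (trig_poly T c x))\<^sup>2 * (c0 / (1 + norm x) ^ (2 * N)) \<le> (norm (trig_poly T c x))\<^sup>2 * w x"
            using wlow[OF True] by (intro mult_left_mono) auto
          hence "(norm (trig_poly T c x))\<^sup>2 / (1 + norm x) ^ (2 * N) \<le> 1 / c0 * ((norm (trig_poly T c x))\<^sup>2 * w x)"
            using low by (simp add: field_simps)
          thus ?thesis using True low unfolding sq_norm_def
            by (subst ennreal_mult'[symmetric]) (auto intro: ennreal_leI)
        qed simp
      qed
      also have "\<dots> = ennreal (1 / c0) * (\<integral>\<^sup>+ x. sq_norm w T c x \<partial>lborel)" by (rule nn_integral_cmult) measurable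
      also have "\<dots> \<le> ennreal (1 / c0) * ennreal (B\<^sup>2)" using int by (intro mult_left_mono) auto
      also have "\<dots> = ennreal ((B / s)\<^sup>2)" using low s by (simp add: ennreal_mult'[symmetric] power_divide)
      finally show ?thesis .
    qed
    have near: "norm (trig_poly T c x) \<le> D * B" if x: "norm x \<le> k0" for x
    proof -
      have "norm (trig_poly T c x) \<le> C1 * (1 + norm x) ^ N * (B / s)"
      proof (rule C1(2)[OF T _ _ far])
        show "norm (x + y) > k0" if "norm y > 2 * k0" for y
          using norm_triangle_ineq2[of y "- x"] that x by (simp add: add.commute)
      qed (use B s in auto)
      also have "\<dots> \<le> C1 * (1 + k0) ^ N * (B / s)"
        using x C1(1) B s low(2) by (intro mult_mono power_mono) auto
      finally show ?thesis by (simp add: D_def)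
    qed
    have "norm (trig_poly T c x) \<le> C2 * (1 + norm x) ^ N * (K * B)"
    proof (rule C2(2)[OF T])
      have "(\<integral>\<^sup>+ x. ?q x * indicator {x. norm x > -1} x \<partial>lborel)
        \<le> (\<integral>\<^sup>+ x. ?q x * indicator {x. norm x > k0} x + ennreal ((D * B)\<^sup>2) * indicator (cball 0 k0) x \<partial>lborel)"
      proof (intro nn_integral_mono)
        fix x :: 'a
        show "?q x * indicator {x. norm x > -1} x \<le> ?q x * indicator {x. norm x > k0} x + ennreal ((D * B)\<^sup>2) * indicator (cball 0 k0) x"
        proof (cases "norm x > k0")
          case True
          moreover from True have "norm x > -1" using low by linarith
          ultimately show ?thesis by simp
        next
          case False
          have p: "(1 + norm x) ^ (2 * N) \<ge> 1" by (intro one_le_power) simp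
          have "(norm (trig_poly T c x))\<^sup>2 \<le> (D * B)\<^sup>2" using near[of x] False by (intro power_mono) auto
          moreover have "(norm (trig_poly T c x))\<^sup>2 / (1 + norm x) ^ (2 * N) \<le> (norm (trig_poly T c x))\<^sup>2 / 1"
            using p by (intro divide_left_mono) (auto intro!: zero_less_power add_pos_nonneg)
          ultimately have "(norm (trig_poly T c x))\<^sup>2 / (1 + norm x) ^ (2 * N) \<le> (D * B)\<^sup>2" by simp
          thus ?thesis using False by (auto simp: indicator_def intro: ennreal_leI)
        qed
      qed
      also have "\<dots> = (\<integral>\<^sup>+ x. ?q x * indicator {x. norm x > k0} x \<partial>lborel) + ennreal ((D * B)\<^sup>2) * ennreal V"
        by (subst nn_integral_add) (measurable, measurable, simp add: nn_integral_cmult_indicator V)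
      also have "\<dots> \<le> ennreal ((B / s)\<^sup>2) + ennreal ((D * B)\<^sup>2 * V)"
        using far V0 by (intro add_mono) (auto simp: ennreal_mult')
      also have "\<dots> = ennreal ((B / s)\<^sup>2 + (D * B)\<^sup>2 * V)" using V0 by (intro ennreal_plus[symmetric]) auto
      also have "(B / s)\<^sup>2 + (D * B)\<^sup>2 * V = (K * B)\<^sup>2"
        unfolding power_mult_distrib power_divide s K0 by (simp add: algebra_simps)
      finally show "(\<integral>\<^sup>+ x. ?q x * indicator {x. norm x > -1} x \<partial>lborel) \<le> ennreal ((K * B)\<^sup>2)" .
    next
      show "norm (x + y) > -1" for y using norm_ge_zero[of "x + y"] by linarith
    qed (use K0 B in auto)
    thus "norm (trig_poly T c x) \<le> C2 * K * (1 + norm x) ^ N * B" by (simp add: mult_ac)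
  qed
qed

text \<open>The polynomial vanishes at 0, so for \<open>norm x < 1\<close> the factor
  \<open>norm x\<close> comes from a derivative bound along the ray through \<open>x\<close>. That
  bound is Cauchy's inequality on a complex disc, which the polynomial growth on the real line
  controls through exponential type. For \<open>norm x \<ge> 1\<close> the factor
  \<open>norm x\<close> is at least 1 and the growth bound suffices.\<close>

lemma trig_poly_bound_near_0:
  fixes w :: "'a::euclidean_space \<Rightarrow> real"
  assumes w [measurable]: "w \<in> borel_measurable borel" and w0: "\<And>x. w x \<ge> 0"
    and low: "c0 > 0" "k0 > 0" "\<eta> > 0" "\<And>x. norm x > k0 \<Longrightarrow> w x \<ge> c0 * norm x powr (- \<eta>)"
    and rho: "\<rho> \<ge> 0"
  obtains C where "C > 0"
    "\<And>T c B x. T \<subseteq> cball 0 \<rho> \<Longrightarrow> B \<ge> 0 \<Longrightarrow> (\<integral>\<^sup>+ x. sq_norm w T c x \<partial>lborel) \<le> ennreal (B\<^sup>2) \<Longrightarrow>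
       norm x \<le> k \<Longrightarrow> norm (trig_poly T c x) \<le> C * norm x * B"
proof -
  obtain C1 N where C1: "C1 > 0"
    "\<And>T c B x. T \<subseteq> cball 0 \<rho> \<Longrightarrow> B \<ge> 0 \<Longrightarrow> (\<integral>\<^sup>+ x. sq_norm w T c x \<partial>lborel) \<le> ennreal (B\<^sup>2) \<Longrightarrow>
       norm (trig_poly T c x) \<le> C1 * (1 + norm x) ^ N * B"
  proof (rule trig_poly_polynomial_growth[OF w w0 low rho], goal_cases)
    case (2 C N)
    from 2(2,3) show ?case by (rule that)
  qed
  obtain C2 where C2: "C2 > 0"
    "\<And>(H :: complex \<Rightarrow> complex) A B w. H holomorphic_on UNIV \<Longrightarrow> (\<And>w. norm (H w) \<le> A * exp (\<rho> * norm w)) \<Longrightarrow> B \<ge> 0 \<Longrightarrow>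
      (\<And>x. \<bar>x\<bar> \<ge> 1 \<Longrightarrow> norm (H (complex_of_real x)) \<le> B * \<bar>x\<bar> ^ N) \<Longrightarrow> norm w \<le> 4 * 1 \<Longrightarrow>
      norm (H w) \<le> C2 * B"
  proof (rule exp_type_bound[of 1 \<rho> N], goal_cases)
    case (3 C)
    from 3(2,3) show ?case by (rule that)
  qed (use rho in auto)
  define C3 where "C3 = C2 * (C1 * 2 ^ N)"
  define C4 where "C4 = C1 * (1 + max k 1) ^ N"
  have C34: "C3 > 0" "C4 > 0" using C1(1) C2(1) by (auto simp: C3_def C4_def)
  show thesis
  proof (rule that[of "C3 + C4"])
    show "C3 + C4 > 0" using C34 by simp
    fix T :: "'a set" and c B and x :: 'a
    assume T: "T \<subseteq> cball 0 \<rho>" and B: "B \<ge> 0" and int: "(\<integral>\<^sup>+ x. sq_norm w T c x \<partial>lborel) \<le> ennreal (B\<^sup>2)"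
      and x: "norm x \<le> k"
    note growth = C1(2)[OF T B int]
    have "norm (trig_poly T c x) \<le> C3 * norm x * B \<or> norm (trig_poly T c x) \<le> C4 * norm x * B"
    proof (cases "norm x \<ge> 1")
      case True
      have "norm (trig_poly T c x) \<le> C1 * (1 + norm x) ^ N * B" by (rule growth)
      also have "\<dots> \<le> C1 * (1 + max k 1) ^ N * B"
        using x C1(1) B by (intro mult_right_mono mult_left_mono power_mono) auto
      also have "\<dots> \<le> C4 * norm x * B"
        using True C34 B unfolding C4_def[symmetric] by (intro mult_right_mono) auto
      finally show ?thesis by simp
    next
      case False
      show ?thesis
      proof (cases "x = 0")
        case False
        define e where "e = (1 / norm x) *\<^sub>R x"
        have e: "norm e = 1" "x = norm x *\<^sub>R e" using False by (auto simp: e_def)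
        define H where "H = (\<lambda>u. trig_line T c 0 u e)"
        have holH: "H holomorphic_on UNIV" unfolding H_def by (rule holomorphic_trig_line)
        have bdH: "norm (H u) \<le> C3 * B" if "norm u \<le> 4" for u
        proof -
          have "norm (H u) \<le> C2 * (C1 * 2 ^ N * B)"
          proof (rule C2(2)[OF holH])
            show "norm (H u) \<le> (2 * (\<Sum>t\<in>T. \<bar>c t\<bar>)) * exp (\<rho> * norm u)" for u
              unfolding H_def using norm_trig_line_le[OF T, of c 0 u e] e by simp
            show "norm (H (of_real y)) \<le> C1 * 2 ^ N * B * \<bar>y\<bar> ^ N" if y: "1 \<le> \<bar>y\<bar>" for y
            proof -
              have "norm (H (of_real y)) \<le> C1 * (1 + \<bar>y\<bar>) ^ N * B"
                using growth[of "y *\<^sub>R e"] e by (simp add: H_def trig_line_of_real)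
              also have "\<dots> \<le> C1 * (2 * \<bar>y\<bar>) ^ N * B"
                using y C1(1) B by (intro mult_right_mono mult_left_mono power_mono) auto
              finally show ?thesis by (simp add: power_mult_distrib mult_ac)
            qed
          qed (use that B C1(1) in auto)
          thus ?thesis by (simp add: C3_def mult_ac)
        qed
        have "norm (H (of_real (norm x)) - H 0) \<le> C3 * B * norm (complex_of_real (norm x) - 0)"
        proof (rule field_differentiable_bound[of "cball 0 1" H "deriv H"])
          show "(H has_field_derivative deriv H u) (at u within cball 0 1)" for u
            using holomorphic_derivI[OF holH open_UNIV] has_field_derivative_at_within by blast
          \<comment> \<open>The unit circle around a point of the unit disc stays inside the disc of
            radius 4 on which \<open>H\<close> is bounded.\<close>
          show "norm (deriv H u) \<le> C3 * B" if u: "u \<in> cball 0 1" for u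
          proof -
            have "norm ((deriv ^^ 1) H u) \<le> fact 1 * (C3 * B) / 1 ^ 1"
            proof (rule Cauchy_inequality)
              show "H holomorphic_on ball u 1" using holH holomorphic_on_subset by blast
              show "continuous_on (cball u 1) H"
                using holH holomorphic_on_imp_continuous_on holomorphic_on_subset by blast
              show "norm (H z) \<le> C3 * B" if "norm (u - z) = 1" for z
                using bdH[of z] norm_triangle_ineq2[of z u] u that by (simp add: norm_minus_commute)
            qed auto
            thus ?thesis by simp
          qed
        qed (use \<open>\<not> norm x \<ge> 1\<close> in auto)
        moreover have "H 0 = 0" by (simp add: H_def trig_line_def)
        moreover have "H (of_real (norm x)) = trig_poly T c x"
          using e(2) by (simp add: H_def trig_line_of_real)
        ultimately show ?thesis by (simp add: mult_ac)
      qed simp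
    qed
    moreover have "C3 * norm x * B \<le> (C3 + C4) * norm x * B" "C4 * norm x * B \<le> (C3 + C4) * norm x * B"
      using C34 B by (auto intro!: mult_right_mono)
    ultimately show "norm (trig_poly T c x) \<le> (C3 + C4) * norm x * B" by linarith
  qed
qed

text \<open>The product of the polynomial with \<open>p\<close> is square integrable for Lebesgue
  measure: outside the ball of radius \<open>R\<close> by the lower comparison of \<open>w\<close>
  with the square of \<open>p\<close>, inside by the bound near 0 and the boundedness of
  \<open>p\<close>. Its complexification has type \<open>\<rho> + \<tau>\<close>, so its value at
  any point is bounded by its L2 norm after a translation, with no loss in \<open>x\<close>; the
  upper comparison converts this back to \<open>w\<close>. The prefactor in \<open>type\<close> may
  depend on \<open>x0\<close>, as it does not reach the conclusion.\<close>

lemma trig_poly_bound_far: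
  fixes w :: "'a::euclidean_space \<Rightarrow> real" and \<psi> :: "'a \<Rightarrow> complex \<Rightarrow> 'a \<Rightarrow> complex" and p :: "'a \<Rightarrow> complex"
  assumes w [measurable]: "w \<in> borel_measurable borel" and w0: "\<And>x. w x \<ge> 0"
    and low: "c0 > 0" "k0 > 0" "\<eta> > 0" "\<And>x. norm x > k0 \<Longrightarrow> w x \<ge> c0 * norm x powr (- \<eta>)"
    and rho: "\<rho> \<ge> 0" and tau: "\<tau> \<ge> 0"
    and hol: "\<And>x0 v. (\<lambda>u. \<psi> x0 u v) holomorphic_on UNIV"
    and cont: "\<And>x0. continuous_on UNIV (\<lambda>(u, v). \<psi> x0 u v)"
    and type: "\<And>x0. \<exists>A. \<forall>u v. norm (\<psi> x0 u v) \<le> A * exp (\<tau> * norm u * norm v)"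
    and ext: "\<And>x0 r v. \<psi> x0 (complex_of_real r) v = p (x0 + r *\<^sub>R v)"
    and asymp: "c1 > 0" "c2 > 0" "R > 0" "\<And>x. norm x > R \<Longrightarrow> c1 * (norm (p x))\<^sup>2 \<le> w x"
      "\<And>x. norm x > R \<Longrightarrow> w x \<le> c2 * (norm (p x))\<^sup>2"
  obtains C where "C > 0"
    "\<And>T c B x. T \<subseteq> cball 0 \<rho> \<Longrightarrow> B \<ge> 0 \<Longrightarrow> (\<integral>\<^sup>+ x. sq_norm w T c x \<partial>lborel) \<le> ennreal (B\<^sup>2) \<Longrightarrow>
       norm x > R \<Longrightarrow> (norm (trig_poly T c x))\<^sup>2 * w x \<le> C * B\<^sup>2"
proof -
  obtain C1 where C1: "C1 > 0"
    "\<And>T c B x. T \<subseteq> cball 0 \<rho> \<Longrightarrow> B \<ge> 0 \<Longrightarrow> (\<integral>\<^sup>+ x. sq_norm w T c x \<partial>lborel) \<le> ennreal (B\<^sup>2) \<Longrightarrow>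
       norm x \<le> R \<Longrightarrow> norm (trig_poly T c x) \<le> C1 * norm x * B"
  proof (rule trig_poly_bound_near_0[OF w w0 low rho, of R], goal_cases)
    case (2 C)
    from 2(2,3) show ?case by (rule that)
  qed
  have rt: "\<rho> + \<tau> \<ge> 0" using rho tau by simp
  obtain C2 where C2: "C2 > 0"
    "\<And>(G :: complex \<Rightarrow> 'a \<Rightarrow> complex) A B g.
      (\<And>v. (\<lambda>w. G w v) holomorphic_on UNIV) \<Longrightarrow> continuous_on UNIV (\<lambda>(w, v). G w v) \<Longrightarrow>
      (\<And>w v. norm (G w v) \<le> A * exp ((\<rho> + \<tau>) * norm w * norm v)) \<Longrightarrow>
      (\<And>x v. G (complex_of_real x) v = g (x *\<^sub>R v)) \<Longrightarrow> B \<ge> 0 \<Longrightarrow>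
      (\<integral>\<^sup>+ x. ennreal ((norm (g x))\<^sup>2 / (1 + norm x) ^ (2 * 0)) * indicator {x. norm x > -1} x \<partial>lborel) \<le> ennreal (B\<^sup>2) \<Longrightarrow>
      norm (g 0) \<le> C2 * B"
  proof (rule exp_type_value_at_0_bound[OF rt, where 'a='a and ?k0.0="-1" and N=0], goal_cases)
    case (1 C)
    from 1(2,3) show ?case by (rule that)
  qed
  have p_eq: "p = \<psi> 0 1" using ext[of 0 1] by auto
  have contp: "continuous_on X p" for X unfolding p_eq
    by (rule continuous_on_subset[of UNIV])
       (intro continuous_on_compose2[OF cont, of _ "\<lambda>v. (1, v)", simplified] continuous_intros, simp)
  have pm [measurable]: "p \<in> borel_measurable borel" using contp by (rule borel_measurable_continuous_onI)
  have "bounded (p ` cball 0 R)" by (intro compact_imp_bounded compact_continuous_image contp) auto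
  then obtain L where "\<forall>y\<in>p ` cball 0 R. norm y \<le> L" unfolding bounded_iff by blast
  hence L: "norm (p x) \<le> L" if "norm x \<le> R" for x using that by auto
  have L0: "L \<ge> 0" using L[of 0] asymp(3) order_trans[OF norm_ge_zero] by auto
  define V where "V = measure lborel (cball 0 R :: 'a set)"
  have V0: "V \<ge> 0" by (simp add: V_def)
  have [measurable]: "cball 0 R \<in> sets (borel :: 'a measure)" by (simp add: borel_closed)
  have V: "emeasure lborel (cball 0 R :: 'a set) = ennreal V"
    unfolding V_def using emeasure_lborel_cball_finite[of "0::'a" R] by (simp add: emeasure_eq_ennreal_measure)
  define D where "D = C1 * R * L"
  have D0: "D \<ge> 0" using C1(1) asymp(3) L0 by (simp add: D_def)
  define K where "K = sqrt (1 / c1 + D\<^sup>2 * V)"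
  have K0: "K > 0" "K\<^sup>2 = 1 / c1 + D\<^sup>2 * V" using asymp(1) V0 D0 by (auto simp: K_def add_pos_nonneg)
  show thesis
  proof (rule that[of "c2 * (C2 * K)\<^sup>2"])
    show "c2 * (C2 * K)\<^sup>2 > 0" using asymp(2) C2(1) K0 by simp
    fix T :: "'a set" and c B and x0 :: 'a
    assume T: "T \<subseteq> cball 0 \<rho>" and B: "B \<ge> 0" and int: "(\<integral>\<^sup>+ x. sq_norm w T c x \<partial>lborel) \<le> ennreal (B\<^sup>2)"
      and x0: "norm x0 > R"
    define g where "g = (\<lambda>x. trig_poly T c x * p x)"
    have gm [measurable]: "g \<in> borel_measurable borel" unfolding g_def by measurable
    have gint: "(\<integral>\<^sup>+ x. ennreal ((norm (g x))\<^sup>2) \<partial>lborel) \<le> ennreal ((K * B)\<^sup>2)"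
    proof -
      have "(\<integral>\<^sup>+ x. ennreal ((norm (g x))\<^sup>2) \<partial>lborel)
        \<le> (\<integral>\<^sup>+ x. ennreal (1 / c1) * sq_norm w T c x + ennreal ((D * B)\<^sup>2) * indicator (cball 0 R) x \<partial>lborel)"
      proof (intro nn_integral_mono)
        fix x :: 'a
        show "ennreal ((norm (g x))\<^sup>2) \<le> ennreal (1 / c1) * sq_norm w T c x + ennreal ((D * B)\<^sup>2) * indicator (cball 0 R) x"
        proof (cases "norm x > R")
          case True
          have "(norm (trig_poly T c x))\<^sup>2 * (c1 * (norm (p x))\<^sup>2) \<le> (norm (trig_poly T c x))\<^sup>2 * w x"
            using asymp(4)[OF True] by (intro mult_left_mono) auto
          hence "(norm (g x))\<^sup>2 \<le> 1 / c1 * ((norm (trig_poly T c x))\<^sup>2 * w x)"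
            using asymp(1) by (simp add: g_def norm_mult power_mult_distrib field_simps)
          hence "ennreal ((norm (g x))\<^sup>2) \<le> ennreal (1 / c1) * sq_norm w T c x"
            using asymp(1) unfolding sq_norm_def by (subst ennreal_mult'[symmetric]) (auto intro: ennreal_leI)
          thus ?thesis using True by simp
        next
          case False
          have "norm (trig_poly T c x) \<le> C1 * norm x * B" using False by (intro C1(2)[OF T B int]) auto
          also have "\<dots> \<le> C1 * R * B" using False C1(1) B by (intro mult_right_mono mult_left_mono) auto
          finally have "norm (g x) \<le> C1 * R * B * L"
            unfolding g_def norm_mult using L[of x] False C1(1) B asymp(3) by (intro mult_mono) auto
          hence "(norm (g x))\<^sup>2 \<le> (D * B)\<^sup>2" by (intro power_mono) (auto simp: D_def mult_ac)
          hence "ennreal ((norm (g x))\<^sup>2) \<le> ennreal ((D * B)\<^sup>2) * indicator (cball 0 R) x"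
            using False by (auto intro: ennreal_leI)
          thus ?thesis by (simp add: add_increasing)
        qed
      qed
      also have "\<dots> = ennreal (1 / c1) * (\<integral>\<^sup>+ x. sq_norm w T c x \<partial>lborel) + ennreal ((D * B)\<^sup>2) * ennreal V"
        by (subst nn_integral_add) (measurable, measurable, simp add: nn_integral_cmult nn_integral_cmult_indicator V)
      also have "\<dots> \<le> ennreal (1 / c1) * ennreal (B\<^sup>2) + ennreal ((D * B)\<^sup>2) * ennreal V"
        using int by (intro add_mono mult_left_mono) auto
      also have "\<dots> = ennreal (1 / c1 * B\<^sup>2 + (D * B)\<^sup>2 * V)"
        using V0 asymp(1) by (simp add: ennreal_mult'[symmetric] ennreal_plus[symmetric] del: ennreal_plus)
      also have "1 / c1 * B\<^sup>2 + (D * B)\<^sup>2 * V = (K * B)\<^sup>2"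
        unfolding power_mult_distrib K0 by (simp add: algebra_simps)
      finally show ?thesis .
    qed
    obtain A where A: "\<And>u v. norm (\<psi> x0 u v) \<le> A * exp (\<tau> * norm u * norm v)" using type[of x0] by blast
    have "norm (g (x0 + 0)) \<le> C2 * (K * B)"
    proof (rule C2(2)[of "\<lambda>u v. trig_line T c x0 u v * \<psi> x0 u v" "(2 * (\<Sum>t\<in>T. \<bar>c t\<bar>)) * A" "\<lambda>y. g (x0 + y)"])
      show "(\<lambda>u. trig_line T c x0 u v * \<psi> x0 u v) holomorphic_on UNIV" for v
        by (intro holomorphic_intros holomorphic_trig_line hol)
      show "continuous_on UNIV (\<lambda>(u, v). trig_line T c x0 u v * \<psi> x0 u v)"
        using continuous_on_mult[OF continuous_trig_line cont] by (simp add: case_prod_unfold)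
      show "norm (trig_line T c x0 u v * \<psi> x0 u v) \<le> (2 * (\<Sum>t\<in>T. \<bar>c t\<bar>)) * A * exp ((\<rho> + \<tau>) * norm u * norm v)" for u v
      proof -
        have "norm (trig_line T c x0 u v * \<psi> x0 u v)
            \<le> ((2 * (\<Sum>t\<in>T. \<bar>c t\<bar>)) * exp (\<rho> * norm u * norm v)) * (A * exp (\<tau> * norm u * norm v))"
          unfolding norm_mult by (intro mult_mono norm_trig_line_le[OF T] A) (auto intro!: mult_nonneg_nonneg sum_nonneg)
        also have "\<dots> = (2 * (\<Sum>t\<in>T. \<bar>c t\<bar>)) * A * (exp (\<rho> * norm u * norm v) * exp (\<tau> * norm u * norm v))"
          by (simp only: mult_ac)
        finally show ?thesis by (simp only: mult_exp_exp ring_distribs)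
      qed
      show "trig_line T c x0 (of_real r) v * \<psi> x0 (of_real r) v = g (x0 + r *\<^sub>R v)" for r v
        by (simp add: g_def trig_line_of_real ext)
      show "0 \<le> K * B" using K0 B by simp
      have "(\<integral>\<^sup>+ y. ennreal ((norm (g (x0 + y)))\<^sup>2) \<partial>lborel) \<le> ennreal ((K * B)\<^sup>2)"
        using gint by (subst nn_integral_lborel_translate[where f="\<lambda>x. ennreal ((norm (g x))\<^sup>2)"]) auto
      moreover have "norm y > -1" for y :: 'a using norm_ge_zero[of y] by linarith
      ultimately show "(\<integral>\<^sup>+ y. ennreal ((norm (g (x0 + y)))\<^sup>2 / (1 + norm y) ^ (2 * 0)) * indicator {y. norm y > -1} y \<partial>lborel)
          \<le> ennreal ((K * B)\<^sup>2)" by simp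
    qed
    hence "(norm (g x0))\<^sup>2 \<le> (C2 * (K * B))\<^sup>2" by (intro power_mono) auto
    moreover have "(norm (trig_poly T c x0))\<^sup>2 * w x0 \<le> (norm (trig_poly T c x0))\<^sup>2 * (c2 * (norm (p x0))\<^sup>2)"
      using asymp(5)[OF x0] by (intro mult_left_mono) auto
    moreover have "\<dots> = c2 * (norm (g x0))\<^sup>2" by (simp add: g_def norm_mult power_mult_distrib)
    moreover have "c2 * (norm (g x0))\<^sup>2 \<le> c2 * (C2 * (K * B))\<^sup>2"
      using calculation(1) asymp(2) by (intro mult_left_mono) auto
    ultimately have "(norm (trig_poly T c x0))\<^sup>2 * w x0 \<le> c2 * (C2 * (K * B))\<^sup>2" by linarith
    thus "(norm (trig_poly T c x0))\<^sup>2 * w x0 \<le> c2 * (C2 * K)\<^sup>2 * B\<^sup>2" by (simp add: power_mult_distrib mult_ac)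
  qed
qed

section \<open>Comparison of the two norms\<close>

definition sq_int :: "('a::euclidean_space \<Rightarrow> real) \<Rightarrow> 'a set \<Rightarrow> ('a \<Rightarrow> real) \<Rightarrow> real" where
  "sq_int w T c = (LINT x|lborel. (norm (trig_poly T c x))\<^sup>2 * w x)"

lemma trig_poly_sum:
  "trig_poly T (\<lambda>t. \<Sum>i\<in>I. u i * c i t) x = (\<Sum>i\<in>I. of_real (u i) * trig_poly T (c i) x)"
  unfolding trig_poly_def sum_distrib_left
  by (subst sum.swap) (simp add: sum_distrib_right mult.assoc)

lemma trig_poly_scale: "trig_poly T (\<lambda>t. s * c t) x = of_real s * trig_poly T c x"
  by (simp add: trig_poly_def sum_distrib_left mult.assoc)

lemma sq_int_scale: "sq_int w T (\<lambda>t. s * c t) = s\<^sup>2 * sq_int w T c"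
  unfolding sq_int_def trig_poly_scale
  by (simp add: norm_mult power_mult_distrib mult.assoc)

text \<open>The hypothesis bounds the squared norm of an evaluation functional on an orthonormal
  system, and the conclusion bounds the diagonal of its reproducing kernel. Testing with
  \<open>u = Re z\<close> and \<open>u = Im z\<close> separately costs the factor 2: the
  combinations are real while the values are complex.\<close>

lemma sum_sq_le_reproducing:
  fixes z :: "nat \<Rightarrow> complex"
  assumes "\<And>u. (norm (\<Sum>i<m. of_real (u i) * z i))\<^sup>2 \<le> L * (\<Sum>i<m. (u i)\<^sup>2)" and "L \<ge> 0"
  shows "(\<Sum>i<m. (norm (z i))\<^sup>2) \<le> 2 * L"
proof -
  have gen: "(\<Sum>i<m. (u i)\<^sup>2) \<le> L" if "\<bar>\<Sum>i<m. (u i)\<^sup>2\<bar> \<le> norm (\<Sum>i<m. of_real (u i) * z i)" for u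
  proof -
    define S where "S = (\<Sum>i<m. (u i)\<^sup>2)"
    have S0: "S \<ge> 0" unfolding S_def by (intro sum_nonneg) auto
    have "S\<^sup>2 \<le> (norm (\<Sum>i<m. of_real (u i) * z i))\<^sup>2"
      using that S0 unfolding S_def by (intro power_mono) auto
    also have "\<dots> \<le> L * S" using assms(1)[of u] unfolding S_def .
    finally have "S * S \<le> L * S" by (simp add: power2_eq_square)
    hence "S \<le> L" using S0 assms(2) by (cases "S = 0") auto
    thus ?thesis by (simp only: S_def)
  qed
  have "(\<Sum>i<m. (Re (z i))\<^sup>2) \<le> L"
  proof (rule gen)
    have "Re (\<Sum>i<m. of_real (Re (z i)) * z i) = (\<Sum>i<m. (Re (z i))\<^sup>2)" by (simp add: power2_eq_square)
    thus "\<bar>\<Sum>i<m. (Re (z i))\<^sup>2\<bar> \<le> norm (\<Sum>i<m. of_real (Re (z i)) * z i)" by (metis abs_Re_le_cmod)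
  qed
  moreover have "(\<Sum>i<m. (Im (z i))\<^sup>2) \<le> L"
  proof (rule gen)
    have "Im (\<Sum>i<m. of_real (Im (z i)) * z i) = (\<Sum>i<m. (Im (z i))\<^sup>2)" by (simp add: power2_eq_square)
    thus "\<bar>\<Sum>i<m. (Im (z i))\<^sup>2\<bar> \<le> norm (\<Sum>i<m. of_real (Im (z i)) * z i)" by (metis abs_Im_le_cmod)
  qed
  ultimately show ?thesis by (simp add: cmod_power2 sum.distrib)
qed

text \<open>The interface between analysis and probability: analytic functions no longer appear,
  only the two kernel bounds and two integrability conditions. The factor
  \<open>(norm x)\<^sup>2\<close> in \<open>near\<close> is exactly the one that
  \<open>near_integrable\<close> pays for, and \<open>w0 x\<close> in \<open>far\<close> is what
  turns a relative deviation into an integrable quantity.\<close>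

locale comparable_weights =
  fixes w0 w1 :: "'a::euclidean_space \<Rightarrow> real" and \<rho> k C1 C2 :: real
  assumes w_meas [measurable]: "w0 \<in> borel_measurable borel" "w1 \<in> borel_measurable borel"
    and w_nonneg: "\<And>x. w0 x \<ge> 0" "\<And>x. w1 x \<ge> 0"
    and w_pos: "\<And>x. x \<noteq> 0 \<Longrightarrow> w0 x > 0" "\<And>x. x \<noteq> 0 \<Longrightarrow> w1 x > 0"
    and sq_integrable: "\<And>T c. finite T \<Longrightarrow> integrable lborel (\<lambda>x. (norm (trig_poly T c x))\<^sup>2 * w0 x)"
      "\<And>T c. finite T \<Longrightarrow> integrable lborel (\<lambda>x. (norm (trig_poly T c x))\<^sup>2 * w1 x)"
    and C_nonneg: "C1 \<ge> 0" "C2 \<ge> 0" and k_pos: "k > 0"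
    and near: "\<And>T c x. finite T \<Longrightarrow> T \<subseteq> cball 0 \<rho> \<Longrightarrow> norm x \<le> k \<Longrightarrow>
      (norm (trig_poly T c x))\<^sup>2 \<le> C1 * (norm x)\<^sup>2 * sq_int w0 T c"
    and far: "\<And>T c x. finite T \<Longrightarrow> T \<subseteq> cball 0 \<rho> \<Longrightarrow> norm x > k \<Longrightarrow>
      (norm (trig_poly T c x))\<^sup>2 * w0 x \<le> C2 * sq_int w0 T c"
    and near_integrable: "integrable lborel (\<lambda>x. (norm x)\<^sup>2 * (w0 x + w1 x) * indicator {x. norm x \<le> k} x)"
    and far_integrable: "integrable lborel (\<lambda>x. ((w1 x - w0 x) / w0 x)\<^sup>2 * indicator {x. norm x > k} x)"
begin

definition near_fun :: "'a \<Rightarrow> real" where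
  "near_fun x = (norm x)\<^sup>2 * (w0 x + w1 x) * indicator {x. norm x \<le> k} x"

definition far_fun :: "'a \<Rightarrow> real" where
  "far_fun x = ((w1 x - w0 x) / w0 x)\<^sup>2 * indicator {x. norm x > k} x"

definition diff_int :: "'a set \<Rightarrow> ('a \<Rightarrow> real) \<Rightarrow> real" where
  "diff_int T c = (LINT x|lborel. (norm (trig_poly T c x))\<^sup>2 * \<bar>w1 x - w0 x\<bar>)"

lemma near_far_integrable [simp]: "integrable lborel near_fun" "integrable lborel far_fun"
  using near_integrable far_integrable unfolding near_fun_def[abs_def] far_fun_def[abs_def] by auto

lemma near_far_nonneg: "near_fun x \<ge> 0" "far_fun x \<ge> 0"
  using w_nonneg[of x] by (auto simp: near_fun_def far_fun_def)

lemma sq_int_nonneg: "sq_int w0 T c \<ge> 0" "sq_int w1 T c \<ge> 0"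
  unfolding sq_int_def using w_nonneg by (auto intro!: integral_nonneg)

lemma diff_integrable:
  assumes "finite T"
  shows "integrable lborel (\<lambda>x. (norm (trig_poly T c x))\<^sup>2 * \<bar>w1 x - w0 x\<bar>)"
proof (rule Bochner_Integration.integrable_bound)
  show "integrable lborel (\<lambda>x. (norm (trig_poly T c x))\<^sup>2 * w0 x + (norm (trig_poly T c x))\<^sup>2 * w1 x)"
    using sq_integrable assms by auto
  show "AE x in lborel. norm ((norm (trig_poly T c x))\<^sup>2 * \<bar>w1 x - w0 x\<bar>)
      \<le> norm ((norm (trig_poly T c x))\<^sup>2 * w0 x + (norm (trig_poly T c x))\<^sup>2 * w1 x)"
  proof (intro AE_I2)
    fix x
    have "(norm (trig_poly T c x))\<^sup>2 * \<bar>w1 x - w0 x\<bar> \<le> (norm (trig_poly T c x))\<^sup>2 * (w0 x + w1 x)"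
      using w_nonneg[of x] by (intro mult_left_mono) auto
    thus "norm ((norm (trig_poly T c x))\<^sup>2 * \<bar>w1 x - w0 x\<bar>)
      \<le> norm ((norm (trig_poly T c x))\<^sup>2 * w0 x + (norm (trig_poly T c x))\<^sup>2 * w1 x)"
      using w_nonneg[of x] by (simp add: distrib_left)
  qed
qed measurable

lemma abs_sq_int_diff_le:
  assumes "finite T"
  shows "\<bar>sq_int w1 T c - sq_int w0 T c\<bar> \<le> diff_int T c"
proof -
  have "sq_int w1 T c - sq_int w0 T c = (LINT x|lborel. (norm (trig_poly T c x))\<^sup>2 * (w1 x - w0 x))"
    unfolding sq_int_def using sq_integrable[OF assms]
    by (subst Bochner_Integration.integral_diff[symmetric]) (auto simp: right_diff_distrib)
  also have "\<bar>\<dots>\<bar> \<le> (LINT x|lborel. \<bar>(norm (trig_poly T c x))\<^sup>2 * (w1 x - w0 x)\<bar>)"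
    by (rule integral_abs_bound)
  finally show ?thesis unfolding diff_int_def by (simp add: abs_mult)
qed

text \<open>The inequality \<open>2 * s * h \<le> s\<^sup>2 + h\<^sup>2\<close> for the relative
  deviation \<open>h\<close>, multiplied by \<open>w0 x\<close>. The free parameter \<open>s\<close>
  serves once as a small weight and once to recover Cauchy-Schwarz.\<close>

lemma diff_far:
  assumes "norm x > k"
  shows "s * \<bar>w1 x - w0 x\<bar> \<le> (s\<^sup>2 * w0 x + w0 x * far_fun x) / 2"
proof -
  have x: "w0 x > 0" using assms k_pos by (intro w_pos) auto
  define h where "h = \<bar>w1 x - w0 x\<bar> / w0 x"
  have h: "\<bar>w1 x - w0 x\<bar> = h * w0 x" "far_fun x = h\<^sup>2"
    using x assms by (auto simp: h_def far_fun_def power_divide)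
  have "2 * (s * h) \<le> s\<^sup>2 + h\<^sup>2" using sum_squares_bound[of s h] by simp
  hence "2 * (s * h) * w0 x \<le> (s\<^sup>2 + h\<^sup>2) * w0 x" using x by (intro mult_right_mono) auto
  thus ?thesis unfolding h by (simp add: algebra_simps)
qed

text \<open>For polynomials of norm 1, everything except a \<open>\<delta>\<close> fraction of the
  L2(w0) density lies below one integrable function independent of \<open>T\<close> and
  \<open>c\<close>. This makes dominated convergence available for sequences of polynomials that are
  merely bounded in norm.\<close>

lemma diff_dominated:
  assumes T: "finite T" "T \<subseteq> cball 0 \<rho>" and d: "\<delta> > 0"
  shows "(norm (trig_poly T c x))\<^sup>2 * \<bar>w1 x - w0 x\<bar>
    \<le> \<delta> * ((norm (trig_poly T c x))\<^sup>2 * w0 x) + sq_int w0 T c * (C1 * near_fun x + C2 / \<delta> * far_fun x)"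
proof (cases "norm x \<le> k")
  case True
  have "(norm (trig_poly T c x))\<^sup>2 * \<bar>w1 x - w0 x\<bar> \<le> (C1 * (norm x)\<^sup>2 * sq_int w0 T c) * (w0 x + w1 x)"
    using near[OF T True, of c] w_nonneg[of x] C_nonneg sq_int_nonneg by (intro mult_mono mult_nonneg_nonneg) auto
  also have "\<dots> = sq_int w0 T c * (C1 * near_fun x)" using True by (simp add: near_fun_def)
  finally show ?thesis
    using w_nonneg[of x] d True by (simp add: far_fun_def add_increasing)
next
  case False
  define n where "n = (norm (trig_poly T c x))\<^sup>2"
  have n: "n \<ge> 0" by (simp add: n_def)
  have x: "norm x > k" using False by simp
  define W where "W = w0 x * far_fun x"
  have "2 * \<delta> * \<bar>w1 x - w0 x\<bar> \<le> (4 * \<delta>\<^sup>2 * w0 x + W) / 2"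
    using diff_far[OF x, of "2 * \<delta>"] unfolding W_def power_mult_distrib by simp
  hence "\<bar>w1 x - w0 x\<bar> * (4 * \<delta>) \<le> 4 * \<delta>\<^sup>2 * w0 x + W" by (simp add: mult_ac)
  hence "\<bar>w1 x - w0 x\<bar> \<le> (4 * \<delta>\<^sup>2 * w0 x + W) / (4 * \<delta>)"
    using d by (simp add: pos_le_divide_eq)
  also have "\<dots> = \<delta> * w0 x + w0 x * far_fun x / (4 * \<delta>)"
    using d by (simp add: W_def add_divide_distrib power2_eq_square)
  also have "w0 x * far_fun x / (4 * \<delta>) \<le> w0 x * far_fun x / \<delta>"
    using d w_nonneg[of x] near_far_nonneg[of x] by (intro divide_left_mono) auto
  finally have "n * \<bar>w1 x - w0 x\<bar> \<le> n * (\<delta> * w0 x + w0 x * far_fun x / \<delta>)"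
    using n by (intro mult_left_mono) auto
  also have "\<dots> = \<delta> * (n * w0 x) + (n * w0 x) * (far_fun x / \<delta>)" by (simp add: algebra_simps)
  also have "(n * w0 x) * (far_fun x / \<delta>) \<le> (C2 * sq_int w0 T c) * (far_fun x / \<delta>)"
    using far[OF T x, of c] d near_far_nonneg[of x] unfolding n_def by (intro mult_right_mono) auto
  also have "\<dots> = sq_int w0 T c * (C1 * near_fun x + C2 / \<delta> * far_fun x)"
    using x by (simp add: near_fun_def)
  finally show ?thesis by (simp add: n_def)
qed

lemma sq_int_upper:
  obtains b where "b > 0" "\<And>T c. finite T \<Longrightarrow> T \<subseteq> cball 0 \<rho> \<Longrightarrow> sq_int w1 T c \<le> b * sq_int w0 T c"
proof -
  define I where "I = (LINT x|lborel. C1 * near_fun x + C2 / 1 * far_fun x)"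
  have I: "I \<ge> 0" unfolding I_def using near_far_nonneg C_nonneg by (auto intro!: integral_nonneg)
  show thesis
  proof (rule that[of "2 + I"])
    fix T c assume T: "finite (T :: 'a set)" "T \<subseteq> cball 0 \<rho>"
    have "diff_int T c \<le> (LINT x|lborel. 1 * ((norm (trig_poly T c x))\<^sup>2 * w0 x) + sq_int w0 T c * (C1 * near_fun x + C2 / 1 * far_fun x))"
      unfolding diff_int_def using sq_integrable(1)[OF T(1)]
      by (intro integral_mono diff_integrable T diff_dominated) auto
    also have "\<dots> = sq_int w0 T c + sq_int w0 T c * I"
      unfolding sq_int_def I_def using sq_integrable(1)[OF T(1)]
      by (subst Bochner_Integration.integral_add) auto
    finally show "sq_int w1 T c \<le> (2 + I) * sq_int w0 T c"
      using abs_sq_int_diff_le[OF T(1), of c] by (simp add: algebra_simps)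
  qed (use I in simp)
qed

text \<open>If the two norms were not comparable, a normalised sequence would tend to \<open>0\<close> in
  \<open>L\<^sup>2(w1)\<close>, hence almost everywhere along a subsequence because \<open>w1 > 0\<close>; the domination above
  then forces the two norms to be asymptotically close, a contradiction.\<close>

lemma sq_int_lower:
  obtains a where "a > 0" "\<And>T c. finite T \<Longrightarrow> T \<subseteq> cball 0 \<rho> \<Longrightarrow> a * sq_int w0 T c \<le> sq_int w1 T c"
proof (rule ccontr)
  note thesisI = that
  assume "\<not> thesis"
  hence "\<exists>T c. finite T \<and> T \<subseteq> cball 0 \<rho> \<and> a * sq_int w0 T c > sq_int w1 T c" if "a > 0" for a
    using thesisI[of a] \<open>a > 0\<close> by (meson not_le)
  hence "\<forall>n. \<exists>T c. finite T \<and> T \<subseteq> cball 0 \<rho> \<and> inverse (real (Suc n)) * sq_int w0 T c > sq_int w1 T c"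
    by simp
  then obtain T c where T: "\<And>n. finite (T n)" "\<And>n. T n \<subseteq> cball 0 \<rho>"
    and lt: "\<And>n. inverse (real (Suc n)) * sq_int w0 (T n) (c n) > sq_int w1 (T n) (c n)" by metis
  have pos: "sq_int w0 (T n) (c n) > 0" for n
    using lt[of n] sq_int_nonneg[where T="T n" and c="c n"]
    by (metis less_eq_real_def mult_zero_right not_le)
  define d where "d = (\<lambda>n t. 1 / sqrt (sq_int w0 (T n) (c n)) * c n t)"
  have d0: "sq_int w0 (T n) (d n) = 1" for n
    unfolding d_def sq_int_scale using pos[of n] by (simp add: power_divide)
  have d1: "sq_int w1 (T n) (d n) \<le> inverse (real (Suc n))" for n
    unfolding d_def sq_int_scale using lt[of n] pos[of n] by (simp add: power_divide divide_simps)
  define u where "u = (\<lambda>n x. (norm (trig_poly (T n) (d n) x))\<^sup>2)"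
  have u0: "u n x \<ge> 0" for n x by (simp add: u_def)
  have um [measurable]: "u n \<in> borel_measurable borel" for n unfolding u_def by measurable
  have "\<exists>r::nat\<Rightarrow>nat. strict_mono r \<and> (AE x in lborel. (\<lambda>n. u (r n) x * w1 x) \<longlonglongrightarrow> 0)"
  proof (rule tendsto_L1_AE_subseq)
    show "integrable lborel (\<lambda>x. u n x * w1 x)" for n unfolding u_def by (rule sq_integrable[OF T(1)])
    have "(\<lambda>n. sq_int w1 (T n) (d n)) \<longlonglongrightarrow> 0"
      by (rule tendsto_sandwich[OF _ _ tendsto_const LIMSEQ_inverse_real_of_nat])
         (use d1 sq_int_nonneg in auto)
    thus "(\<lambda>n. LINT x|lborel. norm (u n x * w1 x)) \<longlonglongrightarrow> 0"
      unfolding sq_int_def u_def using w_nonneg by (simp add: abs_mult)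
  qed
  then obtain r :: "nat \<Rightarrow> nat" where r: "strict_mono r" "AE x in lborel. (\<lambda>n. u (r n) x * w1 x) \<longlonglongrightarrow> 0" by blast
  have AE0: "AE x in lborel. x \<noteq> (0::'a)" by (rule AE_lborel_singleton)
  have u_lim: "AE x in lborel. (\<lambda>n. u (r n) x) \<longlonglongrightarrow> 0"
    using r(2) AE0
  proof eventually_elim
    case (elim x)
    have "(\<lambda>n. u (r n) x * w1 x * inverse (w1 x)) \<longlonglongrightarrow> 0 * inverse (w1 x)"
      by (intro tendsto_intros elim)
    thus ?case using w_pos(2)[of x] elim by (simp add: mult.assoc)
  qed
  define m where "m = (\<lambda>x. C1 * near_fun x + C2 / (1/2) * far_fun x)"
  have m0: "m x \<ge> 0" for x unfolding m_def using near_far_nonneg C_nonneg by simp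
  have mi: "integrable lborel m" unfolding m_def by simp
  \<comment> \<open>Only the excess over half of \<open>u n x * w0 x\<close> is dominated by
    \<open>m\<close>, so the positive part of this excess is passed to the limit.\<close>
  define v where "v = (\<lambda>n x. max 0 (u n x * \<bar>w1 x - w0 x\<bar> - 1/2 * (u n x * w0 x)))"
  have vm: "v n x \<le> m x" for n x
    using diff_dominated[OF T(1)[of n] T(2)[of n], of "1/2" "d n" x] d0[of n] m0[of x]
    unfolding v_def m_def u_def by simp
  have "(\<lambda>n. LINT x|lborel. v (r n) x) \<longlonglongrightarrow> (LINT x::'a|lborel. (0::real))"
  proof (rule integral_dominated_convergence[where w=m and s="\<lambda>n. v (r n)"])
    show "AE x in lborel. (\<lambda>n. v (r n) x) \<longlonglongrightarrow> 0"
      using u_lim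
    proof eventually_elim
      case (elim x)
      have "(\<lambda>n. max 0 (u (r n) x * \<bar>w1 x - w0 x\<bar> - 1/2 * (u (r n) x * w0 x)))
          \<longlonglongrightarrow> max 0 (0 * \<bar>w1 x - w0 x\<bar> - 1/2 * (0 * w0 x))"
        by (intro tendsto_intros elim)
      thus ?case by (simp add: v_def)
    qed
    show "AE x in lborel. norm (v (r n) x) \<le> m x" for n
      using vm[of "r n"] by (auto simp: v_def)
    show "(\<lambda>x. v (r n) x) \<in> borel_measurable lborel" for n unfolding v_def by measurable
  qed (use mi in auto)
  hence vlim: "(\<lambda>n. LINT x|lborel. v (r n) x) \<longlonglongrightarrow> 0" by simp
  have vi: "integrable lborel (v n)" for n
    by (rule Bochner_Integration.integrable_bound[OF mi]) (use vm[of n] m0 in \<open>auto simp: v_def\<close>)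
  \<comment> \<open>The norms differ by almost 1 while the undominated half contributes at most 1/2;
    in the limit this reads \<open>1 \<le> 1/2\<close>.\<close>
  have ineq: "1 - inverse (real (Suc n)) \<le> 1/2 + (LINT x|lborel. v n x)" for n
  proof -
    have "1 - inverse (real (Suc n)) \<le> \<bar>sq_int w1 (T n) (d n) - sq_int w0 (T n) (d n)\<bar>"
      using d0[of n] d1[of n] by simp
    also have "\<dots> \<le> diff_int (T n) (d n)" by (rule abs_sq_int_diff_le[OF T(1)])
    also have "\<dots> \<le> (LINT x|lborel. 1/2 * ((norm (trig_poly (T n) (d n) x))\<^sup>2 * w0 x) + v n x)"
      unfolding diff_int_def using sq_integrable(1)[OF T(1)] vi
      by (intro integral_mono diff_integrable T) (auto simp: v_def u_def)
    also have "\<dots> = 1/2 * sq_int w0 (T n) (d n) + (LINT x|lborel. v n x)"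
      unfolding sq_int_def using sq_integrable(1)[OF T(1)] vi
      by (subst Bochner_Integration.integral_add) auto
    finally show ?thesis using d0[of n] by simp
  qed
  have l1: "(\<lambda>n. 1 - inverse (real (Suc (r n)))) \<longlonglongrightarrow> 1 - 0"
    using LIMSEQ_subseq_LIMSEQ[OF LIMSEQ_inverse_real_of_nat r(1)] unfolding o_def by (intro tendsto_intros)
  have l2: "(\<lambda>n. 1/2 + (LINT x|lborel. v (r n) x)) \<longlonglongrightarrow> 1/2 + 0"
    by (intro tendsto_intros vlim)
  have "1 - 0 \<le> 1/2 + (0::real)" by (rule LIMSEQ_le[OF l1 l2]) (use ineq in blast)
  thus False by simp
qed

text \<open>The system is orthonormal for \<open>w0\<close>, and the sum runs over squared diagonal
  entries of the difference form. The near parts are summable, since the kernel bound times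
  \<open>near_fun\<close> is integrable, and each is at most \<open>\<alpha>\<close>, so their
  squares are summable. The far parts need not be summable, but by Cauchy-Schwarz their squares are
  at most integrals of \<open>\<phi> i * w0 * far_fun\<close>, and these sum up by the far kernel
  bound. This is where square integrability of the relative deviation enters.\<close>

lemma hilbert_schmidt_bound:
  obtains C where "C > 0"
    "\<And>T (c :: nat \<Rightarrow> 'a \<Rightarrow> real) m. finite T \<Longrightarrow> T \<subseteq> cball 0 \<rho> \<Longrightarrow>
      (\<And>u. sq_int w0 T (\<lambda>t. \<Sum>i<m. u i * c i t) = (\<Sum>i<m. (u i)\<^sup>2)) \<Longrightarrow>
      (\<Sum>i<m. (sq_int w1 T (c i) - sq_int w0 T (c i))\<^sup>2) \<le> C"
proof -
  define \<alpha> where "\<alpha> = (LINT x|lborel. C1 * near_fun x)"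
  define \<beta> where "\<beta> = (LINT x|lborel. C2 * far_fun x)"
  have ab: "\<alpha> \<ge> 0" "\<beta> \<ge> 0" unfolding \<alpha>_def \<beta>_def using near_far_nonneg C_nonneg by (auto intro!: integral_nonneg)
  show thesis
  \<comment> \<open>The summand 1 only makes the constant positive when both integrals
    vanish.\<close>
  proof (rule that[of "4 * \<alpha>\<^sup>2 + 4 * \<beta> + 1"])
    fix T and c :: "nat \<Rightarrow> 'a \<Rightarrow> real" and m
    assume T: "finite T" "T \<subseteq> cball 0 \<rho>"
      and on: "\<And>u. sq_int w0 T (\<lambda>t. \<Sum>i<m. u i * c i t) = (\<Sum>i<m. (u i)\<^sup>2)"
    define \<phi> where "\<phi> = (\<lambda>i x. (norm (trig_poly T (c i) x))\<^sup>2)"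
    have \<phi>0: "\<phi> i x \<ge> 0" for i x by (simp add: \<phi>_def)
    have \<phi>m [measurable]: "\<phi> i \<in> borel_measurable borel" for i unfolding \<phi>_def by measurable
    have on1: "sq_int w0 T (c i) = 1" if "i < m" for i
    proof -
      have "(\<lambda>t. \<Sum>j<m. (if j = i then 1 else 0) * c j t) = c i" using that by (simp add: if_distrib[of "\<lambda>a. a * _"] cong: if_cong)
      moreover have "(\<Sum>j<m. (if j = i then 1 else 0 :: real)\<^sup>2) = 1" using that by (simp add: if_distrib[of "\<lambda>a. a\<^sup>2"] cong: if_cong)
      ultimately show ?thesis using on[of "\<lambda>j. if j = i then 1 else 0"] by simp
    qed
    have Snear: "(\<Sum>i<m. \<phi> i x) \<le> 2 * (C1 * (norm x)\<^sup>2)" if "norm x \<le> k" for x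
      unfolding \<phi>_def
    proof (rule sum_sq_le_reproducing)
      show "(norm (\<Sum>i<m. of_real (u i) * trig_poly T (c i) x))\<^sup>2 \<le> C1 * (norm x)\<^sup>2 * (\<Sum>i<m. (u i)\<^sup>2)" for u
        using near[OF T that, of "\<lambda>t. \<Sum>i<m. u i * c i t"] unfolding on trig_poly_sum .
    qed (use C_nonneg in auto)
    have Sfar: "(\<Sum>i<m. \<phi> i x) * w0 x \<le> 2 * C2" if x: "norm x > k" for x
    proof -
      have wx: "w0 x > 0" using x k_pos by (intro w_pos) auto
      have "(\<Sum>i<m. \<phi> i x) \<le> 2 * (C2 / w0 x)" unfolding \<phi>_def
      proof (rule sum_sq_le_reproducing)
        show "(norm (\<Sum>i<m. of_real (u i) * trig_poly T (c i) x))\<^sup>2 \<le> C2 / w0 x * (\<Sum>i<m. (u i)\<^sup>2)" for u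
          using far[OF T x, of "\<lambda>t. \<Sum>i<m. u i * c i t"] wx unfolding on trig_poly_sum by (simp add: field_simps)
      qed (use C_nonneg wx in auto)
      thus ?thesis using wx by (simp add: field_simps)
    qed
    define nr where "nr = (\<lambda>i. LINT x|lborel. \<phi> i x * \<bar>w1 x - w0 x\<bar> * indicator {x. norm x \<le> k} x)"
    define fr where "fr = (\<lambda>i. LINT x|lborel. \<phi> i x * \<bar>w1 x - w0 x\<bar> * indicator {x. norm x > k} x)"
    have di: "integrable lborel (\<lambda>x. \<phi> i x * \<bar>w1 x - w0 x\<bar>)" for i
      unfolding \<phi>_def by (rule diff_integrable[OF T(1)])
    have ni: "integrable lborel (\<lambda>x. \<phi> i x * \<bar>w1 x - w0 x\<bar> * indicator {x. norm x \<le> k} x)" for i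
      by (intro integrable_real_mult_indicator di) simp
    have fi: "integrable lborel (\<lambda>x. \<phi> i x * \<bar>w1 x - w0 x\<bar> * indicator {x. norm x > k} x)" for i
      by (intro integrable_real_mult_indicator di) simp
    have split: "diff_int T (c i) = nr i + fr i" for i
    proof -
      have "diff_int T (c i) = (LINT x|lborel. \<phi> i x * \<bar>w1 x - w0 x\<bar> * indicator {x. norm x \<le> k} x
          + \<phi> i x * \<bar>w1 x - w0 x\<bar> * indicator {x. norm x > k} x)"
        unfolding diff_int_def \<phi>_def by (intro Bochner_Integration.integral_cong) (auto simp: indicator_def)
      thus ?thesis unfolding nr_def fr_def using ni fi by simp
    qed
    have nr0: "nr i \<ge> 0" and fr0: "fr i \<ge> 0" for i unfolding nr_def fr_def using \<phi>0 by (auto intro!: integral_nonneg)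
    have nr1: "nr i \<le> \<alpha>" if "i < m" for i
      unfolding nr_def \<alpha>_def
    proof (rule integral_mono)
      fix x
      show "\<phi> i x * \<bar>w1 x - w0 x\<bar> * indicator {x. norm x \<le> k} x \<le> C1 * near_fun x"
      proof (cases "norm x \<le> k")
        case True
        have "\<phi> i x * \<bar>w1 x - w0 x\<bar> \<le> (C1 * (norm x)\<^sup>2 * 1) * (w0 x + w1 x)"
          using near[OF T True, of "c i"] on1[OF that] w_nonneg[of x] C_nonneg unfolding \<phi>_def by (intro mult_mono) auto
        thus ?thesis using True by (simp add: near_fun_def mult.assoc)
      qed (simp add: near_fun_def)
    qed (use ni in auto)
    have nrsum: "(\<Sum>i<m. nr i) \<le> 2 * \<alpha>"
    proof -
      have "(\<Sum>i<m. nr i) = (LINT x|lborel. (\<Sum>i<m. \<phi> i x * \<bar>w1 x - w0 x\<bar> * indicator {x. norm x \<le> k} x))"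
        unfolding nr_def by (rule Bochner_Integration.integral_sum[symmetric]) (rule ni)
      also have "\<dots> \<le> (LINT x|lborel. 2 * (C1 * near_fun x))"
      proof (rule integral_mono)
        fix x
        show "(\<Sum>i<m. \<phi> i x * \<bar>w1 x - w0 x\<bar> * indicator {x. norm x \<le> k} x) \<le> 2 * (C1 * near_fun x)"
        proof (cases "norm x \<le> k")
          case True
          have "(\<Sum>i<m. \<phi> i x) * \<bar>w1 x - w0 x\<bar> \<le> (2 * (C1 * (norm x)\<^sup>2)) * (w0 x + w1 x)"
            using Snear[OF True] w_nonneg[of x] C_nonneg by (intro mult_mono) auto
          thus ?thesis using True by (simp add: near_fun_def mult.assoc sum_distrib_right)
        qed (simp add: near_fun_def)
      qed (rule Bochner_Integration.integrable_sum, rule ni, simp)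
      finally show ?thesis by (simp add: \<alpha>_def)
    qed
    define g where "g = (\<lambda>i x. \<phi> i x * w0 x * far_fun x)"
    have gi: "integrable lborel (g i)" if "i < m" for i
    proof (rule Bochner_Integration.integrable_bound[of _ "\<lambda>x. C2 * far_fun x"])
      show "AE x in lborel. norm (g i x) \<le> norm (C2 * far_fun x)"
      proof (rule AE_I2)
        fix x
        show "norm (g i x) \<le> norm (C2 * far_fun x)"
        proof (cases "norm x > k")
          case True
          have "\<phi> i x * w0 x * far_fun x \<le> C2 * far_fun x"
            using far[OF T True, of "c i"] on1[OF that] near_far_nonneg[of x] unfolding \<phi>_def by (intro mult_right_mono) auto
          thus ?thesis using \<phi>0[of i x] w_nonneg[of x] near_far_nonneg[of x] C_nonneg by (simp add: g_def)
        qed (simp add: g_def far_fun_def)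
      qed
      show "g i \<in> borel_measurable lborel" unfolding g_def far_fun_def by measurable
    qed simp
    \<comment> \<open>Cauchy-Schwarz in disguise: \<open>diff_far\<close> with
      \<open>s = fr i\<close>, integrated against \<open>\<phi> i\<close>, gives
      \<open>(fr i)\<^sup>2\<close> at most half of itself plus half of the integral of
      \<open>g i\<close>.\<close>
    have frsq: "(fr i)\<^sup>2 \<le> (LINT x|lborel. g i x)" if "i < m" for i
    proof -
      have "fr i * fr i = (LINT x|lborel. fr i * (\<phi> i x * \<bar>w1 x - w0 x\<bar> * indicator {x. norm x > k} x))"
        by (simp add: fr_def)
      also have "\<dots> \<le> (LINT x|lborel. (fr i)\<^sup>2 / 2 * (\<phi> i x * w0 x) + 1/2 * g i x)"
      proof (rule integral_mono)
        fix x
        show "fr i * (\<phi> i x * \<bar>w1 x - w0 x\<bar> * indicator {x. norm x > k} x) \<le> (fr i)\<^sup>2 / 2 * (\<phi> i x * w0 x) + 1/2 * g i x"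
        proof (cases "norm x > k")
          case True
          from mult_left_mono[OF diff_far[OF True, of "fr i"] \<phi>0[of i x]]
          show ?thesis using True by (simp add: g_def algebra_simps add_divide_distrib)
        next
          case False
          thus ?thesis using \<phi>0[of i x] w_nonneg[of x] by (simp add: g_def far_fun_def)
        qed
      qed (use fi gi[OF that] sq_integrable(1)[OF T(1)] in \<open>auto simp: \<phi>_def\<close>)
      also have "\<dots> = (fr i)\<^sup>2 / 2 * sq_int w0 T (c i) + 1/2 * (LINT x|lborel. g i x)"
        unfolding sq_int_def \<phi>_def using gi[OF that] sq_integrable(1)[OF T(1)]
        by (subst Bochner_Integration.integral_add) auto
      finally show ?thesis using on1[OF that] by (simp add: power2_eq_square)
    qed
    have gsum: "(\<Sum>i<m. LINT x|lborel. g i x) \<le> 2 * \<beta>"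
    proof -
      have "(\<Sum>i<m. LINT x|lborel. g i x) = (LINT x|lborel. (\<Sum>i<m. g i x))" using gi by simp
      also have "\<dots> \<le> (LINT x|lborel. 2 * (C2 * far_fun x))"
      proof (rule integral_mono)
        fix x
        show "(\<Sum>i<m. g i x) \<le> 2 * (C2 * far_fun x)"
        proof (cases "norm x > k")
          case True
          have "(\<Sum>i<m. g i x) = (\<Sum>i<m. \<phi> i x) * w0 x * far_fun x" by (simp add: g_def sum_distrib_right)
          also have "\<dots> \<le> 2 * C2 * far_fun x"
            using Sfar[OF True] near_far_nonneg[of x] by (intro mult_right_mono) auto
          finally show ?thesis by simp
        qed (simp add: g_def far_fun_def)
      qed (use gi in auto)
      finally show ?thesis by (simp add: \<beta>_def)
    qed
    have "(\<Sum>i<m. (sq_int w1 T (c i) - sq_int w0 T (c i))\<^sup>2) \<le> (\<Sum>i<m. 2 * (\<alpha> * nr i) + 2 * (LINT x|lborel. g i x))"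
    proof (intro sum_mono)
      fix i assume "i \<in> {..<m}"
      hence i: "i < m" by simp
      have "(sq_int w1 T (c i) - sq_int w0 T (c i))\<^sup>2 \<le> (nr i + fr i)\<^sup>2"
        using abs_sq_int_diff_le[OF T(1), of "c i"] split[of i] by (simp add: abs_le_square_iff[symmetric])
      also have "\<dots> \<le> 2 * (nr i)\<^sup>2 + 2 * (fr i)\<^sup>2"
        using sum_squares_bound[of "nr i" "fr i"] by (simp add: power2_sum)
      also have "(nr i)\<^sup>2 \<le> \<alpha> * nr i" using nr1[OF i] nr0[of i] by (simp add: power2_eq_square mult_right_mono)
      finally show "(sq_int w1 T (c i) - sq_int w0 T (c i))\<^sup>2 \<le> 2 * (\<alpha> * nr i) + 2 * (LINT x|lborel. g i x)"
        using frsq[OF i] by linarith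
    qed
    also have "\<dots> = 2 * (\<alpha> * (\<Sum>i<m. nr i)) + 2 * (\<Sum>i<m. LINT x|lborel. g i x)"
      by (simp add: sum.distrib sum_distrib_left)
    also have "\<dots> \<le> 2 * (\<alpha> * (2 * \<alpha>)) + 2 * (2 * \<beta>)"
      using nrsum gsum ab by (intro add_mono mult_left_mono) auto
    also have "\<dots> \<le> 4 * \<alpha>\<^sup>2 + 4 * \<beta> + 1" by (simp add: power2_eq_square)
    finally show "(\<Sum>i<m. (sq_int w1 T (c i) - sq_int w0 T (c i))\<^sup>2) \<le> 4 * \<alpha>\<^sup>2 + 4 * \<beta> + 1" .
  qed (use ab in \<open>simp add: add_nonneg_pos\<close>)
qed

end

section \<open>Linear algebra and one-dimensional normal laws\<close>

text \<open>The form may be degenerate: the parameter 0 gives a null vector, and distinct parameters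
  may be dependent. Hence null residuals produce no new basis vector, and the unit vectors are
  represented only up to vectors of norm 0.\<close>

lemma gram_schmidt_form:
  fixes B :: "('t \<Rightarrow> real) \<Rightarrow> ('t \<Rightarrow> real) \<Rightarrow> real"
  assumes lin: "\<And>c a d e. B (\<lambda>s. c s + a * d s) e = B c e + a * B d e"
    and sym: "\<And>c d. B c d = B d c" and nonneg: "\<And>c. B c c \<ge> 0" and T: "finite T"
  obtains m b \<beta> where
    "\<And>i j. i < m \<Longrightarrow> j < m \<Longrightarrow> B (b i) (b j) = (if i = j then 1 else 0)"
    "\<And>t. t \<in> T \<Longrightarrow> B (\<lambda>s. (if s = t then 1 else 0) - (\<Sum>i<(m::nat). \<beta> t i * b i s))
                     (\<lambda>s. (if s = t then 1 else 0) - (\<Sum>i<m. \<beta> t i * b i s)) = 0"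
proof -
  have zero: "B (\<lambda>s. 0) e = 0" for e using lin[of "\<lambda>s. 0" 1 "\<lambda>s. 0" e] by simp
  have scale: "B (\<lambda>s. a * d s) e = a * B d e" for a d e using lin[of "\<lambda>s. 0" a d e] zero by simp
  have diff: "B (\<lambda>s. c s - (\<Sum>i<m. u i * b i s)) e = B c e - (\<Sum>i<m. u i * B (b i) e)" for c u b e and m :: nat
  proof (induction m)
    case (Suc m)
    have "B (\<lambda>s. c s - (\<Sum>i<Suc m. u i * b i s)) e = B (\<lambda>s. (c s - (\<Sum>i<m. u i * b i s)) + (- u m) * b m s) e"
      by (simp add: algebra_simps)
    also have "\<dots> = B c e - (\<Sum>i<Suc m. u i * B (b i) e)" unfolding lin Suc by simp
    finally show ?case .
  qed simp
  have "\<exists>m b \<beta>. (\<forall>i<m. \<forall>j<m. B (b i) (b j) = (if i = j then 1 else 0)) \<and>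
     (\<forall>t\<in>T. B (\<lambda>s. (if s = t then 1 else 0) - (\<Sum>i<(m::nat). \<beta> t i * b i s))
                     (\<lambda>s. (if s = t then 1 else 0) - (\<Sum>i<m. \<beta> t i * b i s)) = 0)"
    using T
  proof (induction T)
    case empty
    show ?case by (rule exI[of _ 0]) simp
  next
    case (insert x T)
    then obtain m b \<beta> where on: "\<And>i j. i < m \<Longrightarrow> j < m \<Longrightarrow> B (b i) (b j) = (if i = j then 1 else 0)"
      and res: "\<And>t. t \<in> T \<Longrightarrow> B (\<lambda>s. (if s = t then 1 else 0) - (\<Sum>i<m. \<beta> t i * b i s))
                     (\<lambda>s. (if s = t then 1 else 0) - (\<Sum>i<(m::nat). \<beta> t i * b i s)) = 0" by blast
    define e :: "'t \<Rightarrow> real" where "e = (\<lambda>s. if s = x then 1 else 0)"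
    define r where "r = (\<lambda>s. e s - (\<Sum>i<m. B e (b i) * b i s))"
    show ?case
    proof (cases "B r r = 0")
      \<comment> \<open>\<open>x\<close> lies in the span up to a null vector, so the system stays
        and only the coefficients of \<open>x\<close> are added.\<close>
      case True
      show ?thesis
      proof (intro exI conjI ballI)
        show "\<forall>i<m. \<forall>j<m. B (b i) (b j) = (if i = j then 1 else 0)" using on by blast
        fix t assume t: "t \<in> insert x T"
        show "B (\<lambda>s. (if s = t then 1 else 0) - (\<Sum>i<m. (\<beta>(x := \<lambda>i. B e (b i))) t i * b i s))
              (\<lambda>s. (if s = t then 1 else 0) - (\<Sum>i<m. (\<beta>(x := \<lambda>i. B e (b i))) t i * b i s)) = 0"
        proof (cases "t = x")
          case True
          thus ?thesis using \<open>B r r = 0\<close> unfolding r_def e_def by simp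
        next
          case False
          thus ?thesis using res[of t] t by simp
        qed
      qed
    next
      case False
      define n where "n = sqrt (B r r)"
      have n: "n > 0" "n * n = B r r" using False nonneg[of r] by (auto simp: n_def)
      have rb: "B r (b j) = 0" if "j < m" for j
      proof -
        have "B r (b j) = B e (b j) - (\<Sum>i<m. B e (b i) * B (b i) (b j))" unfolding r_def by (rule diff)
        also have "(\<Sum>i<m. B e (b i) * B (b i) (b j)) = (\<Sum>i<m. if i = j then B e (b i) else 0)"
          using on that by (intro sum.cong) auto
        finally show ?thesis using that by simp
      qed
      define b' where "b' = b(m := \<lambda>s. 1 / n * r s)"
      define \<beta>' where "\<beta>' = (\<lambda>t i. if t = x then (if i = m then n else B e (b i)) else (if i = m then 0 else \<beta> t i))"
      have scale_m: "B (b' m) f = 1 / n * B r f" for f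
        unfolding b'_def fun_upd_same by (rule scale)
      have bm: "B (b' m) (b j) = 0" if "j < m" for j unfolding scale_m rb[OF that] by simp
      have bmm: "B (b' m) (b' m) = 1"
      proof -
        have "B (b' m) (b' m) = 1 / n * B r (b' m)" by (rule scale_m)
        also have "B r (b' m) = B (b' m) r" by (rule sym)
        also have "\<dots> = 1 / n * B r r" by (rule scale_m)
        finally show ?thesis using n(1) by (simp add: n(2)[symmetric])
      qed
      have b'_eq: "b' i = b i" if "i < m" for i using that by (simp add: b'_def)
      have on': "B (b' i) (b' j) = (if i = j then 1 else 0)" if ij: "i < Suc m" "j < Suc m" for i j
      proof -
        consider "i < m" "j < m" | "i = m" "j < m" | "i < m" "j = m" | "i = m" "j = m" using ij by (auto simp: less_Suc_eq)
        thus ?thesis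
        proof cases
          case 1 thus ?thesis using on b'_eq by simp
        next
          case 2 thus ?thesis using bm b'_eq by simp
        next
          case 3 thus ?thesis using bm[of i] b'_eq sym[of "b' i" "b' m"] by simp
        next
          case 4 thus ?thesis using bmm by simp
        qed
      qed
      have sum_eq: "(\<Sum>i<Suc m. \<beta>' t i * b' i s) = (if t = x then (\<Sum>i<m. B e (b i) * b i s) + r s else (\<Sum>i<m. \<beta> t i * b i s))" for t s
      proof -
        have "(\<Sum>i<m. \<beta>' t i * b' i s) = (\<Sum>i<m. (if t = x then B e (b i) else \<beta> t i) * b i s)"
          by (intro sum.cong) (auto simp: \<beta>'_def b'_def)
        moreover have "\<beta>' t m * b' m s = (if t = x then r s else 0)" using n by (simp add: \<beta>'_def b'_def)
        ultimately show ?thesis by simp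
      qed
      show ?thesis
      proof (intro exI[of _ "Suc m"] exI[of _ b'] exI[of _ \<beta>'] conjI ballI)
        show "\<forall>i<Suc m. \<forall>j<Suc m. B (b' i) (b' j) = (if i = j then 1 else 0)" using on' by blast
        fix t assume t: "t \<in> insert x T"
        show "B (\<lambda>s. (if s = t then 1 else 0) - (\<Sum>i<Suc m. \<beta>' t i * b' i s))
              (\<lambda>s. (if s = t then 1 else 0) - (\<Sum>i<Suc m. \<beta>' t i * b' i s)) = 0"
        proof (cases "t = x")
          case True
          have "(\<lambda>s. (if s = t then 1 else 0) - (\<Sum>i<Suc m. \<beta>' t i * b' i s)) = (\<lambda>s. 0)"
            unfolding sum_eq using True by (auto simp: r_def e_def)
          thus ?thesis using zero by simp
        next
          case False
          thus ?thesis unfolding sum_eq using res[of t] t by simp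
        qed
      qed
    qed
  qed
  thus thesis using that by blast
qed

text \<open>Jacobi's method as a variational argument: an orthogonal matrix maximising the sum of the
  squared diagonal entries diagonalises the form, since a plane rotation annihilating an off-diagonal entry
  would increase that sum.\<close>

lemma symmetric_diagonalization:
  fixes C :: "nat \<Rightarrow> nat \<Rightarrow> real"
  assumes sym: "\<And>k l. C k l = C l k"
  obtains U where
    "\<And>i j. i < m \<Longrightarrow> j < m \<Longrightarrow> (\<Sum>k<m. U i k * U j k) = (if i = j then 1 else 0)"
    "\<And>k l. k < m \<Longrightarrow> l < m \<Longrightarrow> (\<Sum>i<m. U i k * U i l) = (if k = l then 1 else 0)"
    "\<And>i j. i < m \<Longrightarrow> j < m \<Longrightarrow> i \<noteq> j \<Longrightarrow> (\<Sum>k<m. \<Sum>l<m. U i k * C k l * U j l) = 0"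
proof -
  define D where "D = (\<lambda>(U :: nat \<Rightarrow> nat \<Rightarrow> real) i j. \<Sum>k<m. \<Sum>l<m. U i k * C k l * U j l)"
  \<comment> \<open>Matrices are functions on all of \<open>nat \<times> nat\<close>, set to 0
    outside the index square. Entries then lie in \<open>{-1..1}\<close>, so the set is closed in a
    compact product and a maximiser exists.\<close>
  define Orth where "Orth = {U :: nat \<Rightarrow> nat \<Rightarrow> real.
     (\<forall>i j. i < m \<longrightarrow> j < m \<longrightarrow> (\<Sum>k<m. U i k * U j k) = (if i = j then 1 else 0)) \<and>
     (\<forall>k l. k < m \<longrightarrow> l < m \<longrightarrow> (\<Sum>i<m. U i k * U i l) = (if k = l then 1 else 0)) \<and>
     (\<forall>i k. i \<ge> m \<or> k \<ge> m \<longrightarrow> U i k = 0)}"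
  have contU [continuous_intros]: "continuous_on X (\<lambda>U :: nat \<Rightarrow> nat \<Rightarrow> real. U i k)" for X i k
    by (intro continuous_on_product_then_coordinatewise[of X "\<lambda>U. U i"] continuous_on_subset[OF continuous_on_product_coordinates]) auto
  have box: "compact (PiE UNIV (\<lambda>_. PiE UNIV (\<lambda>_. {-1..1})) :: (nat \<Rightarrow> nat \<Rightarrow> real) set)"
  proof -
    have "compactin (product_topology (\<lambda>_. euclidean) UNIV) (PiE UNIV (\<lambda>_. {-1..1}) :: (nat \<Rightarrow> real) set)"
      by (simp add: compactin_PiE)
    hence 1: "compactin euclidean (PiE UNIV (\<lambda>_. {-1..1}) :: (nat \<Rightarrow> real) set)"
      by (simp add: euclidean_product_topology)
    have "compactin (product_topology (\<lambda>_. euclidean) UNIV) (PiE UNIV (\<lambda>_. PiE UNIV (\<lambda>_. {-1..1})) :: (nat \<Rightarrow> nat \<Rightarrow> real) set)"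
      using 1 unfolding compactin_PiE by blast
    thus ?thesis by (simp add: euclidean_product_topology)
  qed
  have "closed Orth" unfolding Orth_def
    by (intro closed_Collect_conj closed_Collect_all closed_Collect_imp open_Collect_const closed_Collect_eq continuous_intros)
  have le1: "\<bar>U i k\<bar> \<le> 1" if U: "U \<in> Orth" for U i k
  proof (cases "i < m \<and> k < m")
    case True
    have "U i k * U i k \<le> (\<Sum>k<m. U i k * U i k)"
      using True by (intro member_le_sum) auto
    also have "\<dots> = 1" using U True by (auto simp: Orth_def)
    finally show ?thesis by (simp add: abs_square_le_1[symmetric] power2_eq_square)
  next
    case False
    hence "U i k = 0" using U unfolding Orth_def by force
    thus ?thesis by simp
  qed
  have sub: "Orth \<subseteq> PiE UNIV (\<lambda>_. PiE UNIV (\<lambda>_. {-1..1}))"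
    using le1 by (auto simp: abs_le_iff minus_le_iff)
  have "compact Orth"
    using compact_Int_closed[OF box \<open>closed Orth\<close>] sub by (simp add: Int_absorb1)
  moreover have "(\<lambda>i k. if i = k \<and> i < m then 1 else 0) \<in> Orth"
    unfolding Orth_def by (auto simp: if_distrib[of "\<lambda>a. a * _"] if_distrib[of "\<lambda>a. _ * a"] cong: if_cong)
  moreover have "continuous_on Orth (\<lambda>U. \<Sum>i<m. (D U i i)\<^sup>2)" unfolding D_def
    by (intro continuous_intros)
  ultimately obtain U where U: "U \<in> Orth" and max: "\<And>V. V \<in> Orth \<Longrightarrow> (\<Sum>i<m. (D V i i)\<^sup>2) \<le> (\<Sum>i<m. (D U i i)\<^sup>2)"
    using continuous_attains_sup[of Orth "\<lambda>U. \<Sum>i<m. (D U i i)\<^sup>2"] by blast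
  have rows: "(\<Sum>k<m. U i k * U j k) = (if i = j then 1 else 0)" if "i < m" "j < m" for i j
    using U that by (auto simp: Orth_def)
  have cols: "(\<Sum>i<m. U i k * U i l) = (if k = l then 1 else 0)" if "k < m" "l < m" for k l
    using U that by (auto simp: Orth_def)
  have out: "U i k = 0" if "i \<ge> m \<or> k \<ge> m" for i k using U that unfolding Orth_def by force
  have Dsym: "D V i j = D V j i" for V i j
    unfolding D_def by (subst sum.swap) (simp add: sym mult_ac)
  have "D U p q = 0" if pq: "p < m" "q < m" "p \<noteq> q" for p q
  proof (rule ccontr)
    assume nz: "D U p q \<noteq> 0"
    \<comment> \<open>The rotation is by half of the angle \<open>\<theta>\<close> with cosine
      \<open>a / r\<close> and sine \<open>- b / r\<close>. It keeps the sum of the two diagonal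
      entries and makes their difference \<open>- 2 * r\<close>, the largest possible in modulus;
      the sum of their squares then grows by \<open>2 * b\<^sup>2\<close>.\<close>
    define a where "a = (D U q q - D U p p) / 2"
    define b where "b = D U p q"
    define r where "r = sqrt (a\<^sup>2 + b\<^sup>2)"
    have r: "r > 0" "r\<^sup>2 = a\<^sup>2 + b\<^sup>2" using nz by (auto simp: r_def b_def sum_power2_gt_zero_iff)
    have ab: "(a / r)\<^sup>2 + (- b / r)\<^sup>2 = 1" using r(1) by (simp add: power_divide add_divide_distrib[symmetric] r(2)[symmetric])
    obtain \<theta> where th: "a / r = cos \<theta>" "- b / r = sin \<theta>"
    proof (rule sincos_total_2pi[OF ab], goal_cases)
      case (1 t)
      from 1(4,5) show ?case by (rule that)
    qed
    define c where "c = cos (\<theta> / 2)"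
    define s where "s = sin (\<theta> / 2)"
    have cs: "c\<^sup>2 + s\<^sup>2 = 1" by (simp add: c_def s_def)
    have cos2: "c\<^sup>2 - s\<^sup>2 = a / r" using cos_double[of "\<theta> / 2"] th by (simp add: c_def s_def)
    have sin2: "2 * s * c = - b / r" using sin_double[of "\<theta> / 2"] th by (simp add: c_def s_def)
    define V where "V = (\<lambda>i k. if i = p then c * U p k + s * U q k else if i = q then c * U q k - s * U p k else U i k)"
    have Vp: "V p = (\<lambda>k. c * U p k + s * U q k)" and Vq: "V q = (\<lambda>k. c * U q k - s * U p k)"
      and Vi: "\<And>i. i \<noteq> p \<Longrightarrow> i \<noteq> q \<Longrightarrow> V i = U i" using pq by (auto simp: V_def)
    have bil: "(\<Sum>k<m. (a1 * U i1 k + b1 * U j1 k) * (a2 * U i2 k + b2 * U j2 k))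
       = a1 * a2 * (\<Sum>k<m. U i1 k * U i2 k) + a1 * b2 * (\<Sum>k<m. U i1 k * U j2 k)
       + b1 * a2 * (\<Sum>k<m. U j1 k * U i2 k) + b1 * b2 * (\<Sum>k<m. U j1 k * U j2 k)" for a1 b1 a2 b2 i1 i2 j1 j2
      by (simp add: sum_distrib_left sum.distrib[symmetric] algebra_simps)
    \<comment> \<open>One formula for all rows of \<open>V\<close>: the partner row
      \<open>\<pi> i\<close> has coefficient 0 unless \<open>i\<close> is \<open>p\<close> or
      \<open>q\<close>, so its default value does not matter.\<close>
    define \<alpha> where "\<alpha> = (\<lambda>i. if i = p \<or> i = q then c else 1)"
    define \<gamma> where "\<gamma> = (\<lambda>i. if i = p then s else if i = q then - s else 0)"
    define \<pi> where "\<pi> = (\<lambda>i. if i = p then q else p)"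
    have Vgen: "V i k = \<alpha> i * U i k + \<gamma> i * U (\<pi> i) k" for i k
      using pq by (auto simp: V_def \<alpha>_def \<gamma>_def \<pi>_def)
    have Vrows: "(\<Sum>k<m. V i k * V j k) = (if i = j then 1 else 0)" if "i < m" "j < m" for i j
    proof -
      have "\<pi> i < m" "\<pi> j < m" using pq by (auto simp: \<pi>_def)
      thus ?thesis unfolding Vgen bil using rows that pq cs
        by (auto simp: \<alpha>_def \<gamma>_def \<pi>_def power2_eq_square algebra_simps)
    qed
    have split: "(\<Sum>i<m. f i) = f p + f q + (\<Sum>i\<in>{..<m} - {p, q}. f i)" for f :: "nat \<Rightarrow> real"
    proof -
      have "{..<m} = insert p (insert q ({..<m} - {p, q}))" using pq by auto
      hence "(\<Sum>i<m. f i) = (\<Sum>i\<in>insert p (insert q ({..<m} - {p, q})). f i)" by simp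
      thus ?thesis using pq by (simp add: add.assoc)
    qed
    have Vcols: "(\<Sum>i<m. V i k * V i l) = (if k = l then 1 else 0)" if "k < m" "l < m" for k l
    proof -
      have "V p k * V p l + V q k * V q l = (c\<^sup>2 + s\<^sup>2) * (U p k * U p l + U q k * U q l)"
        unfolding Vp Vq by (simp add: power2_eq_square algebra_simps)
      moreover have "(\<Sum>i\<in>{..<m} - {p, q}. V i k * V i l) = (\<Sum>i\<in>{..<m} - {p, q}. U i k * U i l)"
        by (intro sum.cong) (auto simp: Vi)
      ultimately have "(\<Sum>i<m. V i k * V i l) = (\<Sum>i<m. U i k * U i l)" unfolding split cs by simp
      thus ?thesis using cols[OF that] by simp
    qed
    have Vout: "V i k = 0" if "i \<ge> m \<or> k \<ge> m" for i k
      using out[of i k] out[of p k] out[of q k] that pq unfolding V_def by auto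
    have VO: "V \<in> Orth" unfolding Orth_def using Vrows Vcols Vout by auto
    have Dbil: "D V i j = \<alpha> i * \<alpha> j * D U i j + \<alpha> i * \<gamma> j * D U i (\<pi> j) + \<gamma> i * \<alpha> j * D U (\<pi> i) j + \<gamma> i * \<gamma> j * D U (\<pi> i) (\<pi> j)" for i j
      unfolding D_def Vgen by (simp add: sum_distrib_left sum.distrib[symmetric] algebra_simps)
    have Dpp: "D V p p = c\<^sup>2 * D U p p + 2 * s * c * b + s\<^sup>2 * D U q q"
      unfolding Dbil using pq Dsym[of U q p] by (simp add: \<alpha>_def \<gamma>_def \<pi>_def b_def power2_eq_square algebra_simps)
    have Dqq: "D V q q = s\<^sup>2 * D U p p - 2 * s * c * b + c\<^sup>2 * D U q q"
      unfolding Dbil using pq Dsym[of U q p] by (simp add: \<alpha>_def \<gamma>_def \<pi>_def b_def power2_eq_square algebra_simps)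
    have Dii: "D V i i = D U i i" if "i \<noteq> p" "i \<noteq> q" for i
      unfolding Dbil using that by (simp add: \<alpha>_def \<gamma>_def)
    have "D V p p - D V q q = - 2 * r"
    proof -
      have "D V p p - D V q q = (c\<^sup>2 - s\<^sup>2) * (- 2 * a) + 2 * (2 * s * c) * b"
        unfolding Dpp Dqq a_def by (simp add: field_simps)
      also have "\<dots> = - 2 * (a\<^sup>2 + b\<^sup>2) / r" unfolding cos2 sin2 using r by (simp add: field_simps power2_eq_square)
      also have "\<dots> = - 2 * r" using r(1) unfolding r(2)[symmetric] by (simp add: power2_eq_square)
      finally show ?thesis .
    qed
    moreover have "D V p p + D V q q = D U p p + D U q q"
    proof -
      have "D V p p + D V q q = (c\<^sup>2 + s\<^sup>2) * (D U p p + D U q q)" unfolding Dpp Dqq by (simp add: algebra_simps)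
      thus ?thesis using cs by simp
    qed
    moreover have "2 * ((x::real)\<^sup>2 + y\<^sup>2) = (x + y)\<^sup>2 + (x - y)\<^sup>2" for x y by (simp add: power2_eq_square algebra_simps)
    ultimately have "2 * ((D V p p)\<^sup>2 + (D V q q)\<^sup>2) = (D U p p + D U q q)\<^sup>2 + 4 * r\<^sup>2"
      by (simp add: power_mult_distrib)
    also have "4 * r\<^sup>2 = (D U p p - D U q q)\<^sup>2 + 4 * b\<^sup>2" unfolding r(2) a_def by (simp add: power2_eq_square field_simps)
    also have "(D U p p + D U q q)\<^sup>2 + ((D U p p - D U q q)\<^sup>2 + 4 * b\<^sup>2) = 2 * ((D U p p)\<^sup>2 + (D U q q)\<^sup>2) + 4 * b\<^sup>2"
      by (simp add: power2_eq_square algebra_simps)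
    finally have "(D V p p)\<^sup>2 + (D V q q)\<^sup>2 = (D U p p)\<^sup>2 + (D U q q)\<^sup>2 + 2 * b\<^sup>2" by simp
    moreover have "(\<Sum>i\<in>{..<m} - {p, q}. (D V i i)\<^sup>2) = (\<Sum>i\<in>{..<m} - {p, q}. (D U i i)\<^sup>2)"
      by (intro sum.cong) (auto simp: Dii)
    ultimately have "(\<Sum>i<m. (D V i i)\<^sup>2) = (\<Sum>i<m. (D U i i)\<^sup>2) + 2 * b\<^sup>2" unfolding split by simp
    moreover have "b\<^sup>2 > 0" using nz by (simp add: b_def)
    ultimately show False using max[OF VO] by simp
  qed
  thus thesis using that[OF rows cols] unfolding D_def by blast
qed

section \<open>Moments of the likelihood ratio of centered normal laws\<close>

lemma nn_integral_normal_density: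
  "\<sigma> > 0 \<Longrightarrow> (\<integral>\<^sup>+ x. ennreal (normal_density \<mu> \<sigma> x) \<partial>lborel) = 1"
  by (subst nn_integral_eq_integral) auto

text \<open>The integrand is a multiple of the normal density of variance
  \<open>s\<^sup>2 / d\<close> with \<open>d = 1 - p * (\<sigma> - 1)\<close>; positivity of
  \<open>d\<close> is the condition for convergence.\<close>

lemma normal_likelihood_moment:
  fixes s r p :: real
  assumes sr: "s > 0" "r > 0" and p: "p > 0" and \<sigma>: "\<sigma> = s\<^sup>2 / r\<^sup>2" and pos: "1 - p * (\<sigma> - 1) > 0"
  shows "(\<integral>\<^sup>+ x. ennreal (normal_density 0 s x * (normal_density 0 s x / normal_density 0 r x) powr p) \<partial>lborel)
    = ennreal (\<sigma> powr (- p / 2) * (1 - p * (\<sigma> - 1)) powr (- 1 / 2))"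
proof -
  define d where "d = 1 - p * (\<sigma> - 1)"
  define v where "v = s / sqrt d"
  have d0: "d > 0" using pos by (simp add: d_def)
  have v0: "v > 0" using sr d0 by (simp add: v_def)
  have \<sigma>0: "\<sigma> > 0" using sr \<sigma> by simp
  have eq: "normal_density 0 s x * (normal_density 0 s x / normal_density 0 r x) powr p
      = (\<sigma> powr (- p / 2) * d powr (- 1 / 2)) * normal_density 0 v x" for x
  proof -
    have q: "normal_density 0 s x / normal_density 0 r x = \<sigma> powr (- 1 / 2) * exp (- x\<^sup>2 / (2 * s\<^sup>2) + x\<^sup>2 / (2 * r\<^sup>2))"
    proof -
      have "sqrt (2 * pi * r\<^sup>2) / sqrt (2 * pi * s\<^sup>2) = r / s"
        using sr by (simp add: real_sqrt_mult)
      moreover have "\<sigma> powr (- 1 / 2) = r / s"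
        using sr by (simp add: \<sigma> powr_minus powr_half_sqrt powr_divide real_sqrt_divide)
      ultimately have c: "sqrt (2 * pi * r\<^sup>2) / sqrt (2 * pi * s\<^sup>2) = \<sigma> powr (- 1 / 2)" by simp
      have "normal_density 0 s x / normal_density 0 r x
          = (sqrt (2 * pi * r\<^sup>2) / sqrt (2 * pi * s\<^sup>2)) * (exp (- x\<^sup>2 / (2 * s\<^sup>2)) / exp (- x\<^sup>2 / (2 * r\<^sup>2)))"
        unfolding normal_density_def by simp
      thus ?thesis unfolding c exp_diff[symmetric] by simp
    qed
    have "(normal_density 0 s x / normal_density 0 r x) powr p
      = \<sigma> powr (- p / 2) * exp (p * (- x\<^sup>2 / (2 * s\<^sup>2) + x\<^sup>2 / (2 * r\<^sup>2)))"
      unfolding q using \<sigma>0 by (simp add: powr_mult powr_powr exp_powr_real mult_ac)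
    moreover have "normal_density 0 s x * exp (p * (- x\<^sup>2 / (2 * s\<^sup>2) + x\<^sup>2 / (2 * r\<^sup>2))) = d powr (- 1 / 2) * normal_density 0 v x"
    proof -
      have "- x\<^sup>2 / (2 * s\<^sup>2) + p * (- x\<^sup>2 / (2 * s\<^sup>2) + x\<^sup>2 / (2 * r\<^sup>2)) = - x\<^sup>2 * d / (2 * s\<^sup>2)"
        using sr unfolding d_def \<sigma> by (simp add: field_simps)
      also have "\<dots> = - x\<^sup>2 / (2 * v\<^sup>2)" using d0 sr by (simp add: v_def power_divide)
      finally have e: "exp (- x\<^sup>2 / (2 * s\<^sup>2)) * exp (p * (- x\<^sup>2 / (2 * s\<^sup>2) + x\<^sup>2 / (2 * r\<^sup>2))) = exp (- x\<^sup>2 / (2 * v\<^sup>2))"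
        by (simp add: mult_exp_exp)
      have "1 / sqrt (2 * pi * s\<^sup>2) = d powr (- 1 / 2) * (1 / sqrt (2 * pi * v\<^sup>2))"
        using sr d0 by (simp add: v_def powr_minus powr_half_sqrt real_sqrt_mult real_sqrt_divide field_simps)
      thus ?thesis unfolding normal_density_def using e by (simp add: mult.assoc)
    qed
    ultimately show ?thesis by (simp add: mult_ac)
  qed
  show ?thesis unfolding eq d_def[symmetric]
    by (subst ennreal_mult') (auto simp: nn_integral_cmult nn_integral_normal_density[OF v0])
qed

text \<open>In the logarithm of the moment, \<open>- p / 2 * ln \<sigma>\<close> and
  \<open>- 1 / 2 * ln (1 - p * (\<sigma> - 1))\<close> have opposite first-order terms in
  \<open>\<sigma> - 1\<close>. What remains is quadratic, so a product over coordinates is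
  controlled by the sum of squares alone. The condition \<open>p * b \<le> 1 / 2\<close> keeps the
  second logarithm away from its singularity.\<close>

lemma normal_likelihood_moment_le:
  fixes s r p a b :: real
  assumes sr: "s > 0" "r > 0" and p: "p > 0" "p * b \<le> 1 / 2" and a: "a > 0"
    and \<sigma>: "\<sigma> = s\<^sup>2 / r\<^sup>2" "a \<le> \<sigma>" "\<sigma> \<le> b"
  shows "(\<integral>\<^sup>+ x. ennreal (normal_density 0 s x * (normal_density 0 s x / normal_density 0 r x) powr p) \<partial>lborel)
    \<le> ennreal (exp ((p / (2 * a) + p\<^sup>2) * (\<sigma> - 1)\<^sup>2))"
proof -
  define x where "x = \<sigma> - 1"
  have \<sigma>0: "\<sigma> > 0" using a \<sigma> by linarith
  have "p * \<sigma> \<le> p * b" using \<sigma> p by (intro mult_left_mono) auto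
  hence y: "p * x \<le> 1 / 2" using p unfolding x_def right_diff_distrib by linarith
  have l1: "ln \<sigma> \<ge> x - x\<^sup>2 / a"
  proof -
    have "ln (1 / \<sigma>) \<le> 1 / \<sigma> - 1" using \<sigma>0 by (intro ln_le_minus_one) auto
    hence "ln \<sigma> \<ge> 1 - 1 / \<sigma>" using \<sigma>0 by (simp add: ln_div)
    also have "1 - 1 / \<sigma> = x - x\<^sup>2 / \<sigma>" using \<sigma>0 by (simp add: x_def field_simps power2_eq_square)
    moreover have "x\<^sup>2 / \<sigma> \<le> x\<^sup>2 / a" by (intro divide_left_mono mult_pos_pos) (use a \<sigma>(2) \<sigma>0 in auto)
    ultimately show ?thesis by linarith
  qed
  have l2: "- ln (1 - p * x) \<le> p * x + 2 * (p * x)\<^sup>2"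
  proof -
    define z where "z = p * x"
    have z: "z \<le> 1 / 2" using y by (simp add: z_def)
    have "ln (1 / (1 - z)) \<le> 1 / (1 - z) - 1" using z by (intro ln_le_minus_one) auto
    hence "- ln (1 - z) \<le> 1 / (1 - z) - 1" using z by (simp add: ln_div)
    also have "1 / (1 - z) - 1 = z + z\<^sup>2 / (1 - z)" using z by (simp add: field_simps power2_eq_square)
    also have "z\<^sup>2 / (1 - z) \<le> z\<^sup>2 / (1 / 2)" using z by (intro divide_left_mono) auto
    finally show ?thesis by (simp add: z_def)
  qed
  have "\<sigma> powr (- p / 2) * (1 - p * x) powr (- 1 / 2) = exp (- p / 2 * ln \<sigma> + 1 / 2 * (- ln (1 - p * x)))"
    using \<sigma>0 y by (simp add: powr_def exp_add[symmetric] mult_ac)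
  also have "\<dots> \<le> exp ((p / (2 * a) + p\<^sup>2) * x\<^sup>2)"
  proof -
    have "p / 2 * (x - x\<^sup>2 / a) \<le> p / 2 * ln \<sigma>" using l1 p by (intro mult_left_mono) auto
    moreover have "- p / 2 * l + 1 / 2 * L \<le> - A + 1 / 2 * Q" if "A \<le> p / 2 * l" "L \<le> Q" for A L Q l :: real
      using that by simp
    ultimately have "- p / 2 * ln \<sigma> + 1 / 2 * (- ln (1 - p * x)) \<le> - (p / 2 * (x - x\<^sup>2 / a)) + 1 / 2 * (p * x + 2 * (p * x)\<^sup>2)"
      using l2 by blast
    also have "\<dots> = (p / (2 * a) + p\<^sup>2) * x\<^sup>2"
    proof -
      have "- (p / 2 * (x - X / a)) + 1 / 2 * (p * x + 2 * (P * X)) = (p / (2 * a) + P) * X" for X P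
        using a by (simp add: field_simps)
      thus ?thesis unfolding power_mult_distrib .
    qed
    finally show ?thesis by simp
  qed
  finally have "\<sigma> powr (- p / 2) * (1 - p * x) powr (- 1 / 2) \<le> exp ((p / (2 * a) + p\<^sup>2) * x\<^sup>2)" .
  moreover have "1 - p * (\<sigma> - 1) > 0" using y by (simp add: x_def)
  ultimately show ?thesis
    unfolding normal_likelihood_moment[OF sr p(1) \<sigma>(1) \<open>1 - p * (\<sigma> - 1) > 0\<close>]
    by (intro ennreal_leI) (simp add: x_def)
qed

section \<open>Product laws from characteristic functions\<close>

definition normal_law :: "real \<Rightarrow> real measure" where
  "normal_law \<sigma> = density lborel (\<lambda>x. ennreal (normal_density 0 \<sigma> x))"

lemma sets_normal_law [simp, measurable_cong]: "sets (normal_law \<sigma>) = sets borel"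
  and space_normal_law [simp]: "space (normal_law \<sigma>) = UNIV"
  by (auto simp: normal_law_def)

lemma prob_space_normal_law: "\<sigma> > 0 \<Longrightarrow> prob_space (normal_law \<sigma>)"
  unfolding normal_law_def by (rule prob_space_normal_density)

lemma real_distribution_normal_law: "\<sigma> > 0 \<Longrightarrow> real_distribution (normal_law \<sigma>)"
  using prob_space_normal_law by (auto simp: real_distribution_def real_distribution_axioms_def)

lemma char_of_normal_distributed:
  assumes "prob_space M" and \<sigma>: "\<sigma> > 0" and D: "distributed M lborel Y (\<lambda>x. ennreal (normal_density 0 \<sigma> x))"
  shows "(CLINT w|M. iexp (t * Y w)) = exp (- complex_of_real ((t * \<sigma>)\<^sup>2) / 2)"
proof -
  interpret prob_space M by fact
  have [measurable]: "Y \<in> borel_measurable M" using D by (auto simp: distributed_def)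
  have "distributed M lborel (\<lambda>w. (Y w - 0) / \<sigma>) std_normal_density"
    using D normal_standard_normal_convert[OF \<sigma>] by blast
  hence "distr M lborel (\<lambda>w. Y w / \<sigma>) = std_normal_distribution"
    using distributed_distr_eq_density by force
  moreover have "distr M lborel (\<lambda>w. Y w / \<sigma>) = distr M borel (\<lambda>w. Y w / \<sigma>)" by (intro distr_cong) auto
  ultimately have "char (distr M borel (\<lambda>w. Y w / \<sigma>)) (t * \<sigma>) = complex_of_real (exp (- ((t * \<sigma>)^2) / 2))"
    using char_std_normal_distribution by simp
  moreover have "char (distr M borel (\<lambda>w. Y w / \<sigma>)) (t * \<sigma>) = (CLINT w|M. iexp (t * Y w))"
    unfolding char_def using \<sigma> by (subst integral_distr) auto
  ultimately show ?thesis by (simp add: exp_of_real[symmetric])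
qed

lemma char_normal_law:
  assumes "\<sigma> > 0" shows "char (normal_law \<sigma>) t = exp (- complex_of_real ((t * \<sigma>)\<^sup>2) / 2)"
proof -
  have "distributed (normal_law \<sigma>) lborel (\<lambda>x. x) (\<lambda>x. ennreal (normal_density 0 \<sigma> x))"
    unfolding distributed_def normal_law_def by (auto intro!: distr_id2)
  from char_of_normal_distributed[OF prob_space_normal_law[OF assms] assms this] show ?thesis
    unfolding char_def by simp
qed

text \<open>In terms of the second moment the degenerate law needs no separate formula: variance 0
  gives the value 1.\<close>

lemma centered_gaussian_rv_char:
  assumes "prob_space M" and "centered_gaussian_rv M Y"
  shows "integrable M (\<lambda>w. (Y w)\<^sup>2)"
    and "(CLINT w|M. iexp (Y w)) = exp (- complex_of_real (LINT w|M. (Y w)\<^sup>2) / 2)"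
proof -
  interpret prob_space M by fact
  have [measurable]: "Y \<in> borel_measurable M" using assms by (auto simp: centered_gaussian_rv_def)
  consider "AE w in M. Y w = 0" | \<sigma> where "\<sigma> > 0" "distributed M lborel Y (\<lambda>x. ennreal (normal_density 0 \<sigma> x))"
    using assms by (auto simp: centered_gaussian_rv_def)
  hence "integrable M (\<lambda>w. (Y w)\<^sup>2) \<and> (CLINT w|M. iexp (Y w)) = exp (- complex_of_real (LINT w|M. (Y w)\<^sup>2) / 2)"
  proof cases
    case 1
    have "integrable M (\<lambda>w. (Y w)\<^sup>2) \<longleftrightarrow> integrable M (\<lambda>w. 0::real)"
      using 1 by (intro integrable_cong_AE) (auto elim!: eventually_mono)
    moreover have "(LINT w|M. (Y w)\<^sup>2) = (LINT w|M. 0)"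
      using 1 by (intro integral_cong_AE) (auto elim!: eventually_mono)
    moreover have "(CLINT w|M. iexp (Y w)) = (CLINT w|M. 1)"
      using 1 by (intro integral_cong_AE) (auto elim!: eventually_mono)
    ultimately show ?thesis by (simp add: prob_space)
  next
    case 2
    have "integrable M (\<lambda>w. (Y w)\<^sup>2)"
      using distributed_integrable[OF 2(2), of "\<lambda>x. x\<^sup>2"] integrable_normal_moment[OF 2(1), of 0 2] by simp
    moreover have "expectation Y = 0" by (rule normal_distributed_expectation[OF 2])
    hence "(LINT w|M. (Y w)\<^sup>2) = \<sigma>\<^sup>2" using normal_distributed_variance[OF 2] by simp
    ultimately show ?thesis using char_of_normal_distributed[OF \<open>prob_space M\<close> 2, of 1] by simp
  qed
  thus "integrable M (\<lambda>w. (Y w)\<^sup>2)"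
    and "(CLINT w|M. iexp (Y w)) = exp (- complex_of_real (LINT w|M. (Y w)\<^sup>2) / 2)" by auto
qed

text \<open>\<open>R / c\<close> is the density of a probability measure under which
  \<open>Y\<close> has characteristic function \<open>char \<nu>\<close>, so one-dimensional Levy
  uniqueness applies.\<close>

lemma weighted_law_from_char:
  fixes R :: "'w \<Rightarrow> real"
  assumes "prob_space M" and Y [measurable]: "Y \<in> borel_measurable M" and \<nu>: "real_distribution \<nu>"
    and R [measurable]: "R \<in> borel_measurable M" and R0: "\<And>w. R w \<ge> 0" and Ri: "integrable M R"
    and c: "(LINT w|M. R w) = c" "c > 0"
    and ch: "\<And>v. (CLINT w|M. of_real (R w) * iexp (v * Y w)) = of_real c * char \<nu> v"
    and A [measurable]: "A \<in> sets borel"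
  shows "(LINT w|M. R w * indicator A (Y w)) = c * measure \<nu> A"
proof -
  interpret prob_space M by fact
  define N where "N = density M (\<lambda>w. ennreal (R w / c))"
  have Rc0: "R w / c \<ge> 0" for w using R0 c by simp
  have "emeasure N (space N) = (\<integral>\<^sup>+ w. ennreal (R w / c) \<partial>M)"
    unfolding N_def by (simp add: emeasure_density cong: nn_integral_cong)
  also have "\<dots> = ennreal (LINT w|M. R w / c)"
    using Ri Rc0 by (intro nn_integral_eq_integral) auto
  finally have "prob_space N" using c by (intro prob_spaceI) simp
  then interpret N: prob_space N .
  have YN [measurable]: "Y \<in> borel_measurable N" unfolding N_def by simp
  have "char (distr N borel Y) v = char \<nu> v" for v
  proof -
    have "char (distr N borel Y) v = (CLINT w|N. iexp (v * Y w))"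
      unfolding char_def by (subst integral_distr) auto
    also have "\<dots> = (CLINT w|M. (R w / c) *\<^sub>R iexp (v * Y w))"
      unfolding N_def using Rc0 by (subst integral_density) auto
    also have "\<dots> = (CLINT w|M. (1 / of_real c) * (of_real (R w) * iexp (v * Y w)))"
      by (simp add: scaleR_conv_of_real)
    also have "\<dots> = (1 / of_real c) * (CLINT w|M. of_real (R w) * iexp (v * Y w))"
      by (rule integral_mult_right_zero)
    finally show ?thesis using ch[of v] c by simp
  qed
  hence "char (distr N borel Y) = char \<nu>" by auto
  hence eq: "distr N borel Y = \<nu>"
    by (intro Levy_uniqueness N.real_distribution_distr \<nu>) auto
  have "measure \<nu> A = measure N (Y -` A \<inter> space N)"
    unfolding eq[symmetric] by (rule measure_distr) auto
  also have "\<dots> = (LINT w|N. indicator A (Y w))"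
  proof -
    have "(LINT w|N. indicator A (Y w) :: real) = (LINT w|N. indicator (Y -` A \<inter> space N) w)"
      by (intro Bochner_Integration.integral_cong) (auto simp: indicator_def)
    thus ?thesis by simp
  qed
  also have "\<dots> = (LINT w|M. (R w / c) *\<^sub>R indicator A (Y w))"
    unfolding N_def using Rc0 by (subst integral_density) auto
  also have "\<dots> = (LINT w|M. (R w * indicator A (Y w))) / c" by simp
  finally show ?thesis using c by (simp add: field_simps)
qed

text \<open>A complex weight is reduced to the positive weights
  \<open>2 + Re (\<kappa> * Z)\<close>: the part with constant weight is known, and
  \<open>\<kappa> = 1\<close> and \<open>\<kappa> = - \<i>\<close> recover real and imaginary
  part.\<close>

lemma complex_weighted_law_from_char:
  fixes Z :: "'w \<Rightarrow> complex"
  assumes "prob_space M" and Y [measurable]: "Y \<in> borel_measurable M" and \<nu>: "real_distribution \<nu>"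
    and Z [measurable]: "Z \<in> borel_measurable M" and Z1: "\<And>w. norm (Z w) \<le> 1"
    and ch: "\<And>v. (CLINT w|M. Z w * iexp (v * Y w)) = e * char \<nu> v"
      "\<And>v. (CLINT w|M. cnj (Z w) * iexp (v * Y w)) = cnj e * char \<nu> v"
      "\<And>v. (CLINT w|M. iexp (v * Y w)) = char \<nu> v"
    and A [measurable]: "A \<in> sets borel"
  shows "(CLINT w|M. Z w * indicator A (Y w)) = e * measure \<nu> A"
proof -
  interpret prob_space M by fact
  interpret \<nu>: real_distribution \<nu> by fact
  have bi: "integrable M f" if "f \<in> borel_measurable M" "\<And>w. norm (f w) \<le> 1" for f :: "'w \<Rightarrow> complex"
    by (rule integrable_const_bound[of _ 1]) (use that in auto)
  have bir: "integrable M f" if "f \<in> borel_measurable M" "\<And>w. \<bar>f w\<bar> \<le> 1" for f :: "'w \<Rightarrow> real"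
    by (rule integrable_const_bound[of _ 1]) (use that in auto)
  have Zi: "integrable M Z" by (intro bi Z1) auto
  have eZ: "(CLINT w|M. Z w) = e" using ch(1)[of 0] by (simp add: \<nu>.char_zero)
  have [measurable]: "(\<lambda>w. cnj (Z w)) \<in> borel_measurable M"
    by (rule measurable_compose[OF Z]) (intro borel_measurable_continuous_onI continuous_intros)
  have base: "(LINT w|M. indicator A (Y w)) = measure \<nu> A"
    using weighted_law_from_char[OF \<open>prob_space M\<close> Y \<nu>, of "\<lambda>_. 1" 1 A] ch(3) by (simp add: prob_space)
  have gen: "(LINT w|M. Re (\<kappa> * Z w) * indicator A (Y w)) = Re (\<kappa> * e) * measure \<nu> A" if \<kappa>: "norm \<kappa> = 1" for \<kappa>
  proof -
    have n1: "norm (\<kappa> * Z w) \<le> 1" for w using Z1[of w] \<kappa> by (simp add: norm_mult)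
    have r1: "\<bar>Re (\<kappa> * Z w)\<bar> \<le> 1" for w using n1[of w] abs_Re_le_cmod order_trans by blast
    have ri: "integrable M (\<lambda>w. Re (\<kappa> * Z w))" by (intro bir r1) auto
    have e1: "\<bar>Re (\<kappa> * e)\<bar> \<le> 1"
    proof -
      have "norm e \<le> (LINT w|M. norm (Z w))" unfolding eZ[symmetric] by (rule integral_norm_bound)
      also have "\<dots> \<le> (LINT w|M. 1)" using Zi Z1 by (intro integral_mono) auto
      finally have "norm (\<kappa> * e) \<le> 1" using \<kappa> by (simp add: norm_mult prob_space)
      thus ?thesis using abs_Re_le_cmod order_trans by blast
    qed
    \<comment> \<open>The constant 2 keeps weight and mean positive, since
      \<open>Re (\<kappa> * Z)\<close> and \<open>Re (\<kappa> * e)\<close> are bounded by 1 in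
      modulus.\<close>
    have "(LINT w|M. (2 + Re (\<kappa> * Z w)) * indicator A (Y w)) = (2 + Re (\<kappa> * e)) * measure \<nu> A"
    proof (rule weighted_law_from_char[OF \<open>prob_space M\<close> Y \<nu>])
      show "2 + Re (\<kappa> * Z w) \<ge> 0" for w using r1[of w] by linarith
      show "integrable M (\<lambda>w. 2 + Re (\<kappa> * Z w))" using ri by auto
      have "(LINT w|M. Re (\<kappa> * Z w)) = Re (CLINT w|M. \<kappa> * Z w)"
        using Zi by (intro integral_Re) auto
      also have "\<dots> = Re (\<kappa> * e)" using eZ by simp
      finally show "(LINT w|M. 2 + Re (\<kappa> * Z w)) = 2 + Re (\<kappa> * e)" using ri by (simp add: prob_space)
      show "2 + Re (\<kappa> * e) > 0" using e1 by linarith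
      show "(CLINT w|M. of_real (2 + Re (\<kappa> * Z w)) * iexp (v * Y w)) = of_real (2 + Re (\<kappa> * e)) * char \<nu> v" for v
      proof -
        have i1: "integrable M (\<lambda>w. iexp (v * Y w))" by (intro bi) auto
        have i2: "integrable M (\<lambda>w. Z w * iexp (v * Y w))" using Z1 by (intro bi) (auto simp: norm_mult)
        have i3: "integrable M (\<lambda>w. cnj (Z w) * iexp (v * Y w))" using Z1 by (intro bi) (auto simp: norm_mult)
        have Re_eq: "complex_of_real (2 + Re (\<kappa> * z)) = 2 + (\<kappa> / 2) * z + (cnj \<kappa> / 2) * cnj z" for z
          by (simp add: complex_eq_iff field_simps)
        have "(CLINT w|M. of_real (2 + Re (\<kappa> * Z w)) * iexp (v * Y w))
          = (CLINT w|M. 2 * iexp (v * Y w) + (\<kappa> / 2) * (Z w * iexp (v * Y w)) + (cnj \<kappa> / 2) * (cnj (Z w) * iexp (v * Y w)))"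
          by (simp only: Re_eq distrib_right mult.assoc)
        also have "\<dots> = 2 * char \<nu> v + (\<kappa> / 2) * (e * char \<nu> v) + (cnj \<kappa> / 2) * (cnj e * char \<nu> v)"
          using i1 i2 i3 ch(1)[of v] ch(2)[of v] ch(3)[of v] by simp
        also have "\<dots> = of_real (2 + Re (\<kappa> * e)) * char \<nu> v" by (simp only: Re_eq distrib_right mult.assoc)
        finally show ?thesis .
      qed
    qed measurable
    moreover have "(LINT w|M. (2 + Re (\<kappa> * Z w)) * indicator A (Y w))
      = 2 * (LINT w|M. indicator A (Y w)) + (LINT w|M. Re (\<kappa> * Z w) * indicator A (Y w))"
    proof -
      have j1: "integrable M (\<lambda>w. indicator A (Y w) :: real)" by (intro bir) (auto simp: indicator_def)
      have j2: "integrable M (\<lambda>w. Re (\<kappa> * Z w) * indicator A (Y w))"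
        by (intro bir) (use r1 in \<open>auto simp: indicator_def\<close>)
      have "(LINT w|M. (2 + Re (\<kappa> * Z w)) * indicator A (Y w))
        = (LINT w|M. 2 * indicator A (Y w) + Re (\<kappa> * Z w) * indicator A (Y w))"
        by (simp only: distrib_right)
      thus ?thesis using j1 j2 by simp
    qed
    ultimately show ?thesis unfolding base by (simp add: distrib_right)
  qed
  have ZA: "integrable M (\<lambda>w. Z w * indicator A (Y w))" using Z1 by (intro bi) (auto simp: norm_mult indicator_def)
  show ?thesis
  proof (rule complex_eqI)
    have "Re (CLINT w|M. Z w * indicator A (Y w)) = (LINT w|M. Re (1 * Z w) * indicator A (Y w))"
      unfolding integral_Re[OF ZA, symmetric]
      by (intro Bochner_Integration.integral_cong) (auto simp: indicator_def)
    thus "Re (CLINT w|M. Z w * indicator A (Y w)) = Re (e * measure \<nu> A)" using gen[of 1] by simp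
    have "Im (CLINT w|M. Z w * indicator A (Y w)) = (LINT w|M. Re (- \<i> * Z w) * indicator A (Y w))"
      unfolding integral_Im[OF ZA, symmetric]
      by (intro Bochner_Integration.integral_cong) (auto simp: indicator_def)
    thus "Im (CLINT w|M. Z w * indicator A (Y w)) = Im (e * measure \<nu> A)" using gen[of "- \<i>"] by simp
  qed
qed

text \<open>Multivariate uniqueness for product laws from the one-dimensional case, by conditioning
  on one coordinate at a time. The joint characteristic function of the other coordinates is
  unchanged by conditioning on \<open>Y j \<in> A j\<close>, so the induction hypothesis applies to
  the conditional measure; for this \<open>M\<close> must vary in the induction.\<close>

lemma box_prob_from_char:
  fixes Y :: "'i \<Rightarrow> 'w \<Rightarrow> real"
  assumes "finite I" and \<nu>: "\<And>i. i \<in> I \<Longrightarrow> real_distribution (\<nu> i)"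
    and "prob_space M" and "\<And>i. i \<in> I \<Longrightarrow> Y i \<in> borel_measurable M"
    and "\<And>u. (CLINT w|M. iexp (\<Sum>i\<in>I. u i * Y i w)) = (\<Prod>i\<in>I. char (\<nu> i) (u i))"
    and "\<And>i. i \<in> I \<Longrightarrow> A i \<in> sets borel"
  shows "measure M {w\<in>space M. \<forall>i\<in>I. Y i w \<in> A i} = (\<Prod>i\<in>I. measure (\<nu> i) (A i))"
  using assms
proof (induction I arbitrary: M)
  case (empty M)
  then interpret prob_space M by simp
  show ?case by (simp add: prob_space)
next
  case (insert j I M)
  interpret prob_space M by fact
  interpret \<nu>: real_distribution "\<nu> j" using insert.prems by simp
  have Ym [measurable]: "Y i \<in> borel_measurable M" if "i \<in> insert j I" for i using insert.prems that by blast
  have Yj [measurable]: "Y j \<in> borel_measurable M" by (rule Ym) simp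
  have YI [measurable]: "(\<lambda>w. \<Sum>i\<in>I. u i * Y i w) \<in> borel_measurable M" for u
    by (intro borel_measurable_sum borel_measurable_times Ym) auto
  have Aj [measurable]: "A j \<in> sets borel" using insert.prems by simp
  have chm: "(CLINT w|M. iexp (\<Sum>i\<in>I. u i * Y i w) * iexp (v * Y j w)) = (\<Prod>i\<in>I. char (\<nu> i) (u i)) * char (\<nu> j) v" for u v
  proof -
    have "(CLINT w|M. iexp (\<Sum>i\<in>insert j I. (u(j := v)) i * Y i w)) = (\<Prod>i\<in>insert j I. char (\<nu> i) ((u(j := v)) i))"
      by (rule insert.prems)
    moreover have "(\<Prod>i\<in>insert j I. char (\<nu> i) ((u(j := v)) i)) = (\<Prod>i\<in>I. char (\<nu> i) (u i)) * char (\<nu> j) v"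
      using insert.hyps by (subst prod.insert) (auto intro!: prod.cong simp: mult.commute)
    moreover have "(\<Sum>i\<in>insert j I. (u(j := v)) i * Y i w) = (\<Sum>i\<in>I. u i * Y i w) + v * Y j w" for w
      using insert.hyps by (subst sum.insert) (auto intro!: sum.cong)
    moreover have "iexp (a + b) = iexp a * iexp b" for a b by (simp add: exp_add[symmetric] distrib_left)
    ultimately show ?thesis by (simp only:)
  qed
  have ch0: "(CLINT w|M. iexp (v * Y j w)) = char (\<nu> j) v" for v
  proof -
    have "(\<Prod>i\<in>I. char (\<nu> i) 0) = 1"
      using insert.prems(1) by (intro prod.neutral) (auto simp: real_distribution.char_zero)
    thus ?thesis using chm[of "\<lambda>_. 0" v] by simp
  qed
  define q where "q = measure (\<nu> j) (A j)"
  \<comment> \<open>The one-dimensional statement for \<open>Y j\<close>, with the exponential of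
    the other coordinates as complex weight.\<close>
  have PA: "(CLINT w|M. iexp (\<Sum>i\<in>I. u i * Y i w) * indicator (A j) (Y j w)) = (\<Prod>i\<in>I. char (\<nu> i) (u i)) * q" for u
    unfolding q_def
  proof (rule complex_weighted_law_from_char[OF \<open>prob_space M\<close> Yj _ _ _ chm _ ch0 Aj])
    fix v
    have neg: "iexp (\<Sum>i\<in>I. (- u i) * Y i w) = cnj (iexp (\<Sum>i\<in>I. u i * Y i w))" for w
      by (simp add: sum_negf exp_cnj)
    have "(\<Prod>i\<in>I. char (\<nu> i) (- u i)) = cnj (CLINT w|M. iexp (\<Sum>i\<in>I. u i * Y i w))"
    proof -
      have "(\<Prod>i\<in>I. char (\<nu> i) (- u i)) = (CLINT w|M. iexp (\<Sum>i\<in>I. (- u i) * Y i w))"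
        using chm[of "\<lambda>i. - u i" 0] by (simp add: \<nu>.char_zero)
      also have "\<dots> = cnj (CLINT w|M. iexp (\<Sum>i\<in>I. u i * Y i w))" unfolding neg by (rule Bochner_Integration.integral_cnj)
      finally show ?thesis .
    qed
    also have "(CLINT w|M. iexp (\<Sum>i\<in>I. u i * Y i w)) = (\<Prod>i\<in>I. char (\<nu> i) (u i))"
      using chm[of u 0] by (simp add: \<nu>.char_zero)
    finally show "(CLINT w|M. cnj (iexp (\<Sum>i\<in>I. u i * Y i w)) * iexp (v * Y j w)) = cnj (\<Prod>i\<in>I. char (\<nu> i) (u i)) * char (\<nu> j) v"
      using chm[of "\<lambda>i. - u i" v] unfolding neg by simp
  qed (use insert.prems in auto)
  have q_eq: "q = measure M {w\<in>space M. Y j w \<in> A j}"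
  proof -
    have "(LINT w|M. 1 * indicator (A j) (Y j w)) = 1 * measure (\<nu> j) (A j)"
      by (rule weighted_law_from_char[OF \<open>prob_space M\<close> Yj]) (use insert.prems ch0 in \<open>auto simp: prob_space\<close>)
    moreover have "(LINT w|M. indicator (A j) (Y j w)) = (LINT w|M. indicator {w\<in>space M. Y j w \<in> A j} w :: real)"
      by (intro Bochner_Integration.integral_cong) (auto simp: indicator_def)
    moreover have "\<dots> = measure M {w\<in>space M. Y j w \<in> A j}"
      by (subst Bochner_Integration.integral_indicator) (auto intro!: arg_cong[where f="measure M"])
    ultimately show ?thesis by (simp add: q_def)
  qed
  have SI [measurable]: "{w\<in>space M. \<forall>i\<in>I. Y i w \<in> A i} \<in> sets M"
    using insert.hyps insert.prems by (intro sets.sets_Collect_finite_All) (auto intro!: measurable_sets_Collect[OF Ym])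
  have Sj [measurable]: "{w\<in>space M. Y j w \<in> A j} \<in> sets M" by measurable
  have split: "{w\<in>space M. \<forall>i\<in>insert j I. Y i w \<in> A i} = {w\<in>space M. \<forall>i\<in>I. Y i w \<in> A i} \<inter> {w\<in>space M. Y j w \<in> A j}" by auto
  show ?case
  proof (cases "q = 0")
    \<comment> \<open>Conditioning on a null event is impossible, but both sides vanish
      here.\<close>
    case True
    have "measure M {w\<in>space M. \<forall>i\<in>insert j I. Y i w \<in> A i} \<le> measure M {w\<in>space M. Y j w \<in> A j}"
      unfolding split by (intro finite_measure_mono Sj) auto
    hence "measure M {w\<in>space M. \<forall>i\<in>insert j I. Y i w \<in> A i} = 0" using True q_eq by (simp add: measure_le_0_iff)
    moreover have "(\<Prod>i\<in>insert j I. measure (\<nu> i) (A i)) = 0" using True insert.hyps by (simp add: q_def)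
    ultimately show ?thesis by simp
  next
    case False
    have q0: "q > 0" using False unfolding q_def by (simp add: less_le)
    \<comment> \<open>The conditional law given \<open>Y j \<in> A j\<close>.\<close>
    define N where "N = density M (\<lambda>w. ennreal (indicator (A j) (Y j w) / q))"
    have emN: "emeasure N S = ennreal (measure M (S \<inter> {w\<in>space M. Y j w \<in> A j}) / q)" if S: "S \<in> sets M" for S
    proof -
      have "emeasure N S = (\<integral>\<^sup>+ w. ennreal (indicator (A j) (Y j w) / q) * indicator S w \<partial>M)"
        unfolding N_def using S by (intro emeasure_density) auto
      also have "\<dots> = (\<integral>\<^sup>+ w. ennreal (1 / q) * indicator (S \<inter> {w\<in>space M. Y j w \<in> A j}) w \<partial>M)"
        by (intro nn_integral_cong) (auto simp: indicator_def)
      also have "\<dots> = ennreal (1 / q) * emeasure M (S \<inter> {w\<in>space M. Y j w \<in> A j})"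
        using S by (intro nn_integral_cmult_indicator) auto
      also have "\<dots> = ennreal (measure M (S \<inter> {w\<in>space M. Y j w \<in> A j}) / q)"
        unfolding emeasure_eq_measure using q0 by (simp add: ennreal_mult'[symmetric])
      finally show ?thesis .
    qed
    have spN: "space N = space M" and seN [measurable_cong]: "sets N = sets M" by (simp_all add: N_def)
    have "emeasure N (space N) = ennreal (measure M (space M \<inter> {w\<in>space M. Y j w \<in> A j}) / q)"
      unfolding spN by (rule emN) auto
    also have "space M \<inter> {w\<in>space M. Y j w \<in> A j} = {w\<in>space M. Y j w \<in> A j}" by auto
    finally have pN: "prob_space N" using q0 q_eq by (intro prob_spaceI) simp
    have "measure N {w\<in>space N. \<forall>i\<in>I. Y i w \<in> A i} = (\<Prod>i\<in>I. measure (\<nu> i) (A i))"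
    proof (rule insert.IH[OF _ pN])
      show "Y i \<in> borel_measurable N" if "i \<in> I" for i using Ym[of i] that seN by (simp cong: measurable_cong_sets)
      fix u
      have "(CLINT w|N. iexp (\<Sum>i\<in>I. u i * Y i w)) = (CLINT w|M. (indicator (A j) (Y j w) / q) *\<^sub>R iexp (\<Sum>i\<in>I. u i * Y i w))"
        unfolding N_def using q0 by (subst integral_density) (auto simp del: of_real_sum)
      also have "\<dots> = (CLINT w|M. (1 / of_real q) * (iexp (\<Sum>i\<in>I. u i * Y i w) * indicator (A j) (Y j w)))"
        by (intro Bochner_Integration.integral_cong) (auto simp: scaleR_conv_of_real indicator_def)
      also have "\<dots> = (1 / of_real q) * (CLINT w|M. iexp (\<Sum>i\<in>I. u i * Y i w) * indicator (A j) (Y j w))"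
        by (rule integral_mult_right_zero)
      finally show "(CLINT w|N. iexp (\<Sum>i\<in>I. u i * Y i w)) = (\<Prod>i\<in>I. char (\<nu> i) (u i))"
        using PA[of u] q0 by simp
    qed (use insert.prems in auto)
    moreover have "measure N {w\<in>space N. \<forall>i\<in>I. Y i w \<in> A i} = measure M {w\<in>space M. \<forall>i\<in>insert j I. Y i w \<in> A i} / q"
      unfolding measure_def spN emN[OF SI] split[symmetric] using q0 by simp
    ultimately have "measure M {w\<in>space M. \<forall>i\<in>insert j I. Y i w \<in> A i} = q * (\<Prod>i\<in>I. measure (\<nu> i) (A i))"
      using q0 by (simp add: field_simps)
    thus ?thesis using insert.hyps by (simp add: q_def)
  qed
qed

lemma product_law_from_char:
  fixes Y :: "'i \<Rightarrow> 'w \<Rightarrow> real"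
  assumes I: "finite I" and \<nu>: "\<And>i. real_distribution (\<nu> i)"
    and M: "prob_space M" and Y: "\<And>i. i \<in> I \<Longrightarrow> Y i \<in> borel_measurable M"
    and ch: "\<And>u. (CLINT w|M. iexp (\<Sum>i\<in>I. u i * Y i w)) = (\<Prod>i\<in>I. char (\<nu> i) (u i))"
  shows "distr M (PiM I (\<lambda>_. borel)) (\<lambda>w. \<lambda>i\<in>I. Y i w) = PiM I \<nu>"
proof -
  interpret prob_space M by fact
  interpret \<nu>: real_distribution "\<nu> i" for i by fact
  interpret product_prob_space \<nu> by standard
  have Ym: "(\<lambda>w. \<lambda>i\<in>I. Y i w) \<in> measurable M (PiM I (\<lambda>_. borel))" using Y by (intro measurable_restrict) auto
  have se: "sets (PiM I \<nu>) = sets (PiM I (\<lambda>_. borel))" by (intro sets_PiM_cong) auto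
  show ?thesis
  proof (rule PiM_eqI[OF I])
    show "sets (distr M (PiM I (\<lambda>_. borel)) (\<lambda>w. \<lambda>i\<in>I. Y i w)) = sets (PiM I \<nu>)" by (simp add: se)
    fix A assume A: "\<And>i. i \<in> I \<Longrightarrow> A i \<in> sets (\<nu> i)"
    have "PiE I A \<in> sets (PiM I (\<lambda>_. borel))" using A I by (intro sets_PiM_I_finite) auto
    hence "emeasure (distr M (PiM I (\<lambda>_. borel)) (\<lambda>w. \<lambda>i\<in>I. Y i w)) (PiE I A) = emeasure M ((\<lambda>w. \<lambda>i\<in>I. Y i w) -` PiE I A \<inter> space M)"
      using Ym by (rule emeasure_distr[rotated])
    also have "(\<lambda>w. \<lambda>i\<in>I. Y i w) -` PiE I A \<inter> space M = {w\<in>space M. \<forall>i\<in>I. Y i w \<in> A i}" by (auto simp: PiE_iff)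
    also have "emeasure M \<dots> = ennreal (\<Prod>i\<in>I. measure (\<nu> i) (A i))"
    proof -
      have "measure M {w\<in>space M. \<forall>i\<in>I. Y i w \<in> A i} = (\<Prod>i\<in>I. measure (\<nu> i) (A i))"
        by (rule box_prob_from_char[OF I \<nu> M Y ch]) (use A in auto)
      thus ?thesis by (simp add: finite_measure.emeasure_eq_measure[OF prob_space.finite_measure[OF M]])
    qed
    also have "\<dots> = (\<Prod>i\<in>I. emeasure (\<nu> i) (A i))"
      by (simp add: \<nu>.emeasure_eq_measure prod_ennreal)
    finally show "emeasure (distr M (PiM I (\<lambda>_. borel)) (\<lambda>w. \<lambda>i\<in>I. Y i w)) (PiE I A) = (\<Prod>i\<in>I. emeasure (\<nu> i) (A i))" .
  qed
qed

text \<open>Both measures agree on boxes, where the integral of the product density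
  factorises.\<close>

lemma product_normal_law_density:
  fixes s r :: "nat \<Rightarrow> real"
  assumes s: "\<And>i. s i > 0" and r: "\<And>i. r i > 0"
  shows "PiM {..<m} (\<lambda>i. normal_law (s i)) = density (PiM {..<m} (\<lambda>i. normal_law (r i)))
    (\<lambda>x. \<Prod>i<m. ennreal (normal_density 0 (s i) (x i) / normal_density 0 (r i) (x i)))"
proof -
  define q where "q = (\<lambda>i y. normal_density 0 (s i) y / normal_density 0 (r i) y)"
  have qm [measurable]: "q i \<in> borel_measurable borel" for i unfolding q_def by measurable
  have q0: "q i y \<ge> 0" for i y by (simp add: q_def)
  interpret S: product_prob_space "\<lambda>i. normal_law (s i)" by (intro product_prob_spaceI prob_space_normal_law s)
  interpret R: product_prob_space "\<lambda>i. normal_law (r i)" by (intro product_prob_spaceI prob_space_normal_law r)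
  have sets_eq: "sets (PiM {..<m} (\<lambda>i. normal_law (\<sigma> i))) = sets (PiM {..<m} (\<lambda>_. borel))" for \<sigma>
    by (intro sets_PiM_cong) auto
  have qPm [measurable]: "(\<lambda>x. \<Prod>i<m. ennreal (q i (x i))) \<in> borel_measurable (PiM {..<m} (\<lambda>i. normal_law (r i)))"
    by measurable
  have "density (PiM {..<m} (\<lambda>i. normal_law (r i))) (\<lambda>x. \<Prod>i<m. ennreal (q i (x i))) = PiM {..<m} (\<lambda>i. normal_law (s i))"
  proof (rule S.PiM_eqI)
    show "sets (density (PiM {..<m} (\<lambda>i. normal_law (r i))) (\<lambda>x. \<Prod>i<m. ennreal (q i (x i)))) = sets (PiM {..<m} (\<lambda>i. normal_law (s i)))"
      by (simp add: sets_eq)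
    fix A assume "\<And>i. i \<in> {..<m} \<Longrightarrow> A i \<in> sets (normal_law (s i))"
    hence A: "A i \<in> sets borel" if "i < m" for i using that by simp
    have "PiE {..<m} A \<in> sets (PiM {..<m} (\<lambda>i. normal_law (r i)))" using A by (intro sets_PiM_I_finite) auto
    hence "emeasure (density (PiM {..<m} (\<lambda>i. normal_law (r i))) (\<lambda>x. \<Prod>i<m. ennreal (q i (x i)))) (PiE {..<m} A)
      = (\<integral>\<^sup>+ x. (\<Prod>i<m. ennreal (q i (x i))) * indicator (PiE {..<m} A) x \<partial>PiM {..<m} (\<lambda>i. normal_law (r i)))"
      by (intro emeasure_density qPm)
    also have "\<dots> = (\<integral>\<^sup>+ x. (\<Prod>i<m. ennreal (q i (x i)) * indicator (A i) (x i)) \<partial>PiM {..<m} (\<lambda>i. normal_law (r i)))"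
    proof (intro nn_integral_cong)
      fix x assume x: "x \<in> space (PiM {..<m} (\<lambda>i. normal_law (r i)))"
      have "(indicator (PiE {..<m} A) x :: ennreal) = (\<Prod>i<m. indicator (A i) (x i))"
      proof (cases "\<forall>i<m. x i \<in> A i")
        case True
        thus ?thesis using x by (auto simp: space_PiM PiE_iff)
      next
        case False
        then obtain i where "i < m" "x i \<notin> A i" by blast
        hence "(\<Prod>i<m. indicator (A i) (x i)) = (0 :: ennreal)" by (intro prod_zero bexI[of _ i]) auto
        moreover have "x \<notin> PiE {..<m} A" using False by (auto simp: PiE_iff)
        ultimately show ?thesis by simp
      qed
      thus "(\<Prod>i<m. ennreal (q i (x i))) * indicator (PiE {..<m} A) x = (\<Prod>i<m. ennreal (q i (x i)) * indicator (A i) (x i))"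
        by (simp add: prod.distrib)
    qed
    also have "\<dots> = (\<Prod>i<m. \<integral>\<^sup>+ y. ennreal (q i y) * indicator (A i) y \<partial>normal_law (r i))"
      by (rule R.product_nn_integral_prod) (use A in auto)
    also have "\<dots> = (\<Prod>i<m. emeasure (normal_law (s i)) (A i))"
    proof (intro prod.cong refl)
      fix i assume "i \<in> {..<m}"
      hence Ai [measurable]: "A i \<in> sets borel" using A by simp
      have "(\<integral>\<^sup>+ y. ennreal (q i y) * indicator (A i) y \<partial>normal_law (r i))
        = (\<integral>\<^sup>+ y. ennreal (normal_density 0 (r i) y) * (ennreal (q i y) * indicator (A i) y) \<partial>lborel)"
        unfolding normal_law_def by (rule nn_integral_density) measurable
      also have "\<dots> = (\<integral>\<^sup>+ y. ennreal (normal_density 0 (s i) y) * indicator (A i) y \<partial>lborel)"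
      proof (intro nn_integral_cong)
        fix y
        have "normal_density 0 (r i) y * q i y = normal_density 0 (s i) y"
          using normal_density_pos[OF r[of i], of 0 y] by (simp add: q_def)
        thus "ennreal (normal_density 0 (r i) y) * (ennreal (q i y) * indicator (A i) y) = ennreal (normal_density 0 (s i) y) * indicator (A i) y"
          using q0 by (simp add: mult.assoc[symmetric] ennreal_mult'[symmetric])
      qed
      also have "\<dots> = emeasure (normal_law (s i)) (A i)"
        unfolding normal_law_def by (rule emeasure_density[symmetric]) auto
      finally show "(\<integral>\<^sup>+ y. ennreal (q i y) * indicator (A i) y \<partial>normal_law (r i)) = emeasure (normal_law (s i)) (A i)" .
    qed
    finally show "emeasure (density (PiM {..<m} (\<lambda>i. normal_law (r i))) (\<lambda>x. \<Prod>i<m. ennreal (q i (x i)))) (PiE {..<m} A)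
      = (\<Prod>i<m. emeasure (normal_law (s i)) (A i))" .
  qed simp
  thus ?thesis by (simp add: q_def)
qed

text \<open>A fractional moment of the likelihood ratio stands in for the relative entropy: it factorises
  over the coordinates.\<close>

lemma product_normal_law_uniformly_continuous:
  fixes a b C \<epsilon> :: real
  assumes a: "a > 0" and e: "\<epsilon> > 0"
  obtains \<delta> where "\<delta> > 0"
    "\<And>m (s :: nat \<Rightarrow> real) (r :: nat \<Rightarrow> real) A. (\<And>i. s i > 0) \<Longrightarrow> (\<And>i. r i > 0) \<Longrightarrow>
      (\<And>i. i < m \<Longrightarrow> a \<le> (s i)\<^sup>2 / (r i)\<^sup>2 \<and> (s i)\<^sup>2 / (r i)\<^sup>2 \<le> b) \<Longrightarrow>
      (\<Sum>i<m. ((s i)\<^sup>2 / (r i)\<^sup>2 - 1)\<^sup>2) \<le> C \<Longrightarrow> A \<in> sets (PiM {..<m} (\<lambda>_. borel)) \<Longrightarrow>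
      emeasure (PiM {..<m} (\<lambda>i. normal_law (r i))) A < ennreal \<delta> \<Longrightarrow>
      emeasure (PiM {..<m} (\<lambda>i. normal_law (s i))) A < ennreal \<epsilon>"
proof -
  \<comment> \<open>A small exponent with \<open>p * b \<le> 1 / 2\<close>, as the moment bound
    requires; taking the maximum with 1 keeps it positive for every \<open>b\<close>.\<close>
  define p where "p = 1 / (2 * max b 1)"
  have p: "p > 0" "p * b \<le> 1 / 2" by (auto simp: p_def divide_simps max_def)
  define c where "c = p / (2 * a) + p\<^sup>2"
  have c0: "c \<ge> 0" using p a by (simp add: c_def)
  define L where "L = exp (c * C)"
  \<comment> \<open>Chosen so that Markov's inequality for the moment bound \<open>L\<close> leaves
    mass at most \<open>L / K powr p = \<epsilon> / 2\<close> where the likelihood ratio exceeds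
    \<open>K\<close>. None of \<open>p\<close>, \<open>L\<close>, \<open>K\<close> depends on
    \<open>m\<close>.\<close>
  define K where "K = (2 * L / \<epsilon>) powr (1 / p)"
  have L0: "L > 0" by (simp add: L_def)
  have K0: "K > 0" using e L0 by (simp add: K_def)
  have Kp: "K powr p = 2 * L / \<epsilon>" using e L0 p by (simp add: K_def powr_powr)
  show thesis
  proof (rule that[of "\<epsilon> / (2 * K)"])
    show "\<epsilon> / (2 * K) > 0" using e K0 by simp
    fix m and s r :: "nat \<Rightarrow> real" and A
    assume s: "\<And>i. s i > 0" and r: "\<And>i. r i > 0"
      and ab: "\<And>i. i < m \<Longrightarrow> a \<le> (s i)\<^sup>2 / (r i)\<^sup>2 \<and> (s i)\<^sup>2 / (r i)\<^sup>2 \<le> b"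
      and C: "(\<Sum>i<m. ((s i)\<^sup>2 / (r i)\<^sup>2 - 1)\<^sup>2) \<le> C" and A: "A \<in> sets (PiM {..<m} (\<lambda>_. borel :: real measure))"
      and lt: "emeasure (PiM {..<m} (\<lambda>i. normal_law (r i))) A < ennreal (\<epsilon> / (2 * K))"
    let ?S = "PiM {..<m} (\<lambda>i. normal_law (s i))"
    let ?R = "PiM {..<m} (\<lambda>i. normal_law (r i))"
    interpret S: product_prob_space "\<lambda>i. normal_law (s i)" by (intro product_prob_spaceI prob_space_normal_law s)
    define q where "q = (\<lambda>i y. normal_density 0 (s i) y / normal_density 0 (r i) y)"
    have qm [measurable]: "q i \<in> borel_measurable borel" for i unfolding q_def by measurable
    have q0: "q i y \<ge> 0" for i y by (simp add: q_def)
    define \<rho> where "\<rho> = (\<lambda>x. \<Prod>i<m. q i (x i))"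
    have \<rho>0: "\<rho> x \<ge> 0" for x unfolding \<rho>_def using q0 by (intro prod_nonneg) auto
    have sets_eq: "sets (PiM {..<m} (\<lambda>i. normal_law (\<sigma> i))) = sets (PiM {..<m} (\<lambda>_. borel))" for \<sigma>
      by (intro sets_PiM_cong) auto
    have \<rho>m0: "\<rho> \<in> borel_measurable (PiM {..<m} (\<lambda>_. borel))"
      unfolding \<rho>_def by (intro borel_measurable_prod) measurable
    have \<rho>mS [measurable]: "\<rho> \<in> borel_measurable ?S" and \<rho>mR [measurable]: "\<rho> \<in> borel_measurable ?R"
      using \<rho>m0 by (simp_all cong: measurable_cong_sets add: sets_eq)
    have AS [measurable]: "A \<in> sets ?S" and AR [measurable]: "A \<in> sets ?R" using A by (simp_all add: sets_eq)
    have dens: "?S = density ?R (\<lambda>x. ennreal (\<rho> x))"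
      using product_normal_law_density[OF s r, of m] q0 unfolding \<rho>_def q_def by (simp add: prod_ennreal)
    have "(\<integral>\<^sup>+ x. ennreal (\<rho> x powr p) \<partial>?S) = (\<integral>\<^sup>+ x. (\<Prod>i<m. ennreal (q i (x i) powr p)) \<partial>?S)"
      unfolding \<rho>_def using q0 by (intro nn_integral_cong) (simp add: prod_powr_distrib prod_ennreal)
    also have "\<dots> = (\<Prod>i<m. \<integral>\<^sup>+ y. ennreal (q i y powr p) \<partial>normal_law (s i))"
      by (rule S.product_nn_integral_prod) auto
    also have "\<dots> \<le> (\<Prod>i<m. ennreal (exp (c * ((s i)\<^sup>2 / (r i)\<^sup>2 - 1)\<^sup>2)))"
    proof (intro prod_mono_ennreal)
      fix i assume "i \<in> {..<m}"
      hence i: "i < m" by simp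
      have "(\<integral>\<^sup>+ y. ennreal (q i y powr p) \<partial>normal_law (s i)) = (\<integral>\<^sup>+ y. ennreal (normal_density 0 (s i) y) * ennreal (q i y powr p) \<partial>lborel)"
        unfolding normal_law_def by (rule nn_integral_density) measurable
      also have "\<dots> = (\<integral>\<^sup>+ y. ennreal (normal_density 0 (s i) y * (normal_density 0 (s i) y / normal_density 0 (r i) y) powr p) \<partial>lborel)"
        by (simp add: q_def ennreal_mult'[symmetric])
      also have "\<dots> \<le> ennreal (exp (c * ((s i)\<^sup>2 / (r i)\<^sup>2 - 1)\<^sup>2))"
        unfolding c_def using ab[OF i] by (intro normal_likelihood_moment_le[where b=b] s r p a refl) auto
      finally show "(\<integral>\<^sup>+ y. ennreal (q i y powr p) \<partial>normal_law (s i)) \<le> ennreal (exp (c * ((s i)\<^sup>2 / (r i)\<^sup>2 - 1)\<^sup>2))" .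
    qed
    also have "\<dots> = ennreal (exp (c * (\<Sum>i<m. ((s i)\<^sup>2 / (r i)\<^sup>2 - 1)\<^sup>2)))"
      by (simp add: prod_ennreal exp_sum sum_distrib_left)
    also have "\<dots> \<le> ennreal L" unfolding L_def using C c0 by (intro ennreal_leI) (simp add: mult_left_mono)
    finally have mom: "(\<integral>\<^sup>+ x. ennreal (\<rho> x powr p) \<partial>?S) \<le> ennreal L" .
    \<comment> \<open>Where the ratio is at most \<open>K\<close>, the first law is at most
      \<open>K\<close> times the second; the rest of \<open>A\<close> is left to Markov's
      inequality.\<close>
    define A1 where "A1 = {x\<in>space ?S. \<rho> x \<le> K} \<inter> A"
    have A1S [measurable]: "A1 \<in> sets ?S" unfolding A1_def by measurable
    have A1R: "A1 \<in> sets ?R" using A1S by (simp add: sets_eq)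
    have part1: "emeasure ?S A1 \<le> ennreal K * emeasure ?R A"
    proof -
      have "emeasure ?S A1 = (\<integral>\<^sup>+ x. ennreal (\<rho> x) * indicator A1 x \<partial>?R)"
        by (subst dens) (rule emeasure_density, auto simp: A1R)
      also have "\<dots> \<le> (\<integral>\<^sup>+ x. ennreal K * indicator A x \<partial>?R)"
        by (intro nn_integral_mono) (auto simp: A1_def indicator_def intro: ennreal_leI)
      also have "\<dots> = ennreal K * emeasure ?R A" by (rule nn_integral_cmult_indicator[OF AR])
      finally show ?thesis .
    qed
    have "emeasure ?S A = (\<integral>\<^sup>+ x. indicator A x \<partial>?S)" by simp
    also have "\<dots> \<le> (\<integral>\<^sup>+ x. indicator A1 x + ennreal (1 / K powr p) * ennreal (\<rho> x powr p) \<partial>?S)"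
    proof (intro nn_integral_mono)
      fix x assume x: "x \<in> space ?S"
      show "indicator A x \<le> indicator A1 x + ennreal (1 / K powr p) * ennreal (\<rho> x powr p)"
      proof (cases "\<rho> x \<le> K")
        case True
        thus ?thesis using x by (auto simp: A1_def indicator_def)
      next
        case False
        have "K powr p \<le> \<rho> x powr p" using False K0 p by (intro powr_mono2) auto
        hence "1 \<le> 1 / K powr p * \<rho> x powr p" using K0 by (simp add: divide_simps)
        hence "1 \<le> ennreal (1 / K powr p) * ennreal (\<rho> x powr p)" by (subst ennreal_mult'[symmetric]) auto
        also have "\<dots> \<le> indicator A1 x + \<dots>" by simp
        finally show ?thesis by (auto simp: indicator_def)
      qed
    qed
    also have "\<dots> = emeasure ?S A1 + ennreal (1 / K powr p) * (\<integral>\<^sup>+ x. ennreal (\<rho> x powr p) \<partial>?S)"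
      by (subst nn_integral_add) (auto simp: nn_integral_cmult)
    also have "\<dots> \<le> ennreal K * emeasure ?R A + ennreal (1 / K powr p) * ennreal L"
      using part1 mom by (intro add_mono mult_left_mono) auto
    also have "ennreal (1 / K powr p) * ennreal L = ennreal (\<epsilon> / 2)"
      unfolding Kp using L0 e by (simp add: ennreal_mult'[symmetric])
    also have "ennreal K * emeasure ?R A + ennreal (\<epsilon> / 2) < ennreal (\<epsilon> / 2) + ennreal (\<epsilon> / 2)"
    proof -
      have "ennreal K * emeasure ?R A < ennreal K * ennreal (\<epsilon> / (2 * K))"
        using lt K0 by (intro ennreal_mult_strict_left_mono) auto
      also have "\<dots> = ennreal (\<epsilon> / 2)" using K0 e by (simp add: ennreal_mult'[symmetric])
      finally show ?thesis
        unfolding add.commute[of "ennreal K * emeasure ?R A"] by (simp add: ennreal_add_left_cancel_less)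
    qed
    also have "ennreal (\<epsilon> / 2) + ennreal (\<epsilon> / 2) = ennreal \<epsilon>" using e by (simp add: ennreal_plus[symmetric] del: ennreal_plus)
    finally show "emeasure ?S A < ennreal \<epsilon>" .
  qed
qed

section \<open>Cylinder sets and finite-dimensional laws\<close>

definition cylinder :: "'t set \<Rightarrow> 't set \<Rightarrow> ('t \<Rightarrow> real) set \<Rightarrow> ('t \<Rightarrow> real) set" where
  "cylinder D T B = {x \<in> space (PiM D (\<lambda>_. borel)). restrict x T \<in> B}"

definition cylinders :: "'t set \<Rightarrow> ('t \<Rightarrow> real) set set" where
  "cylinders D = {cylinder D T B |T B. finite T \<and> T \<subseteq> D \<and> B \<in> sets (PiM T (\<lambda>_. borel))}"

lemma restrict_measurable_subset:
  assumes "T \<subseteq> D"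
  shows "(\<lambda>x. restrict x T) \<in> measurable (PiM D (\<lambda>_. borel :: real measure)) (PiM T (\<lambda>_. borel))"
  using assms by (intro measurable_restrict_subset)

lemma cylinder_in_sets:
  assumes "T \<subseteq> D" "B \<in> sets (PiM T (\<lambda>_. borel))"
  shows "cylinder D T B \<in> sets (PiM D (\<lambda>_. borel))"
proof -
  have "cylinder D T B = (\<lambda>x. restrict x T) -` B \<inter> space (PiM D (\<lambda>_. borel))" by (auto simp: cylinder_def)
  thus ?thesis using measurable_sets[OF restrict_measurable_subset[OF assms(1)] assms(2)] by simp
qed

lemma cylinder_extend:
  assumes "T \<subseteq> T'" "T' \<subseteq> D" "B \<in> sets (PiM T (\<lambda>_. borel))"
  obtains B' where "B' \<in> sets (PiM T' (\<lambda>_. borel))" "cylinder D T B = cylinder D T' B'"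
proof (rule that[OF cylinder_in_sets[OF assms(1,3)]])
  have "restrict (restrict x T') T = restrict x T" for x :: "'a \<Rightarrow> real" using assms(1) by (intro ext) (auto simp: restrict_def)
  moreover have "restrict x T' \<in> space (PiM T' (\<lambda>_. borel :: real measure))" if "x \<in> space (PiM D (\<lambda>_. borel))" for x
    by (auto simp: space_PiM)
  ultimately show "cylinder D T B = cylinder D T' (cylinder T' T B)" by (auto simp: cylinder_def)
qed

lemma cylinders_Compl:
  assumes "C \<in> cylinders D" shows "space (PiM D (\<lambda>_. borel)) - C \<in> cylinders D"
proof -
  obtain T B where TB: "finite T" "T \<subseteq> D" "B \<in> sets (PiM T (\<lambda>_. borel))" "C = cylinder D T B"
    using assms by (auto simp: cylinders_def)
  have "restrict x T \<in> space (PiM T (\<lambda>_. borel :: real measure))" for x :: "'a \<Rightarrow> real" by (auto simp: space_PiM)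
  hence "space (PiM D (\<lambda>_. borel)) - C = cylinder D T (space (PiM T (\<lambda>_. borel)) - B)"
    by (auto simp: TB cylinder_def)
  thus ?thesis using TB unfolding cylinders_def by blast
qed

lemma cylinders_Un:
  assumes "C1 \<in> cylinders D" "C2 \<in> cylinders D" shows "C1 \<union> C2 \<in> cylinders D"
proof -
  obtain T1 B1 where 1: "finite T1" "T1 \<subseteq> D" "B1 \<in> sets (PiM T1 (\<lambda>_. borel))" "C1 = cylinder D T1 B1"
    using assms by (auto simp: cylinders_def)
  obtain T2 B2 where 2: "finite T2" "T2 \<subseteq> D" "B2 \<in> sets (PiM T2 (\<lambda>_. borel))" "C2 = cylinder D T2 B2"
    using assms by (auto simp: cylinders_def)
  have T: "finite (T1 \<union> T2)" "T1 \<union> T2 \<subseteq> D" using 1 2 by auto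
  obtain B1' where B1': "B1' \<in> sets (PiM (T1 \<union> T2) (\<lambda>_. borel))" "C1 = cylinder D (T1 \<union> T2) B1'"
    using cylinder_extend[OF Un_upper1[of T1 T2] T(2) 1(3)] 1(4) by metis
  obtain B2' where B2': "B2' \<in> sets (PiM (T1 \<union> T2) (\<lambda>_. borel))" "C2 = cylinder D (T1 \<union> T2) B2'"
    using cylinder_extend[OF Un_upper2[of T2 T1] T(2) 2(3)] 2(4) by metis
  have "C1 \<union> C2 = cylinder D (T1 \<union> T2) (B1' \<union> B2')" using B1' B2' by (auto simp: cylinder_def)
  thus ?thesis using T B1' B2' unfolding cylinders_def by blast
qed

lemma empty_cylinder: "{} \<in> cylinders D"
proof -
  have "cylinder D {} {} = {}" by (simp add: cylinder_def)
  thus ?thesis unfolding cylinders_def by blast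
qed

text \<open>The sets that can be approximated in the sum of both measures form a sigma-algebra.
  Working with the sum \<open>d\<close> yields one cylinder that is close for \<open>\<mu>\<close>
  and \<open>\<nu>\<close> simultaneously.\<close>

lemma cylinders_approximate:
  fixes \<mu> \<nu> :: "('t \<Rightarrow> real) measure"
  assumes \<mu>: "finite_measure \<mu>" "sets \<mu> = sets (PiM D (\<lambda>_. borel))"
    and \<nu>: "finite_measure \<nu>" "sets \<nu> = sets (PiM D (\<lambda>_. borel))"
    and A: "A \<in> sets (PiM D (\<lambda>_. borel))" and e: "\<epsilon> > 0"
  obtains C where "C \<in> cylinders D" "measure \<mu> ((A - C) \<union> (C - A)) < \<epsilon>" "measure \<nu> ((A - C) \<union> (C - A)) < \<epsilon>"
proof -
  interpret \<mu>: finite_measure \<mu> by fact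
  interpret \<nu>: finite_measure \<nu> by fact
  let ?P = "PiM D (\<lambda>_. borel :: real measure)"
  have cyl_sets: "C \<in> sets ?P" if "C \<in> cylinders D" for C
    using that cylinder_in_sets by (auto simp: cylinders_def)
  define d where "d = (\<lambda>X. measure \<mu> X + measure \<nu> X)"
  have d_mono: "d X \<le> d Y" if "X \<subseteq> Y" "Y \<in> sets ?P" for X Y
    unfolding d_def using that \<mu>(2) \<nu>(2) by (intro add_mono \<mu>.finite_measure_mono \<nu>.finite_measure_mono) auto
  have d_Un: "d (X \<union> Y) \<le> d X + d Y" if "X \<in> sets ?P" "Y \<in> sets ?P" for X Y
    using measure_Un_le[of X \<mu> Y] measure_Un_le[of X \<nu> Y] that \<mu>(2) \<nu>(2) unfolding d_def by simp
  have d_UN: "d (\<Union>i\<in>I. X i) \<le> (\<Sum>i\<in>I. d (X i))" if "finite I" "\<And>i. i \<in> I \<Longrightarrow> X i \<in> sets ?P" for I :: "nat set" and X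
    using that
  proof (induction I)
    case (insert i I)
    have "d (\<Union>j\<in>insert i I. X j) \<le> d (X i) + d (\<Union>j\<in>I. X j)"
      using d_Un[of "X i" "\<Union>j\<in>I. X j"] insert by (simp add: sets.finite_UN)
    thus ?case using insert by simp
  qed (simp add: d_def)
  have "A \<in> sigma_sets (\<Pi>\<^sub>E i\<in>D. space borel) {{f\<in>\<Pi>\<^sub>E i\<in>D. space borel. f i \<in> X} |i X. i \<in> D \<and> X \<in> sets (borel :: real measure)}"
    using A unfolding sets_PiM_single .
  hence "A \<in> sets ?P \<and> (\<forall>\<epsilon>>0. \<exists>C\<in>cylinders D. d ((A - C) \<union> (C - A)) < \<epsilon>)"
  proof (induction A rule: sigma_sets.induct)
    case (Basic A)
    then obtain i X where iX: "i \<in> D" "X \<in> sets borel" "A = {f\<in>\<Pi>\<^sub>E i\<in>D. space borel. f i \<in> X}" by blast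
    have "{x \<in> space (PiM {i} (\<lambda>_. borel)). x i \<in> X} \<in> sets (PiM {i} (\<lambda>_. borel :: real measure))"
      using iX by measurable
    moreover have "A = cylinder D {i} {x \<in> space (PiM {i} (\<lambda>_. borel)). x i \<in> X}"
      using iX by (auto simp: cylinder_def space_PiM)
    ultimately have "A \<in> cylinders D" using iX unfolding cylinders_def by blast
    thus ?case using cyl_sets by (intro conjI allI impI bexI[of _ A]) (auto simp: d_def)
  next
    case Empty
    thus ?case using empty_cylinder by (intro conjI allI impI bexI[of _ "{}"]) (auto simp: d_def)
  next
    case (Compl A)
    have sp: "(\<Pi>\<^sub>E i\<in>D. space borel) = space ?P" by (simp add: space_PiM)
    show ?case unfolding sp
    proof (intro conjI allI impI)
      show "space ?P - A \<in> sets ?P" using Compl by auto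
      fix \<epsilon> :: real assume "\<epsilon> > 0"
      then obtain C where C: "C \<in> cylinders D" "d ((A - C) \<union> (C - A)) < \<epsilon>" using Compl by blast
      have "A \<subseteq> space ?P" "C \<subseteq> space ?P" using Compl cyl_sets[OF C(1)] sets.sets_into_space by blast+
      hence "(space ?P - A - (space ?P - C)) \<union> (space ?P - C - (space ?P - A)) = (A - C) \<union> (C - A)" by auto
      thus "\<exists>C\<in>cylinders D. d ((space ?P - A - C) \<union> (C - (space ?P - A))) < \<epsilon>"
        using C cylinders_Compl[OF C(1)] by (intro bexI[of _ "space ?P - C"]) auto
    qed
  next
    case (Union A)
    have As: "A i \<in> sets ?P" for i using Union by blast
    have Us: "(\<Union>i. A i) \<in> sets ?P" using As by auto
    show ?case
    proof (intro conjI allI impI Us)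
      fix \<epsilon> :: real assume e: "\<epsilon> > 0"
      define U where "U = (\<lambda>n. \<Union>i\<le>n. A i)"
      have Un: "U n \<in> sets ?P" for n unfolding U_def using As by auto
      have "incseq U" unfolding U_def by (intro monoI) force
      moreover have "(\<Union>n. U n) = (\<Union>i. A i)" unfolding U_def by auto
      ultimately have "(\<lambda>n. d (U n)) \<longlonglongrightarrow> d (\<Union>i. A i)"
        unfolding d_def using Un \<mu>(2) \<nu>(2) \<mu>.finite_Lim_measure_incseq[of U] \<nu>.finite_Lim_measure_incseq[of U]
        by (intro tendsto_add) auto
      hence "eventually (\<lambda>n. d (U n) > d (\<Union>i. A i) - \<epsilon> / 2) sequentially"
        using e by (intro order_tendstoD) auto
      then obtain n where n: "d (U n) > d (\<Union>i. A i) - \<epsilon> / 2" by (auto simp: eventually_sequentially)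
      have dU: "d ((\<Union>i. A i) - U n) < \<epsilon> / 2"
      proof -
        have sub: "U n \<subseteq> (\<Union>i. A i)" by (auto simp: U_def)
        have "d ((\<Union>i. A i) - U n) = d (\<Union>i. A i) - d (U n)"
          unfolding d_def using \<mu>.finite_measure_Diff[of "\<Union>i. A i" "U n"] \<nu>.finite_measure_Diff[of "\<Union>i. A i" "U n"] sub Us Un \<mu>(2) \<nu>(2)
          by simp
        thus ?thesis using n by simp
      qed
      \<comment> \<open>The index \<open>n\<close> of the finite union is already fixed, so the
        error can be divided equally among its \<open>Suc n\<close> members.\<close>
      have "\<exists>C\<in>cylinders D. d ((A i - C) \<union> (C - A i)) < \<epsilon> / (2 * real (Suc n))" for i
        using Union.IH[of i] e by simp
      then obtain C where C: "\<And>i. C i \<in> cylinders D" "\<And>i. d ((A i - C i) \<union> (C i - A i)) < \<epsilon> / (2 * real (Suc n))" by metis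
      have Cn: "(\<Union>i\<le>k. C i) \<in> cylinders D" for k
      proof (induction k)
        case (Suc k)
        thus ?case using cylinders_Un[OF Suc C(1)[of "Suc k"]] by (simp add: atMost_Suc Un_commute)
      qed (use C in simp)
      let ?C = "\<Union>i\<le>n. C i"
      have Cs: "C i \<in> sets ?P" for i using cyl_sets C by blast
      have ms: "(A i - C i) \<union> (C i - A i) \<in> sets ?P" for i using As Cs by auto
      have "d (((\<Union>i. A i) - ?C) \<union> (?C - (\<Union>i. A i))) \<le> d (((\<Union>i. A i) - U n) \<union> (\<Union>i\<le>n. (A i - C i) \<union> (C i - A i)))"
        using Us Un ms by (intro d_mono) (auto simp: U_def)
      also have "\<dots> \<le> d ((\<Union>i. A i) - U n) + d (\<Union>i\<le>n. (A i - C i) \<union> (C i - A i))"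
        using Us Un ms by (intro d_Un) auto
      also have "d (\<Union>i\<le>n. (A i - C i) \<union> (C i - A i)) \<le> (\<Sum>i\<le>n. d ((A i - C i) \<union> (C i - A i)))"
        using ms by (intro d_UN) auto
      also have "\<dots> \<le> (\<Sum>i\<le>n. \<epsilon> / (2 * real (Suc n)))" using C(2) by (intro sum_mono less_imp_le)
      also have "\<dots> = \<epsilon> / 2" by (simp add: field_simps del: of_nat_Suc)
      finally have "d (((\<Union>i. A i) - ?C) \<union> (?C - (\<Union>i. A i))) < \<epsilon>" using dU by simp
      thus "\<exists>C\<in>cylinders D. d (((\<Union>i. A i) - C) \<union> (C - (\<Union>i. A i))) < \<epsilon>" using Cn[of n] by blast
    qed
  qed
  then obtain C where "C \<in> cylinders D" "d ((A - C) \<union> (C - A)) < \<epsilon>" using e by blast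
  thus thesis using that[of C] unfolding d_def
    by (smt (verit) measure_nonneg)
qed

text \<open>A cylinder close in both measures to a \<open>\<mu>\<close>-null set has small
  \<open>\<mu>\<close>-mass, hence small \<open>\<nu>\<close>-mass, and the null set differs from it
  by little in \<open>\<nu>\<close>. It is essential that \<open>\<delta>\<close> serves all
  cylinders at once, since the approximating cylinder has no prescribed dimension.\<close>

lemma absolutely_continuous_from_cylinders:
  fixes \<mu> \<nu> :: "('t \<Rightarrow> real) measure"
  assumes \<mu>: "prob_space \<mu>" "sets \<mu> = sets (PiM D (\<lambda>_. borel))"
    and \<nu>: "prob_space \<nu>" "sets \<nu> = sets (PiM D (\<lambda>_. borel))"
    and unif: "\<And>\<epsilon>. \<epsilon> > 0 \<Longrightarrow> \<exists>\<delta>>0. \<forall>C\<in>cylinders D. emeasure \<mu> C < ennreal \<delta> \<longrightarrow> emeasure \<nu> C < ennreal \<epsilon>"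
  shows "absolutely_continuous \<mu> \<nu>"
  unfolding absolutely_continuous_def
proof
  interpret \<mu>: prob_space \<mu> by fact
  interpret \<nu>: prob_space \<nu> by fact
  fix A assume A: "A \<in> null_sets \<mu>"
  hence As: "A \<in> sets (PiM D (\<lambda>_. borel))" and A0: "measure \<mu> A = 0" using \<mu>(2) by (auto simp: null_sets_def measure_def)
  have "measure \<nu> A < e" if e: "e > 0" for e
  proof -
    obtain \<delta> where \<delta>: "\<delta> > 0" "\<And>C. C \<in> cylinders D \<Longrightarrow> emeasure \<mu> C < ennreal \<delta> \<Longrightarrow> emeasure \<nu> C < ennreal (e / 2)"
      using unif[of "e / 2"] e by auto
    obtain C where C: "C \<in> cylinders D" "measure \<mu> ((A - C) \<union> (C - A)) < min \<delta> (e / 2)" "measure \<nu> ((A - C) \<union> (C - A)) < min \<delta> (e / 2)"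
      using cylinders_approximate[OF \<mu>.finite_measure_axioms \<mu>(2) \<nu>.finite_measure_axioms \<nu>(2) As, of "min \<delta> (e / 2)"] \<delta>(1) e by auto
    have Cs: "C \<in> sets (PiM D (\<lambda>_. borel))" using C(1) cylinder_in_sets by (auto simp: cylinders_def)
    have "measure \<mu> C \<le> measure \<mu> (A \<union> ((A - C) \<union> (C - A)))"
      using As Cs \<mu>(2) by (intro \<mu>.finite_measure_mono) auto
    also have "\<dots> \<le> measure \<mu> A + measure \<mu> ((A - C) \<union> (C - A))"
      using As Cs \<mu>(2) by (intro measure_Un_le) auto
    finally have "measure \<mu> C < \<delta>" using A0 C(2) by simp
    hence "emeasure \<nu> C < ennreal (e / 2)" using \<delta>(1) by (intro \<delta>(2) C(1)) (simp add: \<mu>.emeasure_eq_measure ennreal_lessI)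
    hence "measure \<nu> C < e / 2" by (simp add: \<nu>.emeasure_eq_measure ennreal_less_iff)
    moreover have "measure \<nu> A \<le> measure \<nu> (C \<union> ((A - C) \<union> (C - A)))"
      using As Cs \<nu>(2) by (intro \<nu>.finite_measure_mono) auto
    moreover have "\<dots> \<le> measure \<nu> C + measure \<nu> ((A - C) \<union> (C - A))"
      using As Cs \<nu>(2) by (intro measure_Un_le) auto
    ultimately show ?thesis using C(3) by simp
  qed
  hence "measure \<nu> A = 0" by (metis measure_nonneg less_eq_real_def less_irrefl)
  thus "A \<in> null_sets \<nu>" using As \<nu>(2) by (auto simp: null_sets_def \<nu>.emeasure_eq_measure)
qed

section \<open>Simultaneous diagonalization of the two variance forms\<close>

text \<open>The real part of the Hermitian product: with real coefficients it is a symmetric real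
  bilinear form with the same quadratic form.\<close>

lemma sq_int_bilinear:
  assumes w [measurable]: "w \<in> borel_measurable borel" and w0: "\<And>x. w x \<ge> 0"
    and int: "\<And>c. integrable lborel (\<lambda>x. (norm (trig_poly T c x))\<^sup>2 * w x)"
  obtains B where
    "\<And>c a d e. B (\<lambda>s. c s + a * d s) e = B c e + a * B d e" "\<And>c d. B c d = B d c" "\<And>c. B c c = sq_int w T c"
proof -
  define B where "B = (\<lambda>c d. LINT x|lborel. Re (trig_poly T c x * cnj (trig_poly T d x)) * w x)"
  have bi: "integrable lborel (\<lambda>x. Re (trig_poly T c x * cnj (trig_poly T d x)) * w x)" for c d
  proof (rule Bochner_Integration.integrable_bound)
    show "integrable lborel (\<lambda>x. (norm (trig_poly T c x))\<^sup>2 * w x + (norm (trig_poly T d x))\<^sup>2 * w x)"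
      using int by auto
    show "AE x in lborel. norm (Re (trig_poly T c x * cnj (trig_poly T d x)) * w x)
        \<le> norm ((norm (trig_poly T c x))\<^sup>2 * w x + (norm (trig_poly T d x))\<^sup>2 * w x)"
    proof (rule AE_I2)
      fix x
      have "\<bar>Re (trig_poly T c x * cnj (trig_poly T d x))\<bar> \<le> norm (trig_poly T c x) * norm (trig_poly T d x)"
        using abs_Re_le_cmod[of "trig_poly T c x * cnj (trig_poly T d x)"] by (simp add: norm_mult)
      also have "\<dots> \<le> (norm (trig_poly T c x))\<^sup>2 + (norm (trig_poly T d x))\<^sup>2"
        using sum_squares_bound[of "norm (trig_poly T c x)" "norm (trig_poly T d x)"]
          mult_nonneg_nonneg[OF norm_ge_zero[of "trig_poly T c x"] norm_ge_zero[of "trig_poly T d x"]] by linarith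
      finally have "\<bar>Re (trig_poly T c x * cnj (trig_poly T d x))\<bar> * w x \<le> ((norm (trig_poly T c x))\<^sup>2 + (norm (trig_poly T d x))\<^sup>2) * w x"
        using w0 by (intro mult_right_mono) auto
      thus "norm (Re (trig_poly T c x * cnj (trig_poly T d x)) * w x)
        \<le> norm ((norm (trig_poly T c x))\<^sup>2 * w x + (norm (trig_poly T d x))\<^sup>2 * w x)"
        using w0[of x] by (simp only: real_norm_def abs_mult abs_of_nonneg distrib_right)
    qed
    show "(\<lambda>x. Re (trig_poly T c x * cnj (trig_poly T d x)) * w x) \<in> borel_measurable lborel"
    proof -
      have "Re (trig_poly T c x * cnj (trig_poly T d x)) = Re (trig_poly T c x) * Re (trig_poly T d x) + Im (trig_poly T c x) * Im (trig_poly T d x)" for x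
        by simp
      thus ?thesis by (simp only:) measurable
    qed
  qed
  have tp_lin: "trig_poly T (\<lambda>s. c s + a * d s) x = trig_poly T c x + of_real a * trig_poly T d x" for c a d x
    by (simp add: trig_poly_def sum_distrib_left sum.distrib[symmetric] algebra_simps)
  show thesis
  proof (rule that[of B])
    show "B (\<lambda>s. c s + a * d s) e = B c e + a * B d e" for c a d e
    proof -
      have "B (\<lambda>s. c s + a * d s) e = (LINT x|lborel. Re (trig_poly T c x * cnj (trig_poly T e x)) * w x + a * (Re (trig_poly T d x * cnj (trig_poly T e x)) * w x))"
        unfolding B_def tp_lin by (intro Bochner_Integration.integral_cong) (auto simp: algebra_simps)
      thus ?thesis using bi by (simp add: B_def del: times_complex.sel)
    qed
    show "B c d = B d c" for c d
      unfolding B_def by (intro Bochner_Integration.integral_cong) (auto simp: mult.commute)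
    have "Re (z * cnj z) = (norm z)\<^sup>2" for z by (metis Re_complex_of_real complex_norm_square)
    thus "B c c = sq_int w T c" for c unfolding B_def sq_int_def by (simp only:)
  qed
qed

lemma bilinear_sum:
  fixes B :: "('t \<Rightarrow> real) \<Rightarrow> ('t \<Rightarrow> real) \<Rightarrow> real" and m n :: nat
  assumes lin: "\<And>c a d e. B (\<lambda>s. c s + a * d s) e = B c e + a * B d e" and sym: "\<And>c d. B c d = B d c"
  shows "B (\<lambda>s. \<Sum>i<m. u i * b i s) (\<lambda>s. \<Sum>j<n. v j * d j s) = (\<Sum>i<m. \<Sum>j<n. u i * B (b i) (d j) * v j)"
proof -
  have zero: "B (\<lambda>s. 0) e = 0" for e using lin[of "\<lambda>s. 0" 1 "\<lambda>s. 0" e] by simp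
  have left: "B (\<lambda>s. \<Sum>i<m. u i * b i s) e = (\<Sum>i<m. u i * B (b i) e)" for u b e and m :: nat
    by (induction m) (simp_all add: zero lin)
  have right: "B e (\<lambda>s. \<Sum>j<n. v j * d j s) = (\<Sum>j<n. v j * B e (d j))" for e
  proof -
    have "B e (\<lambda>s. \<Sum>j<n. v j * d j s) = B (\<lambda>s. \<Sum>j<n. v j * d j s) e" by (rule sym)
    also have "\<dots> = (\<Sum>j<n. v j * B (d j) e)" by (rule left)
    also have "\<dots> = (\<Sum>j<n. v j * B e (d j))" by (intro sum.cong refl arg_cong2[of _ _ _ _ "(*)"] sym)
    finally show ?thesis .
  qed
  show ?thesis unfolding right unfolding left by (subst sum.swap) (simp add: sum_distrib_left mult_ac)
qed

context comparable_weights
begin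

text \<open>Gram-Schmidt makes the first form the identity, and an orthogonal change of basis then
  diagonalises the second without disturbing the first. The coefficients \<open>\<beta>\<close>
  recover every field value from the new coordinates up to a vector that is null for
  \<open>w0\<close>.\<close>

lemma simultaneous_diagonalization:
  assumes T: "finite T" "T \<subseteq> cball 0 \<rho>"
  obtains m :: nat and c \<beta> and \<sigma> :: "nat \<Rightarrow> real" where
    "\<And>u. sq_int w0 T (\<lambda>t. \<Sum>i<m. u i * c i t) = (\<Sum>i<m. (u i)\<^sup>2)"
    "\<And>u. sq_int w1 T (\<lambda>t. \<Sum>i<m. u i * c i t) = (\<Sum>i<m. \<sigma> i * (u i)\<^sup>2)"
    "\<And>t. t \<in> T \<Longrightarrow> sq_int w0 T (\<lambda>s. (if s = t then 1 else 0) - (\<Sum>i<m. \<beta> t i * c i s)) = 0"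
proof -
  obtain B0 where B0: "\<And>c a d e. B0 (\<lambda>s. c s + a * d s) e = B0 c e + a * B0 d e" "\<And>c d. B0 c d = B0 d c" "\<And>c. B0 c c = sq_int w0 T c"
    using sq_int_bilinear[OF w_meas(1) w_nonneg(1) sq_integrable(1)[OF T(1)]] by blast
  obtain B1 where B1: "\<And>c a d e. B1 (\<lambda>s. c s + a * d s) e = B1 c e + a * B1 d e" "\<And>c d. B1 c d = B1 d c" "\<And>c. B1 c c = sq_int w1 T c"
    using sq_int_bilinear[OF w_meas(2) w_nonneg(2) sq_integrable(2)[OF T(1)]] by blast
  have B00: "B0 c c \<ge> 0" for c unfolding B0(3) by (rule sq_int_nonneg)
  obtain m :: nat and b \<gamma> where b: "\<And>i j. i < m \<Longrightarrow> j < m \<Longrightarrow> B0 (b i) (b j) = (if i = j then 1 else 0)"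
    and \<gamma>: "\<And>t. t \<in> T \<Longrightarrow> B0 (\<lambda>s. (if s = t then 1 else 0) - (\<Sum>i<m. \<gamma> t i * b i s))
                     (\<lambda>s. (if s = t then 1 else 0) - (\<Sum>i<m. \<gamma> t i * b i s)) = 0"
  proof (rule gram_schmidt_form[where B=B0 and T=T, OF B0(1,2) B00 T(1)], goal_cases)
    case (1 m b \<beta>)
    from 1(2,3) show ?case by (rule that)
  qed
  obtain U where U: "\<And>i j. i < m \<Longrightarrow> j < m \<Longrightarrow> (\<Sum>k<m. U i k * U j k) = (if i = j then 1 else 0)"
    "\<And>k l. k < m \<Longrightarrow> l < m \<Longrightarrow> (\<Sum>i<m. U i k * U i l) = (if k = l then 1 else 0)"
    "\<And>i j. i < m \<Longrightarrow> j < m \<Longrightarrow> i \<noteq> j \<Longrightarrow> (\<Sum>k<m. \<Sum>l<m. U i k * B1 (b k) (b l) * U j l) = 0"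
  proof (rule symmetric_diagonalization[of "\<lambda>k l. B1 (b k) (b l)" m], goal_cases)
    case 1
    show ?case by (rule B1(2))
  next
    case (2 U)
    from 2(2,3,4) show ?case by (rule that)
  qed
  define c where "c = (\<lambda>i s. \<Sum>k<m. U i k * b k s)"
  have c0: "B0 (c i) (c j) = (if i = j then 1 else 0)" if "i < m" "j < m" for i j
  proof -
    have "B0 (c i) (c j) = (\<Sum>k<m. \<Sum>l<m. U i k * B0 (b k) (b l) * U j l)"
      unfolding c_def by (rule bilinear_sum[where B=B0, OF B0(1,2)])
    also have "\<dots> = (\<Sum>k<m. \<Sum>l<m. if k = l then U i k * U j k else 0)"
      using b by (intro sum.cong) auto
    also have "\<dots> = (\<Sum>k<m. U i k * U j k)" by simp
    finally show ?thesis using U(1)[OF that] by simp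
  qed
  have c1: "B1 (c i) (c j) = 0" if "i < m" "j < m" "i \<noteq> j" for i j
    unfolding c_def using bilinear_sum[where B=B1 and m=m and u="U i" and b=b and n=m and v="U j" and d=b, OF B1(1,2)] U(3)[OF that] by simp
  \<comment> \<open>Coordinates are rotated together with the basis, so each combination, and with
    it the null residual, stays the same.\<close>
  define \<beta> where "\<beta> = (\<lambda>t i. \<Sum>k<m. \<gamma> t k * U i k)"
  have "(\<Sum>i<m. \<beta> t i * c i s) = (\<Sum>k<m. \<gamma> t k * b k s)" for t s
  proof -
    have "(\<Sum>i<m. \<beta> t i * c i s) = (\<Sum>i<m. \<Sum>k<m. \<Sum>l<m. \<gamma> t k * b l s * (U i k * U i l))"
      unfolding \<beta>_def c_def sum_product by (intro sum.cong refl) (simp add: mult_ac)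
    also have "\<dots> = (\<Sum>k<m. \<Sum>l<m. \<gamma> t k * b l s * (\<Sum>i<m. U i k * U i l))"
      unfolding sum_distrib_left by (rule trans[OF sum.swap]) (intro sum.cong refl sum.swap)
    also have "\<dots> = (\<Sum>k<m. \<Sum>l<m. if k = l then \<gamma> t k * b k s else 0)"
      using U(2) by (intro sum.cong) auto
    finally show ?thesis by simp
  qed
  note \<beta>c = this
  show thesis
  proof (rule that[where m=m and c=c and \<sigma>="\<lambda>i. B1 (c i) (c i)" and \<beta>=\<beta>])
    fix u
    have "sq_int w0 T (\<lambda>t. \<Sum>i<m. u i * c i t) = (\<Sum>i<m. \<Sum>j<m. u i * B0 (c i) (c j) * u j)"
      unfolding B0(3)[symmetric] by (rule bilinear_sum[where B=B0, OF B0(1,2)])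
    also have "\<dots> = (\<Sum>i<m. \<Sum>j<m. if i = j then (u i)\<^sup>2 else 0)"
      using c0 by (intro sum.cong) (auto simp: power2_eq_square)
    finally show "sq_int w0 T (\<lambda>t. \<Sum>i<m. u i * c i t) = (\<Sum>i<m. (u i)\<^sup>2)" by simp
    have "sq_int w1 T (\<lambda>t. \<Sum>i<m. u i * c i t) = (\<Sum>i<m. \<Sum>j<m. u i * B1 (c i) (c j) * u j)"
      unfolding B1(3)[symmetric] by (rule bilinear_sum[where B=B1, OF B1(1,2)])
    also have "\<dots> = (\<Sum>i<m. \<Sum>j<m. if i = j then B1 (c i) (c i) * (u i)\<^sup>2 else 0)"
      using c1 by (intro sum.cong) (auto simp: power2_eq_square)
    finally show "sq_int w1 T (\<lambda>t. \<Sum>i<m. u i * c i t) = (\<Sum>i<m. B1 (c i) (c i) * (u i)\<^sup>2)" by simp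
  next
    fix t assume "t \<in> T"
    thus "sq_int w0 T (\<lambda>s. (if s = t then 1 else 0) - (\<Sum>i<m. \<beta> t i * c i s)) = 0"
      using \<gamma> unfolding \<beta>c B0(3) by blast
  qed
qed

end

text \<open>The combinations \<open>Y i\<close> of field values have the characteristic function of
  independent normal variables, and each \<open>X t\<close> is almost surely a combination of them
  because the residual has variance 0. The transformed event depends on \<open>\<beta>\<close> and
  \<open>B\<close> only, so two fields with the same representation are compared on the same
  set.\<close>

lemma gaussian_field_coordinates_law:
  assumes X: "centered_gaussian_field M X" and T: "finite T"
    and sq: "\<And>c. (LINT w|M. (\<Sum>t\<in>T. c t * X t w)\<^sup>2) = Q c"
    and \<tau>: "\<And>i. \<tau> i > 0" and diag: "\<And>u. Q (\<lambda>t. \<Sum>i<m. u i * c i t) = (\<Sum>i<m. (\<tau> i)\<^sup>2 * (u i)\<^sup>2)"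
    and rep: "\<And>t. t \<in> T \<Longrightarrow> Q (\<lambda>s. (if s = t then 1 else 0) - (\<Sum>i<(m::nat). \<beta> t i * c i s)) = 0"
    and B: "B \<in> sets (PiM T (\<lambda>_. borel))"
  shows "emeasure M {w\<in>space M. (\<lambda>t\<in>T. X t w) \<in> B}
    = emeasure (PiM {..<m} (\<lambda>i. normal_law (\<tau> i))) {y\<in>space (PiM {..<m} (\<lambda>_. borel)). (\<lambda>t\<in>T. \<Sum>i<m. \<beta> t i * y i) \<in> B}"
proof -
  have M: "prob_space M" using X by (simp add: centered_gaussian_field_def)
  then interpret prob_space M .
  have Xm [measurable]: "X t \<in> borel_measurable M" for t using X by (simp add: centered_gaussian_field_def)
  have gau: "centered_gaussian_rv M (\<lambda>w. \<Sum>t\<in>T. a t * X t w)" for a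
    using X T by (simp add: centered_gaussian_field_def)
  define Y where "Y = (\<lambda>i w. \<Sum>t\<in>T. c i t * X t w)"
  have Ym [measurable]: "Y i \<in> borel_measurable M" for i unfolding Y_def by measurable
  have comb: "(\<Sum>i<m. u i * Y i w) = (\<Sum>t\<in>T. (\<Sum>i<m. u i * c i t) * X t w)" for u w
    unfolding Y_def sum_distrib_left sum_distrib_right by (subst sum.swap) (simp add: mult.assoc)
  have law: "distr M (PiM {..<m} (\<lambda>_. borel)) (\<lambda>w. \<lambda>i\<in>{..<m}. Y i w) = PiM {..<m} (\<lambda>i. normal_law (\<tau> i))"
  proof (rule product_law_from_char[OF _ real_distribution_normal_law[OF \<tau>] M Ym])
    fix u
    have "(CLINT w|M. iexp (\<Sum>i\<in>{..<m}. u i * Y i w)) = exp (- complex_of_real (\<Sum>i<m. (\<tau> i)\<^sup>2 * (u i)\<^sup>2) / 2)"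
      unfolding comb centered_gaussian_rv_char(2)[OF M gau] sq diag ..
    also have "\<dots> = (\<Prod>i<m. exp (- complex_of_real ((u i * \<tau> i)\<^sup>2) / 2))"
      by (simp add: exp_sum[symmetric] sum_negf sum_divide_distrib power_mult_distrib mult.commute)
    also have "\<dots> = (\<Prod>i<m. char (normal_law (\<tau> i)) (u i))" by (simp add: char_normal_law[OF \<tau>])
    finally show "(CLINT w|M. iexp (\<Sum>i\<in>{..<m}. u i * Y i w)) = (\<Prod>i\<in>{..<m}. char (normal_law (\<tau> i)) (u i))" .
  qed simp
  \<comment> \<open>The integral of the squared residual vanishes, so the residual vanishes almost
    surely.\<close>
  have AEt: "AE w in M. X t w = (\<Sum>i<m. \<beta> t i * Y i w)" if t: "t \<in> T" for t
  proof -
    define a where "a = (\<lambda>s. (if s = t then 1 else 0) - (\<Sum>i<m. \<beta> t i * c i s))"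
    have eq: "(\<Sum>s\<in>T. a s * X s w) = X t w - (\<Sum>i<m. \<beta> t i * Y i w)" for w
    proof -
      have "(\<Sum>s\<in>T. a s * X s w) = (\<Sum>s\<in>T. (if s = t then 1 else 0) * X s w) - (\<Sum>s\<in>T. (\<Sum>i<m. \<beta> t i * c i s) * X s w)"
        unfolding a_def left_diff_distrib sum_subtractf ..
      moreover have "(\<Sum>s\<in>T. (if s = t then 1 else 0) * X s w) = X t w" using t T by (simp add: if_distrib[of "\<lambda>a. a * _"] cong: if_cong)
      ultimately show ?thesis unfolding comb by simp
    qed
    have "(LINT w|M. (\<Sum>s\<in>T. a s * X s w)\<^sup>2) = 0" unfolding sq using rep[OF t] by (simp add: a_def)
    hence "AE w in M. (\<Sum>s\<in>T. a s * X s w)\<^sup>2 = 0"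
      using integral_nonneg_eq_0_iff_AE[OF centered_gaussian_rv_char(1)[OF M gau]] by simp
    thus ?thesis unfolding eq by simp
  qed
  have AET: "AE w in M. \<forall>t\<in>T. X t w = (\<Sum>i<m. \<beta> t i * Y i w)" using AEt T by (intro AE_finite_allI) auto
  have mX: "(\<lambda>w. \<lambda>t\<in>T. X t w) \<in> measurable M (PiM T (\<lambda>_. borel))" by (intro measurable_restrict) auto
  have mL: "(\<lambda>y. \<lambda>t\<in>T. \<Sum>i<m. \<beta> t i * y i) \<in> measurable (PiM {..<m} (\<lambda>_. borel)) (PiM T (\<lambda>_. borel))"
    by (intro measurable_restrict borel_measurable_sum borel_measurable_times) (auto intro: measurable_component_singleton)
  define B' where "B' = {y\<in>space (PiM {..<m} (\<lambda>_. borel)). (\<lambda>t\<in>T. \<Sum>i<m. \<beta> t i * y i) \<in> B}"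
  have B's: "B' \<in> sets (PiM {..<m} (\<lambda>_. borel))"
    using measurable_sets[OF mL B] unfolding B'_def by (simp add: vimage_def Int_def conj_commute)
  have mY: "(\<lambda>w. \<lambda>i\<in>{..<m}. Y i w) \<in> measurable M (PiM {..<m} (\<lambda>_. borel))" by (intro measurable_restrict) auto
  have "emeasure (PiM {..<m} (\<lambda>i. normal_law (\<tau> i))) B' = emeasure M ((\<lambda>w. \<lambda>i\<in>{..<m}. Y i w) -` B' \<inter> space M)"
    unfolding law[symmetric] by (rule emeasure_distr[OF mY B's])
  also have "\<dots> = emeasure M {w\<in>space M. (\<lambda>t\<in>T. X t w) \<in> B}"
  proof (rule emeasure_eq_AE)
    show "AE w in M. w \<in> (\<lambda>w. \<lambda>i\<in>{..<m}. Y i w) -` B' \<inter> space M \<longleftrightarrow> w \<in> {w\<in>space M. (\<lambda>t\<in>T. X t w) \<in> B}"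
      using AET AE_space
    proof eventually_elim
      case (elim w)
      have "(\<lambda>t\<in>T. \<Sum>i<m. \<beta> t i * (\<lambda>i\<in>{..<m}. Y i w) i) = (\<lambda>t\<in>T. X t w)"
        using elim by (auto simp: restrict_def)
      moreover have "(\<lambda>i\<in>{..<m}. Y i w) \<in> space (PiM {..<m} (\<lambda>_. borel))" by (simp add: space_PiM)
      ultimately show ?case using elim by (auto simp: B'_def)
    qed
    show "(\<lambda>w. \<lambda>i\<in>{..<m}. Y i w) -` B' \<inter> space M \<in> sets M" by (rule measurable_sets[OF mY B's])
    show "{w\<in>space M. (\<lambda>t\<in>T. X t w) \<in> B} \<in> sets M"
      using measurable_sets[OF mX B] by (simp add: vimage_def Int_def conj_commute)
  qed
  finally show ?thesis unfolding B'_def by simp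
qed

section \<open>Equivalence of the fields\<close>

lemma emeasure_field_law_cylinder:
  assumes "\<And>t. X t \<in> borel_measurable M" "T \<subseteq> D" "B \<in> sets (PiM T (\<lambda>_. borel))"
  shows "emeasure (field_law M X D) (cylinder D T B) = emeasure M {w\<in>space M. (\<lambda>t\<in>T. X t w) \<in> B}"
proof -
  have mD: "(\<lambda>w. \<lambda>t\<in>D. X t w) \<in> measurable M (PiM D (\<lambda>_. borel))" using assms(1) by (intro measurable_restrict)
  have "restrict (\<lambda>t\<in>D. X t w) T = (\<lambda>t\<in>T. X t w)" for w
    using assms(2) by (intro ext) (auto simp: restrict_def)
  hence "(\<lambda>w. \<lambda>t\<in>D. X t w) -` cylinder D T B \<inter> space M = {w\<in>space M. (\<lambda>t\<in>T. X t w) \<in> B}"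
    by (auto simp: cylinder_def space_PiM)
  thus ?thesis unfolding field_law_def by (subst emeasure_distr[OF mD cylinder_in_sets[OF assms(2,3)]]) simp
qed

text \<open>Common coordinates turn both laws of a cylinder set into product normal laws of one set
  \<open>A\<close>, with variances in \<open>[a, b]\<close> and square sum of deviations at most
  \<open>C\<close>, where \<open>a\<close>, \<open>b\<close>, \<open>C\<close> serve all cylinders.
  Exchanging the roles of the two product laws gives the converse.\<close>

lemma (in comparable_weights) equivalent_on_gaussian_fields:
  assumes X0: "centered_gaussian_field M0 X0" and X1: "centered_gaussian_field M1 X1"
    and sq0: "\<And>T c. finite T \<Longrightarrow> (LINT w|M0. (\<Sum>t\<in>T. c t * X0 t w)\<^sup>2) = sq_int w0 T c"
    and sq1: "\<And>T c. finite T \<Longrightarrow> (LINT w|M1. (\<Sum>t\<in>T. c t * X1 t w)\<^sup>2) = sq_int w1 T c"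
    and D: "D \<subseteq> cball 0 \<rho>"
  shows "equivalent_on D M0 X0 M1 X1"
proof -
  obtain a where a: "a > 0" "\<And>T c. finite T \<Longrightarrow> T \<subseteq> cball 0 \<rho> \<Longrightarrow> a * sq_int w0 T c \<le> sq_int w1 T c"
  proof (rule sq_int_lower, goal_cases)
    case (1 a)
    from 1(2,3) show ?case by (rule that)
  qed
  obtain b where b: "b > 0" "\<And>T c. finite T \<Longrightarrow> T \<subseteq> cball 0 \<rho> \<Longrightarrow> sq_int w1 T c \<le> b * sq_int w0 T c"
  proof (rule sq_int_upper, goal_cases)
    case (1 b)
    from 1(2,3) show ?case by (rule that)
  qed
  obtain C where C: "C > 0" "\<And>T (c :: nat \<Rightarrow> 'a \<Rightarrow> real) m. finite T \<Longrightarrow> T \<subseteq> cball 0 \<rho> \<Longrightarrow>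
      (\<And>u. sq_int w0 T (\<lambda>t. \<Sum>i<m. u i * c i t) = (\<Sum>i<m. (u i)\<^sup>2)) \<Longrightarrow>
      (\<Sum>i<m. (sq_int w1 T (c i) - sq_int w0 T (c i))\<^sup>2) \<le> C"
  proof (rule hilbert_schmidt_bound, goal_cases)
    case (1 C)
    from 1(2,3) show ?case by (rule that)
  qed
  have p: "prob_space M0" "prob_space M1" and m: "\<And>t. X0 t \<in> borel_measurable M0" "\<And>t. X1 t \<in> borel_measurable M1"
    using X0 X1 by (auto simp: centered_gaussian_field_def)
  have model: "\<exists>(m::nat) \<tau> A. (\<forall>i. \<tau> i > 0) \<and> (\<forall>i<m. a \<le> (\<tau> i)\<^sup>2 \<and> (\<tau> i)\<^sup>2 \<le> b) \<and> (\<Sum>i<m. ((\<tau> i)\<^sup>2 - 1)\<^sup>2) \<le> C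
      \<and> A \<in> sets (PiM {..<m} (\<lambda>_. borel)) \<and> emeasure (field_law M0 X0 D) S = emeasure (PiM {..<m} (\<lambda>i. normal_law 1)) A
      \<and> emeasure (field_law M1 X1 D) S = emeasure (PiM {..<m} (\<lambda>i. normal_law (\<tau> i))) A"
    if S: "S \<in> cylinders D" for S
  proof -
    obtain T B where TB: "finite T" "T \<subseteq> D" "B \<in> sets (PiM T (\<lambda>_. borel))" "S = cylinder D T B"
      using S by (auto simp: cylinders_def)
    have T: "finite T" "T \<subseteq> cball 0 \<rho>" using TB D by auto
    obtain m :: nat and c \<beta> and \<sigma> :: "nat \<Rightarrow> real" where
      d0: "\<And>u. sq_int w0 T (\<lambda>t. \<Sum>i<m. u i * c i t) = (\<Sum>i<m. (u i)\<^sup>2)"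
      and d1: "\<And>u. sq_int w1 T (\<lambda>t. \<Sum>i<m. u i * c i t) = (\<Sum>i<m. \<sigma> i * (u i)\<^sup>2)"
      and rep: "\<And>t. t \<in> T \<Longrightarrow> sq_int w0 T (\<lambda>s. (if s = t then 1 else 0) - (\<Sum>i<m. \<beta> t i * c i s)) = 0"
    proof (rule simultaneous_diagonalization[OF T], goal_cases)
      case (1 m c \<sigma> \<beta>)
      from 1(2,3,4) show ?case by (rule that)
    qed
    have unit: "sq_int w0 T (c i) = 1" "sq_int w1 T (c i) = \<sigma> i" if "i < m" for i
    proof -
      define u where "u = (\<lambda>j. if j = i then 1 else 0 :: real)"
      have "(\<lambda>t. \<Sum>j<m. u j * c j t) = c i" using that by (simp add: u_def if_distrib[of "\<lambda>a. a * _"] cong: if_cong)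
      moreover have "(u j)\<^sup>2 = u j" for j by (simp add: u_def)
      moreover have "(\<Sum>j<m. u j) = 1" "(\<Sum>j<m. \<sigma> j * u j) = \<sigma> i"
        using that by (auto simp: u_def if_distrib[of "\<lambda>a. _ * a"] cong: if_cong)
      ultimately show "sq_int w0 T (c i) = 1" "sq_int w1 T (c i) = \<sigma> i" using d0[of u] d1[of u] by simp_all
    qed
    have \<sigma>: "a \<le> \<sigma> i" "\<sigma> i \<le> b" if "i < m" for i
      using a(2)[OF T, of "c i"] b(2)[OF T, of "c i"] unit[OF that] by auto
    have hs: "(\<Sum>i<m. (\<sigma> i - 1)\<^sup>2) \<le> C" using C(2)[OF T d0] unit by simp
    \<comment> \<open>Outside the index range the value 1 supplies the positivity demanded for every
      index.\<close>
    define \<tau> where "\<tau> = (\<lambda>i. if i < m then sqrt (\<sigma> i) else 1)"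
    have \<tau>0: "\<tau> i > 0" for i using \<sigma>(1)[of i] a(1) by (auto simp: \<tau>_def)
    have \<tau>2: "(\<tau> i)\<^sup>2 = \<sigma> i" if "i < m" for i using \<sigma>(1)[OF that] a(1) that by (simp add: \<tau>_def)
    define A where "A = {y\<in>space (PiM {..<m} (\<lambda>_. borel)). (\<lambda>t\<in>T. \<Sum>i<m. \<beta> t i * y i) \<in> B}"
    have "(\<lambda>y. \<lambda>t\<in>T. \<Sum>i<m. \<beta> t i * y i) \<in> measurable (PiM {..<m} (\<lambda>_. borel)) (PiM T (\<lambda>_. borel))"
      by (intro measurable_restrict borel_measurable_sum borel_measurable_times) (auto intro: measurable_component_singleton)
    from measurable_sets[OF this TB(3)] have A: "A \<in> sets (PiM {..<m} (\<lambda>_. borel))"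
      unfolding A_def by (simp add: vimage_def Int_def conj_commute)
    have "emeasure M0 {w\<in>space M0. (\<lambda>t\<in>T. X0 t w) \<in> B} = emeasure (PiM {..<m} (\<lambda>i. normal_law 1)) A"
      unfolding A_def
      by (rule gaussian_field_coordinates_law[where \<tau>="\<lambda>_. 1" and c=c and Q="sq_int w0 T", OF X0 T(1) sq0[OF T(1)] _ _ rep TB(3)])
         (simp_all add: d0)
    moreover have "emeasure M1 {w\<in>space M1. (\<lambda>t\<in>T. X1 t w) \<in> B} = emeasure (PiM {..<m} (\<lambda>i. normal_law (\<tau> i))) A"
      unfolding A_def
    proof (rule gaussian_field_coordinates_law[where \<tau>=\<tau> and c=c and Q="sq_int w1 T", OF X1 T(1) sq1[OF T(1)] \<tau>0 _ _ TB(3)])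
      show "sq_int w1 T (\<lambda>t. \<Sum>i<m. u i * c i t) = (\<Sum>i<m. (\<tau> i)\<^sup>2 * (u i)\<^sup>2)" for u
        unfolding d1 by (intro sum.cong) (auto simp: \<tau>2)
      \<comment> \<open>A residual that is null for \<open>w0\<close> is null for \<open>w1\<close>,
        because the second norm is at most \<open>b\<close> times the first.\<close>
      show "sq_int w1 T (\<lambda>s. (if s = t then 1 else 0) - (\<Sum>i<m. \<beta> t i * c i s)) = 0" if "t \<in> T" for t
        using b(2)[OF T, of "\<lambda>s. (if s = t then 1 else 0) - (\<Sum>i<m. \<beta> t i * c i s)"] rep[OF that]
          sq_int_nonneg(2)[of T "\<lambda>s. (if s = t then 1 else 0) - (\<Sum>i<m. \<beta> t i * c i s)"] by simp
    qed
    moreover have "(\<Sum>i<m. ((\<tau> i)\<^sup>2 - 1)\<^sup>2) \<le> C" using hs by (simp add: \<tau>2)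
    ultimately show ?thesis
      using \<tau>0 \<sigma> \<tau>2 A emeasure_field_law_cylinder[OF m(1) TB(2,3)] emeasure_field_law_cylinder[OF m(2) TB(2,3)]
      unfolding TB(4) by (intro exI[of _ m] exI[of _ \<tau>] exI[of _ A]) auto
  qed
  have pl: "prob_space (field_law M X D)" "sets (field_law M X D) = sets (PiM D (\<lambda>_. borel))"
    if "prob_space M" "\<And>t. X t \<in> borel_measurable M" for M :: "'m measure" and X
    unfolding field_law_def using that by (auto intro!: prob_space.prob_space_distr measurable_restrict)
  show ?thesis unfolding equivalent_on_def
  proof
    show "absolutely_continuous (field_law M0 X0 D) (field_law M1 X1 D)"
    proof (rule absolutely_continuous_from_cylinders[OF pl[OF p(1) m(1)] pl[OF p(2) m(2)]])
      fix \<epsilon> :: real assume e: "\<epsilon> > 0"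
      obtain \<delta> where \<delta>: "\<delta> > 0"
        "\<And>m (s :: nat \<Rightarrow> real) (r :: nat \<Rightarrow> real) A. (\<And>i. s i > 0) \<Longrightarrow> (\<And>i. r i > 0) \<Longrightarrow>
          (\<And>i. i < m \<Longrightarrow> a \<le> (s i)\<^sup>2 / (r i)\<^sup>2 \<and> (s i)\<^sup>2 / (r i)\<^sup>2 \<le> b) \<Longrightarrow>
          (\<Sum>i<m. ((s i)\<^sup>2 / (r i)\<^sup>2 - 1)\<^sup>2) \<le> C \<Longrightarrow> A \<in> sets (PiM {..<m} (\<lambda>_. borel)) \<Longrightarrow>
          emeasure (PiM {..<m} (\<lambda>i. normal_law (r i))) A < ennreal \<delta> \<Longrightarrow>
          emeasure (PiM {..<m} (\<lambda>i. normal_law (s i))) A < ennreal \<epsilon>"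
      proof (rule product_normal_law_uniformly_continuous[OF a(1) e, where b=b and C=C], goal_cases)
        case (1 \<delta>)
        from 1(2,3) show ?case by (rule that)
      qed
      show "\<exists>\<delta>>0. \<forall>S\<in>cylinders D. emeasure (field_law M0 X0 D) S < ennreal \<delta> \<longrightarrow> emeasure (field_law M1 X1 D) S < ennreal \<epsilon>"
      proof (intro exI[of _ \<delta>] conjI ballI impI \<delta>(1))
        fix S assume S: "S \<in> cylinders D" and lt: "emeasure (field_law M0 X0 D) S < ennreal \<delta>"
        obtain m \<tau> A where *: "\<And>i. \<tau> i > 0" "\<And>i. i < m \<Longrightarrow> a \<le> (\<tau> i)\<^sup>2 \<and> (\<tau> i)\<^sup>2 \<le> b" "(\<Sum>i<m. ((\<tau> i)\<^sup>2 - 1)\<^sup>2) \<le> C"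
          "A \<in> sets (PiM {..<m::nat} (\<lambda>_. borel))" "emeasure (field_law M0 X0 D) S = emeasure (PiM {..<m} (\<lambda>i. normal_law 1)) A"
          "emeasure (field_law M1 X1 D) S = emeasure (PiM {..<m} (\<lambda>i. normal_law (\<tau> i))) A"
          using model[OF S] by blast
        show "emeasure (field_law M1 X1 D) S < ennreal \<epsilon>"
          unfolding *(6) by (rule \<delta>(2)[of \<tau> "\<lambda>_. 1"]) (use * lt in auto)
      qed
    qed
    show "absolutely_continuous (field_law M1 X1 D) (field_law M0 X0 D)"
    proof (rule absolutely_continuous_from_cylinders[OF pl[OF p(2) m(2)] pl[OF p(1) m(1)]])
      fix \<epsilon> :: real assume e: "\<epsilon> > 0"
      \<comment> \<open>For the converse the variance ratios are inverted: they lie in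
        \<open>[1 / b, 1 / a]\<close>, and the squared deviation from 1 grows at most by the factor
        \<open>1 / a\<^sup>2\<close>.\<close>
      have b': "1 / b > 0" using b by simp
      obtain \<delta> where \<delta>: "\<delta> > 0"
        "\<And>m (s :: nat \<Rightarrow> real) (r :: nat \<Rightarrow> real) A. (\<And>i. s i > 0) \<Longrightarrow> (\<And>i. r i > 0) \<Longrightarrow>
          (\<And>i. i < m \<Longrightarrow> 1 / b \<le> (s i)\<^sup>2 / (r i)\<^sup>2 \<and> (s i)\<^sup>2 / (r i)\<^sup>2 \<le> 1 / a) \<Longrightarrow>
          (\<Sum>i<m. ((s i)\<^sup>2 / (r i)\<^sup>2 - 1)\<^sup>2) \<le> C / a\<^sup>2 \<Longrightarrow> A \<in> sets (PiM {..<m} (\<lambda>_. borel)) \<Longrightarrow>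
          emeasure (PiM {..<m} (\<lambda>i. normal_law (r i))) A < ennreal \<delta> \<Longrightarrow>
          emeasure (PiM {..<m} (\<lambda>i. normal_law (s i))) A < ennreal \<epsilon>"
      proof (rule product_normal_law_uniformly_continuous[OF b' e, where b="1 / a" and C="C / a\<^sup>2"], goal_cases)
        case (1 \<delta>)
        from 1(2,3) show ?case by (rule that)
      qed
      show "\<exists>\<delta>>0. \<forall>S\<in>cylinders D. emeasure (field_law M1 X1 D) S < ennreal \<delta> \<longrightarrow> emeasure (field_law M0 X0 D) S < ennreal \<epsilon>"
      proof (intro exI[of _ \<delta>] conjI ballI impI \<delta>(1))
        fix S assume S: "S \<in> cylinders D" and lt: "emeasure (field_law M1 X1 D) S < ennreal \<delta>"
        obtain m \<tau> A where *: "\<And>i. \<tau> i > 0" "\<And>i. i < m \<Longrightarrow> a \<le> (\<tau> i)\<^sup>2 \<and> (\<tau> i)\<^sup>2 \<le> b" "(\<Sum>i<m. ((\<tau> i)\<^sup>2 - 1)\<^sup>2) \<le> C"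
          "A \<in> sets (PiM {..<m::nat} (\<lambda>_. borel))" "emeasure (field_law M0 X0 D) S = emeasure (PiM {..<m} (\<lambda>i. normal_law 1)) A"
          "emeasure (field_law M1 X1 D) S = emeasure (PiM {..<m} (\<lambda>i. normal_law (\<tau> i))) A"
          using model[OF S] by blast
        show "emeasure (field_law M0 X0 D) S < ennreal \<epsilon>"
          unfolding *(5)
        proof (rule \<delta>(2)[of "\<lambda>_. 1" \<tau>])
          show "1 / b \<le> 1\<^sup>2 / (\<tau> i)\<^sup>2 \<and> 1\<^sup>2 / (\<tau> i)\<^sup>2 \<le> 1 / a" if "i < m" for i
            using *(2)[OF that] a(1) by (auto intro!: divide_left_mono mult_pos_pos)
          have "(1\<^sup>2 / (\<tau> i)\<^sup>2 - 1)\<^sup>2 \<le> ((\<tau> i)\<^sup>2 - 1)\<^sup>2 / a\<^sup>2" if "i < m" for i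
          proof -
            have t: "(\<tau> i)\<^sup>2 > 0" "a \<le> (\<tau> i)\<^sup>2" using *(1)[of i] *(2)[OF that] by auto
            have "1\<^sup>2 / (\<tau> i)\<^sup>2 - 1 = - (((\<tau> i)\<^sup>2 - 1) / (\<tau> i)\<^sup>2)" using t(1) by (simp add: diff_divide_distrib)
            hence "(1\<^sup>2 / (\<tau> i)\<^sup>2 - 1)\<^sup>2 = ((\<tau> i)\<^sup>2 - 1)\<^sup>2 / ((\<tau> i)\<^sup>2)\<^sup>2" by (simp only: power2_minus power_divide)
            also have "\<dots> \<le> ((\<tau> i)\<^sup>2 - 1)\<^sup>2 / a\<^sup>2"
              using t a(1) *(1)[of i] by (intro divide_left_mono power_mono mult_pos_pos zero_less_power) auto
            finally show ?thesis .
          qed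
          hence "(\<Sum>i<m. (1\<^sup>2 / (\<tau> i)\<^sup>2 - 1)\<^sup>2) \<le> (\<Sum>i<m. ((\<tau> i)\<^sup>2 - 1)\<^sup>2 / a\<^sup>2)" by (intro sum_mono) auto
          also have "\<dots> = (\<Sum>i<m. ((\<tau> i)\<^sup>2 - 1)\<^sup>2) / a\<^sup>2" by (rule sum_divide_distrib[symmetric])
          also have "\<dots> \<le> C / a\<^sup>2" using *(3) by (intro divide_right_mono) auto
          finally show "(\<Sum>i<m. (1\<^sup>2 / (\<tau> i)\<^sup>2 - 1)\<^sup>2) \<le> C / a\<^sup>2" .
        qed (use * lt in auto)
      qed
    qed
  qed
qed

section \<open>From spectral measures and entire functions to weights and complex lines\<close>

text \<open>The spectral measure lives on the punctured space; extending its density by 0 at the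
  origin moves all integrals to Lebesgue measure on the whole space. Expanding the squared modulus
  of the polynomial and inserting the covariance formula gives the isometry between linear
  functionals and polynomials.\<close>

lemma spectral_weight:
  fixes F :: "(real ^ 'n) measure" and f :: "real ^ 'n \<Rightarrow> real"
  assumes F: "spectral_measure F" and f: "spectral_density F f" and X: "stationary_increments_GRF M X F"
    and w_def: "w = (\<lambda>x. indicator (- {0}) x * f x)"
  shows "w \<in> borel_measurable borel"
    and "finite T \<Longrightarrow> integrable lborel (\<lambda>x. (norm (trig_poly T c x))\<^sup>2 * w x)"
    and "finite T \<Longrightarrow> (LINT v|M. (\<Sum>t\<in>T. c t * X t v)\<^sup>2) = sq_int w T c"
    and "integrable lborel (\<lambda>x. (norm x)\<^sup>2 / (1 + (norm x)\<^sup>2) * w x)"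
proof -
  let ?R = "restrict_space lborel (- {0 :: real ^ 'n})"
  have fm: "f \<in> borel_measurable (restrict_space borel (- {0}))" and f0: "\<And>x. x \<noteq> 0 \<Longrightarrow> 0 \<le> f x"
    and Fd: "F = density ?R (\<lambda>x. ennreal (f x))" using f by (auto simp: spectral_density_def)
  have sR: "sets ?R = sets (restrict_space borel (- {0}))" by (rule sets_restrict_space_cong) simp
  have fmR [measurable]: "f \<in> borel_measurable ?R" using fm by (simp cong: measurable_cong_sets add: sR)
  show "w \<in> borel_measurable borel"
    using fm borel_measurable_restrict_space_iff[of "- {0}" borel f] by (simp add: w_def)
  have f0R: "AE x in ?R. 0 \<le> f x" using f0 by (intro AE_I2) (simp add: space_restrict_space)
  have gR: "g \<in> borel_measurable ?R" if "g \<in> borel_measurable borel" for g :: "real ^ 'n \<Rightarrow> real"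
    using that by (intro measurable_restrict_space1) simp
  have gF: "g \<in> borel_measurable F" if "g \<in> borel_measurable borel" for g :: "real ^ 'n \<Rightarrow> 'b::topological_space"
    unfolding Fd using that by (simp add: measurable_restrict_space1)
  have intF: "integrable F g \<longleftrightarrow> integrable lborel (\<lambda>x. g x * w x)" if "g \<in> borel_measurable borel" for g :: "real ^ 'n \<Rightarrow> real"
    unfolding Fd integrable_real_density[OF fmR f0R gR[OF that]]
    by (subst integrable_restrict_space) (auto simp: w_def mult_ac)
  have lintF: "(LINT x|F. g x) = (LINT x|lborel. g x * w x)" if "g \<in> borel_measurable borel" for g :: "real ^ 'n \<Rightarrow> real"
    unfolding Fd integral_real_density[OF fmR f0R gR[OF that]]
    by (subst integral_restrict_space) (auto simp: w_def mult_ac)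
  have base: "integrable F (\<lambda>x. (norm x)\<^sup>2 / (1 + (norm x)\<^sup>2))"
    using F by (intro integrableI_nonneg gF) (auto simp: spectral_measure_def)
  thus "integrable lborel (\<lambda>x. (norm x)\<^sup>2 / (1 + (norm x)\<^sup>2) * w x)" by (subst intF[symmetric]) measurable
  define e where "e = (\<lambda>t x :: real ^ 'n. exp (\<i> * complex_of_real (t \<bullet> x)) - 1)"
  have em [measurable]: "e t \<in> borel_measurable borel" for t
    unfolding e_def by (intro borel_measurable_continuous_onI continuous_intros)
  \<comment> \<open>The quotient on the right is at least 1/2 for \<open>norm x \<ge> 1\<close>,
    where \<open>8 * (1/2)\<close> covers the bound 4 of the left side, and at least
    \<open>(norm x)\<^sup>2 / 2\<close> otherwise, where \<open>2 * (norm t)\<^sup>2\<close> covers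
    the linear bound.\<close>
  have e_le: "(norm (e t x))\<^sup>2 \<le> (8 + 2 * (norm t)\<^sup>2) * ((norm x)\<^sup>2 / (1 + (norm x)\<^sup>2))" for t x
  proof (cases "norm x \<ge> 1")
    case True
    have "norm (e t x) \<le> 2" unfolding e_def
      using norm_triangle_ineq4[of "exp (\<i> * complex_of_real (t \<bullet> x))" 1] by simp
    hence "(norm (e t x))\<^sup>2 \<le> 2\<^sup>2" by (intro power_mono) auto
    moreover have "1 / 2 \<le> (norm x)\<^sup>2 / (1 + (norm x)\<^sup>2)"
      using one_le_power[OF True, of 2] by (simp add: field_simps add_pos_nonneg)
    hence "8 * (1 / 2) \<le> (8 + 2 * (norm t)\<^sup>2) * ((norm x)\<^sup>2 / (1 + (norm x)\<^sup>2))" by (intro mult_mono) auto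
    ultimately show ?thesis by simp
  next
    case False
    have "norm (e t x) \<le> \<bar>t \<bullet> x\<bar>" using iexp_approx1[of "t \<bullet> x" 0] by (simp add: e_def)
    also have "\<dots> \<le> norm t * norm x" by (rule Cauchy_Schwarz_ineq2)
    finally have "(norm (e t x))\<^sup>2 \<le> (norm t * norm x)\<^sup>2" by (intro power_mono) auto
    also have "\<dots> = 2 * (norm t)\<^sup>2 * ((norm x)\<^sup>2 / 2)" by (simp add: power_mult_distrib)
    also have "\<dots> \<le> (8 + 2 * (norm t)\<^sup>2) * ((norm x)\<^sup>2 / (1 + (norm x)\<^sup>2))"
    proof (intro mult_mono divide_left_mono)
      show "1 + (norm x)\<^sup>2 \<le> 2" using False power_le_one[of "norm x" 2] by simp
    qed (auto intro!: mult_pos_pos add_pos_nonneg)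
    finally show ?thesis .
  qed
  have ei: "integrable F (\<lambda>x. e t x * cnj (e s x))" for t s
  proof (rule Bochner_Integration.integrable_bound)
    show "integrable F (\<lambda>x. ((8 + 2 * (norm t)\<^sup>2) + (8 + 2 * (norm s)\<^sup>2)) * ((norm x)\<^sup>2 / (1 + (norm x)\<^sup>2)))"
      using base by (rule integrable_mult_right)
    show "(\<lambda>x. e t x * cnj (e s x)) \<in> borel_measurable F"
      unfolding e_def by (intro gF borel_measurable_continuous_onI continuous_intros)
    show "AE x in F. norm (e t x * cnj (e s x)) \<le> norm (((8 + 2 * (norm t)\<^sup>2) + (8 + 2 * (norm s)\<^sup>2)) * ((norm x)\<^sup>2 / (1 + (norm x)\<^sup>2)))"
    proof (rule AE_I2)
      fix x
      have "norm (e t x * cnj (e s x)) \<le> (norm (e t x))\<^sup>2 + (norm (e s x))\<^sup>2"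
        using sum_squares_bound[of "norm (e t x)" "norm (e s x)"] mult_nonneg_nonneg[OF norm_ge_zero[of "e t x"] norm_ge_zero[of "e s x"]]
        unfolding norm_mult complex_mod_cnj by linarith
      also have "\<dots> \<le> ((8 + 2 * (norm t)\<^sup>2) + (8 + 2 * (norm s)\<^sup>2)) * ((norm x)\<^sup>2 / (1 + (norm x)\<^sup>2))"
        using e_le[of t x] e_le[of s x] unfolding distrib_right by linarith
      finally show "norm (e t x * cnj (e s x)) \<le> norm (((8 + 2 * (norm t)\<^sup>2) + (8 + 2 * (norm s)\<^sup>2)) * ((norm x)\<^sup>2 / (1 + (norm x)\<^sup>2)))"
        by simp
    qed
  qed
  have tp_e: "trig_poly T c x = (\<Sum>t\<in>T. of_real (c t) * e t x)" for T c x by (simp add: trig_poly_def e_def)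
  have tp_sq: "complex_of_real ((norm (trig_poly T c x))\<^sup>2) = (\<Sum>t\<in>T. \<Sum>s\<in>T. of_real (c t * c s) * (e t x * cnj (e s x)))" for T c x
    unfolding complex_norm_square tp_e cnj_sum sum_product by (simp add: mult_ac)
  have tpi: "complex_integrable F (\<lambda>x. complex_of_real ((norm (trig_poly T c x))\<^sup>2))" for T c
    unfolding tp_sq using ei by (intro Bochner_Integration.integrable_sum integrable_mult_right)
  hence tpir: "integrable F (\<lambda>x. (norm (trig_poly T c x))\<^sup>2)" for T c by (simp only: complex_of_real_integrable_eq)
  thus "integrable lborel (\<lambda>x. (norm (trig_poly T c x))\<^sup>2 * w x)" by (subst intF[symmetric]) measurable
  assume T: "finite T"
  have gauss: "centered_gaussian_field M X" and cov: "\<And>t s. complex_of_real (LINT v|M. X t v * X s v) = (LINT x|F. e t x * cnj (e s x))"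
    using X by (auto simp: stationary_increments_GRF_def e_def exp_cnj)
  have M: "prob_space M" and Xm [measurable]: "\<And>t. X t \<in> borel_measurable M"
    and grv: "\<And>T a. finite T \<Longrightarrow> centered_gaussian_rv M (\<lambda>v. \<Sum>t\<in>T. a t * X t v)"
    using gauss by (auto simp: centered_gaussian_field_def)
  have Xi2: "integrable M (\<lambda>v. (X t v)\<^sup>2)" for t
    using centered_gaussian_rv_char(1)[OF M grv[of "{t}" "\<lambda>_. 1"]] by simp
  have Xi: "integrable M (\<lambda>v. X t v * X s v)" for t s
  proof (rule Bochner_Integration.integrable_bound[OF Bochner_Integration.integrable_add[OF Xi2[of t] Xi2[of s]]])
    show "AE v in M. norm (X t v * X s v) \<le> norm ((X t v)\<^sup>2 + (X s v)\<^sup>2)"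
    proof (rule AE_I2)
      fix v
      have "2 * (\<bar>X t v\<bar> * \<bar>X s v\<bar>) \<le> (X t v)\<^sup>2 + (X s v)\<^sup>2"
        using sum_squares_bound[of "\<bar>X t v\<bar>" "\<bar>X s v\<bar>"] by simp
      moreover have "0 \<le> \<bar>X t v\<bar> * \<bar>X s v\<bar>" by simp
      ultimately have "\<bar>X t v\<bar> * \<bar>X s v\<bar> \<le> (X t v)\<^sup>2 + (X s v)\<^sup>2" by linarith
      thus "norm (X t v * X s v) \<le> norm ((X t v)\<^sup>2 + (X s v)\<^sup>2)" by (simp add: abs_mult)
    qed
  qed measurable
  have "(LINT v|M. (\<Sum>t\<in>T. c t * X t v)\<^sup>2) = (LINT v|M. (\<Sum>t\<in>T. \<Sum>s\<in>T. (c t * c s) * (X t v * X s v)))"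
    unfolding power2_eq_square sum_product by (simp add: mult_ac)
  also have "\<dots> = (\<Sum>t\<in>T. \<Sum>s\<in>T. (c t * c s) * (LINT v|M. X t v * X s v))"
    using Xi by (simp add: Bochner_Integration.integral_sum)
  finally have "complex_of_real (LINT v|M. (\<Sum>t\<in>T. c t * X t v)\<^sup>2) = (\<Sum>t\<in>T. \<Sum>s\<in>T. of_real (c t * c s) * (LINT x|F. e t x * cnj (e s x)))"
    by (simp add: cov)
  also have "\<dots> = (CLINT x|F. complex_of_real ((norm (trig_poly T c x))\<^sup>2))"
    unfolding tp_sq using ei by (simp add: Bochner_Integration.integral_sum)
  also have "\<dots> = complex_of_real (LINT x|F. (norm (trig_poly T c x))\<^sup>2)" by (rule integral_complex_of_real)
  finally have "(LINT v|M. (\<Sum>t\<in>T. c t * X t v)\<^sup>2) = (LINT x|F. (norm (trig_poly T c x))\<^sup>2)" by (simp only: of_real_eq_iff)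
  thus "(LINT v|M. (\<Sum>t\<in>T. c t * X t v)\<^sup>2) = sq_int w T c"
    unfolding sq_int_def by (subst lintF[symmetric]) measurable
qed

lemma entire_continuous:
  assumes "entire \<phi>" shows "continuous_on X \<phi>"
proof (rule continuous_at_imp_continuous_on, rule ballI)
  fix z
  obtain L where "(\<phi> has_derivative L) (at z)" using assms unfolding entire_def by blast
  thus "isCont \<phi> z" by (rule has_derivative_continuous)
qed

text \<open>Beyond some radius the limit superior bounds the logarithm on each sphere; on the
  remaining compact ball continuity gives a constant.\<close>

lemma finite_exponential_type_bound:
  fixes \<phi> :: "complex ^ 'n \<Rightarrow> complex"
  assumes ent: "entire \<phi>" and type: "finite_exponential_type \<phi>"
  obtains A \<tau> where "\<tau> \<ge> 0" "\<And>z. norm (\<phi> z) \<le> A * exp (\<tau> * norm z)"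
proof -
  note cont = entire_continuous[OF ent]
  \<comment> \<open>A natural number above the limit superior gives a nonnegative type even if the
    limit superior is negative or \<open>-\<infinity>\<close>.\<close>
  obtain n :: nat where n: "Limsup at_top (\<lambda>r::real. ereal (1 / r) * (SUP z\<in>sphere 0 r. log_norm (\<phi> z))) < ereal (real n)"
    using type less_PInf_Ex_of_nat unfolding finite_exponential_type_def by auto
  have "eventually (\<lambda>r::real. ereal (1 / r) * (SUP z\<in>sphere 0 r. log_norm (\<phi> z)) < ereal (real n)) at_top"
    by (rule Limsup_lessD[OF n])
  then obtain R0 where R0: "\<And>r. r \<ge> R0 \<Longrightarrow> ereal (1 / r) * (SUP z\<in>sphere 0 r. log_norm (\<phi> z)) < ereal (real n)"
    by (auto simp: eventually_at_top_linorder)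
  define R where "R = max R0 1"
  have far: "norm (\<phi> z) \<le> exp (real n * norm z)" if z: "norm z \<ge> R" for z
  proof (cases "\<phi> z = 0")
    case False
    have r: "norm z > 0" "norm z \<ge> R0" using z by (auto simp: R_def)
    have "log_norm (\<phi> z) \<le> (SUP z\<in>sphere 0 (norm z). log_norm (\<phi> z))" by (rule SUP_upper) simp
    hence "ereal (1 / norm z) * log_norm (\<phi> z) \<le> ereal (1 / norm z) * (SUP z\<in>sphere 0 (norm z). log_norm (\<phi> z))"
      by (intro ereal_mult_left_mono) auto
    also have "\<dots> < ereal (real n)" by (rule R0[OF r(2)])
    finally have "ln (norm (\<phi> z)) / norm z < real n" using False by (simp add: log_norm_def)
    hence "ln (norm (\<phi> z)) \<le> real n * norm z" using r by (simp add: divide_less_eq)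
    thus ?thesis using False by (metis exp_le_cancel_iff exp_ln zero_less_norm_iff)
  qed simp
  have "bounded (\<phi> ` cball 0 R)" by (intro compact_imp_bounded compact_continuous_image cont) auto
  then obtain L where "\<forall>y\<in>\<phi> ` cball 0 R. norm y \<le> L" unfolding bounded_iff by blast
  hence L: "norm (\<phi> z) \<le> L" if "norm z \<le> R" for z using that by auto
  show thesis
  proof (rule that[of "real n" "max L 1"])
    fix z :: "complex ^ 'n"
    have e1: "exp (real n * norm z) \<ge> 1" by simp
    show "norm (\<phi> z) \<le> max L 1 * exp (real n * norm z)"
    proof (cases "norm z \<le> R")
      case True
      have "norm (\<phi> z) \<le> max L 1 * 1" using L[OF True] by simp
      also have "\<dots> \<le> max L 1 * exp (real n * norm z)" using e1 by (intro mult_left_mono) auto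
      finally show ?thesis .
    next
      case False
      have "norm (\<phi> z) \<le> 1 * exp (real n * norm z)" using far[of z] False by simp
      also have "\<dots> \<le> max L 1 * exp (real n * norm z)" by (intro mult_right_mono) auto
      finally show ?thesis .
    qed
  qed simp
qed

definition complex_line :: "(complex ^ 'n \<Rightarrow> complex) \<Rightarrow> real ^ 'n \<Rightarrow> complex \<Rightarrow> real ^ 'n \<Rightarrow> complex" where
  "complex_line \<phi> x u v = \<phi> (of_real_vec x + u *s of_real_vec v)"

lemma norm_of_real_vec: "norm (of_real_vec x) = norm x"
  by (simp add: norm_vec_def of_real_vec_def)

lemma norm_vector_scalar_mult_complex: "norm (u *s (v :: complex ^ 'n)) = norm u * norm v"
  by (simp add: norm_vec_def norm_mult L2_set_right_distrib)

lemma complex_line_of_real: "complex_line \<phi> x (of_real r) v = \<phi> (of_real_vec (x + r *\<^sub>R v))"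
proof -
  have "of_real_vec x + of_real r *s of_real_vec v = of_real_vec (x + r *\<^sub>R v)"
    by (simp add: vec_eq_iff of_real_vec_def)
  thus ?thesis by (simp add: complex_line_def)
qed

text \<open>By the chain rule the derivative is \<open>L (h *s v) = h * L v\<close>: complex
  linearity of the Frechet derivative turns it into a complex derivative in one variable.\<close>

lemma holomorphic_complex_line:
  assumes "entire \<phi>" shows "(\<lambda>u. complex_line \<phi> x u v) holomorphic_on UNIV"
  unfolding holomorphic_on_def
proof
  fix u
  obtain L where L: "(\<phi> has_derivative L) (at (of_real_vec x + u *s of_real_vec v))" "\<And>c v. L (c *s v) = c * L v"
    using assms unfolding entire_def by blast
  have "bounded_linear (\<lambda>h :: complex. h *s of_real_vec v)"
    by (rule linear_conv_bounded_linear[THEN iffD1]) (auto intro!: linearI simp: vec_eq_iff distrib_right)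
  hence "((\<lambda>h. h *s of_real_vec v) has_derivative (\<lambda>h. h *s of_real_vec v)) (at u)"
    by (rule bounded_linear_imp_has_derivative)
  hence "((\<lambda>u. of_real_vec x + u *s of_real_vec v) has_derivative (\<lambda>h. h *s of_real_vec v)) (at u)"
    using has_derivative_add[OF has_derivative_const] by fastforce
  from has_derivative_compose[OF this L(1)]
  have "((\<lambda>u. complex_line \<phi> x u v) has_derivative (\<lambda>h. L (of_real_vec v) * h)) (at u)"
    unfolding complex_line_def L(2) by (simp add: mult.commute)
  thus "(\<lambda>u. complex_line \<phi> x u v) field_differentiable at u within UNIV"
    unfolding field_differentiable_def has_field_derivative_def by auto
qed

lemma continuous_complex_line:
  fixes \<phi> :: "complex ^ 'n \<Rightarrow> complex"
  assumes "entire \<phi>" shows "continuous_on UNIV (\<lambda>(u, v). complex_line \<phi> x u v)"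
proof -
  note cont = entire_continuous[OF assms]
  have "continuous_on UNIV (\<lambda>p. of_real_vec x + fst p *s of_real_vec (snd p) :: complex ^ 'n)"
  proof -
    have "of_real_vec x + fst p *s of_real_vec (snd p) = (\<chi> i. complex_of_real (vec_nth x i) + fst p * complex_of_real (vec_nth (snd p) i))"
      for p :: "complex \<times> (real ^ 'n)"
      by (simp add: vec_eq_iff of_real_vec_def)
    thus ?thesis
      by (simp only:) (intro continuous_on_vec_lambda continuous_on_add continuous_on_mult continuous_on_const
        continuous_on_of_real continuous_on_fst continuous_on_snd continuous_on_component continuous_on_id)
  qed
  from continuous_on_compose2[OF cont[of UNIV] this] show ?thesis by (simp add: complex_line_def case_prod_unfold)
qed

theorem theorem3p6:
  fixes F0 F1 :: "(real ^ 'n) measure"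
    and f0 f1 :: "real ^ 'n \<Rightarrow> real"
    and M0 :: "'v measure" and X0 :: "real ^ 'n \<Rightarrow> 'v \<Rightarrow> real"
    and M1 :: "'w measure" and X1 :: "real ^ 'n \<Rightarrow> 'w \<Rightarrow> real"
  assumes "spectral_measure F0" and "spectral_measure F1"
    and "spectral_density F0 f0" and "spectral_density F1 f1"
    and "\<And>x. x \<noteq> 0 \<Longrightarrow> f0 x > 0" and "\<And>x. x \<noteq> 0 \<Longrightarrow> f1 x > 0"
    and "\<exists>c>0. \<exists>k0>0. \<exists>\<eta>>0. \<forall>x. norm x > k0 \<longrightarrow> f0 x \<ge> c * norm x powr (- \<eta>)"
    and "\<exists>\<phi>0 :: complex ^ 'n \<Rightarrow> complex.
           entire \<phi>0 \<and> finite_exponential_type \<phi>0 \<and>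
           asymp_at_infinity f0 (\<lambda>x. (cmod (\<phi>0 (of_real_vec x)))\<^sup>2)"
    and "\<exists>k>0. (\<integral>\<^sup>+ x\<in>{x. norm x > k}. ennreal (((f1 x - f0 x) / f0 x)\<^sup>2) \<partial>lborel) < \<infinity>"
    and "stationary_increments_GRF M0 X0 F0" and "stationary_increments_GRF M1 X1 F1"
  shows "locally_equivalent M0 X0 M1 X1"
proof -
  define w0 where "w0 = (\<lambda>x. indicator (- {0}) x * f0 x)"
  define w1 where "w1 = (\<lambda>x. indicator (- {0}) x * f1 x)"
  have w_eq: "w0 x = f0 x" "w1 x = f1 x" if "x \<noteq> 0" for x using that by (auto simp: w0_def w1_def)
  have w_zero: "w0 0 = 0" "w1 0 = 0" by (auto simp: w0_def w1_def)
  note W0 = spectral_weight[OF assms(1,3,10) w0_def]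
  note W1 = spectral_weight[OF assms(2,4,11) w1_def]
  note [measurable] = W0(1) W1(1)
  have w_pos: "w0 x > 0" "w1 x > 0" if "x \<noteq> 0" for x using assms(5,6) that w_eq by auto
  have w_nonneg: "w0 x \<ge> 0" "w1 x \<ge> 0" for x
    using w_pos[of x] w_zero by (cases "x = 0"; simp)+
  obtain c0 k0 \<eta> where low: "c0 > 0" "k0 > 0" "\<eta> > 0" "\<And>x. norm x > k0 \<Longrightarrow> f0 x \<ge> c0 * norm x powr (- \<eta>)"
    using assms(7) by blast
  have low_w: "w0 x \<ge> c0 * norm x powr (- \<eta>)" if "norm x > k0" for x
  proof -
    have "x \<noteq> 0" using that low(2) by auto
    thus ?thesis using low(4)[OF that] w_eq by simp
  qed
  obtain \<phi> :: "complex ^ 'n \<Rightarrow> complex" where \<phi>: "entire \<phi>" "finite_exponential_type \<phi>"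
    "asymp_at_infinity f0 (\<lambda>x. (cmod (\<phi> (of_real_vec x)))\<^sup>2)"
    using assms(8) by blast
  obtain A \<tau> where type: "\<tau> \<ge> 0" "\<And>z. norm (\<phi> z) \<le> A * exp (\<tau> * norm z)"
  proof (rule finite_exponential_type_bound[OF \<phi>(1,2)], goal_cases)
    case (1 \<tau> A)
    from 1(2,3) show ?case by (rule that)
  qed
  have A0: "A \<ge> 0" using order_trans[OF norm_ge_zero type(2)[of 0]] by simp
  obtain c1 c2 R where asymp: "c1 > 0" "c2 > 0" "R > 0"
    "\<And>x. norm x > R \<Longrightarrow> c1 * (cmod (\<phi> (of_real_vec x)))\<^sup>2 \<le> f0 x \<and> f0 x \<le> c2 * (cmod (\<phi> (of_real_vec x)))\<^sup>2"
    using \<phi>(3) unfolding asymp_at_infinity_def by blast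
  have asymp_w: "c1 * (cmod (\<phi> (of_real_vec x)))\<^sup>2 \<le> w0 x" "w0 x \<le> c2 * (cmod (\<phi> (of_real_vec x)))\<^sup>2" if "norm x > R" for x
  proof -
    have "x \<noteq> 0" using that asymp(3) by auto
    thus "c1 * (cmod (\<phi> (of_real_vec x)))\<^sup>2 \<le> w0 x" "w0 x \<le> c2 * (cmod (\<phi> (of_real_vec x)))\<^sup>2"
      using asymp(4)[OF that] w_eq by auto
  qed
  obtain k where k: "k > 0" "(\<integral>\<^sup>+ x\<in>{x. norm x > k}. ennreal (((f1 x - f0 x) / f0 x)\<^sup>2) \<partial>lborel) < \<infinity>"
    using assms(9) by blast
  \<comment> \<open>The far region must satisfy both the integrability condition beyond
    \<open>k\<close> and the comparison with the entire function beyond \<open>R\<close>; the bound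
    near 0 holds on a ball of any radius, so the two regions can meet at \<open>K\<close>.\<close>
  define K where "K = max k R"
  have K: "K \<ge> k" "K \<ge> R" "K > 0" using k by (auto simp: K_def)
  have line_type: "\<exists>L. \<forall>u v. norm (complex_line \<phi> x u v) \<le> L * exp (\<tau> * norm u * norm v)" for x
  proof (intro exI allI)
    fix u v
    have "norm (of_real_vec x + u *s of_real_vec v) \<le> norm x + norm u * norm v"
      using norm_triangle_ineq[of "of_real_vec x" "u *s of_real_vec v"]
      by (simp add: norm_of_real_vec norm_vector_scalar_mult_complex)
    hence "\<tau> * norm (of_real_vec x + u *s of_real_vec v) \<le> \<tau> * (norm x + norm u * norm v)"
      using type(1) by (rule mult_left_mono)
    hence "A * exp (\<tau> * norm (of_real_vec x + u *s of_real_vec v)) \<le> A * exp (\<tau> * (norm x + norm u * norm v))"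
      using A0 by (intro mult_left_mono) auto
    also have "\<dots> = (A * exp (\<tau> * norm x)) * exp (\<tau> * norm u * norm v)" by (simp add: distrib_left exp_add mult.assoc)
    finally show "norm (complex_line \<phi> x u v) \<le> (A * exp (\<tau> * norm x)) * exp (\<tau> * norm u * norm v)"
      using type(2)[of "of_real_vec x + u *s of_real_vec v"] unfolding complex_line_def by linarith
  qed
  have [measurable]: "{x :: real ^ 'n. norm x \<le> K} \<in> sets borel" "{x :: real ^ 'n. norm x > K} \<in> sets borel"
    by (intro borel_closed borel_open closed_Collect_le open_Collect_less continuous_intros)+
  \<comment> \<open>On the ball of radius \<open>K\<close>, \<open>(norm x)\<^sup>2\<close> is at
    most \<open>1 + K\<^sup>2\<close> times the integrand in the definition of a spectral
    measure.\<close>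
  have near_int: "integrable lborel (\<lambda>x. (norm x)\<^sup>2 * (w0 x + w1 x) * indicator {x. norm x \<le> K} x)"
  proof (rule Bochner_Integration.integrable_bound)
    show "integrable lborel (\<lambda>x. (1 + K\<^sup>2) * ((norm x)\<^sup>2 / (1 + (norm x)\<^sup>2) * w0 x + (norm x)\<^sup>2 / (1 + (norm x)\<^sup>2) * w1 x))"
      using W0(4) W1(4) by (intro integrable_mult_right Bochner_Integration.integrable_add)
    show "AE x in lborel. norm ((norm x)\<^sup>2 * (w0 x + w1 x) * indicator {x. norm x \<le> K} x)
      \<le> norm ((1 + K\<^sup>2) * ((norm x)\<^sup>2 / (1 + (norm x)\<^sup>2) * w0 x + (norm x)\<^sup>2 / (1 + (norm x)\<^sup>2) * w1 x))"
    proof (rule AE_I2)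
      fix x :: "real ^ 'n"
      define q where "q = (norm x)\<^sup>2 / (1 + (norm x)\<^sup>2)"
      have q0: "q \<ge> 0" by (simp add: q_def)
      have eq: "(1 + K\<^sup>2) * (q * w0 x + q * w1 x) = ((1 + K\<^sup>2) * q) * (w0 x + w1 x)" by (simp add: algebra_simps)
      show "norm ((norm x)\<^sup>2 * (w0 x + w1 x) * indicator {x. norm x \<le> K} x)
        \<le> norm ((1 + K\<^sup>2) * ((norm x)\<^sup>2 / (1 + (norm x)\<^sup>2) * w0 x + (norm x)\<^sup>2 / (1 + (norm x)\<^sup>2) * w1 x))"
        unfolding q_def[symmetric] eq
      proof (cases "norm x \<le> K")
        case True
        have p: "1 + (norm x)\<^sup>2 > 0" by (simp add: add_pos_nonneg)
        have "(norm x)\<^sup>2 = (1 + (norm x)\<^sup>2) * q" using p by (simp add: q_def)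
        also have "\<dots> \<le> (1 + K\<^sup>2) * q" using True q0 by (intro mult_right_mono add_left_mono power_mono) auto
        finally have "(norm x)\<^sup>2 * (w0 x + w1 x) \<le> ((1 + K\<^sup>2) * q) * (w0 x + w1 x)"
          using w_nonneg[of x] by (intro mult_right_mono) auto
        moreover have "(norm x)\<^sup>2 * (w0 x + w1 x) \<ge> 0" using w_nonneg[of x] by simp
        ultimately show "norm ((norm x)\<^sup>2 * (w0 x + w1 x) * indicator {x. norm x \<le> K} x) \<le> norm (((1 + K\<^sup>2) * q) * (w0 x + w1 x))"
          using True by simp
      qed simp
    qed
  qed measurable
  have far_int: "integrable lborel (\<lambda>x. ((w1 x - w0 x) / w0 x)\<^sup>2 * indicator {x. norm x > K} x)"
  proof (rule integrableI_nonneg)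
    have "(\<integral>\<^sup>+ x. ennreal (((w1 x - w0 x) / w0 x)\<^sup>2 * indicator {x. norm x > K} x) \<partial>lborel)
      \<le> (\<integral>\<^sup>+ x\<in>{x. norm x > k}. ennreal (((f1 x - f0 x) / f0 x)\<^sup>2) \<partial>lborel)"
    proof (rule nn_integral_mono)
      fix x :: "real ^ 'n"
      show "ennreal (((w1 x - w0 x) / w0 x)\<^sup>2 * indicator {x. norm x > K} x)
        \<le> ennreal (((f1 x - f0 x) / f0 x)\<^sup>2) * indicator {x. norm x > k} x"
      proof (cases "norm x > K")
        case True
        hence "x \<noteq> 0" "norm x > k" using K by auto
        thus ?thesis using True w_eq by simp
      qed simp
    qed
    thus "(\<integral>\<^sup>+ x. ennreal (((w1 x - w0 x) / w0 x)\<^sup>2 * indicator {x. norm x > K} x) \<partial>lborel) < \<infinity>"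
      using k(2) by (rule le_less_trans)
    have "(\<lambda>x. ((w1 x - w0 x) / w0 x)\<^sup>2) \<in> borel_measurable lborel" by measurable
    thus "(\<lambda>x. ((w1 x - w0 x) / w0 x)\<^sup>2 * indicator {x. norm x > K} x) \<in> borel_measurable lborel"
      by (intro borel_measurable_times borel_measurable_indicator) auto
  qed auto
  show ?thesis unfolding locally_equivalent_def
  proof (intro allI impI)
    fix D :: "(real ^ 'n) set" assume "bounded D"
    then obtain \<rho> where "\<rho> > 0" "\<forall>x\<in>D. norm x \<le> \<rho>" unfolding bounded_pos by blast
    hence \<rho>: "\<rho> > 0" "D \<subseteq> cball 0 \<rho>" by auto
    have rho: "\<rho> \<ge> 0" using \<rho> by simp
    obtain C1 where C1: "C1 > 0"
      "\<And>T c B x. T \<subseteq> cball 0 \<rho> \<Longrightarrow> B \<ge> 0 \<Longrightarrow> (\<integral>\<^sup>+ x. sq_norm w0 T c x \<partial>lborel) \<le> ennreal (B\<^sup>2) \<Longrightarrow>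
         norm x \<le> K \<Longrightarrow> norm (trig_poly T c x) \<le> C1 * norm x * B"
    proof (rule trig_poly_bound_near_0[OF W0(1) w_nonneg(1) low(1-3) low_w rho, where k=K], goal_cases)
      case (2 C)
      from 2(2,3) show ?case by (rule that)
    qed simp
    obtain C2 where C2: "C2 > 0"
      "\<And>T c B x. T \<subseteq> cball 0 \<rho> \<Longrightarrow> B \<ge> 0 \<Longrightarrow> (\<integral>\<^sup>+ x. sq_norm w0 T c x \<partial>lborel) \<le> ennreal (B\<^sup>2) \<Longrightarrow>
         norm x > R \<Longrightarrow> (norm (trig_poly T c x))\<^sup>2 * w0 x \<le> C2 * B\<^sup>2"
    proof (rule trig_poly_bound_far[where \<psi>="complex_line \<phi>" and p="\<lambda>x. \<phi> (of_real_vec x)",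
          OF W0(1) w_nonneg(1) low(1-3) low_w rho type(1) holomorphic_complex_line[OF \<phi>(1)]
            continuous_complex_line[OF \<phi>(1)] line_type complex_line_of_real asymp(1-3) asymp_w], goal_cases)
      case (4 C)
      from 4(2,3) show ?case by (rule that)
    qed simp_all
    have sq: "(\<integral>\<^sup>+ x. sq_norm w0 T c x \<partial>lborel) \<le> ennreal ((sqrt (sq_int w0 T c))\<^sup>2)" "sq_int w0 T c \<ge> 0" if "finite T" for T c
    proof -
      show "sq_int w0 T c \<ge> 0" unfolding sq_int_def using w_nonneg by (intro Bochner_Integration.integral_nonneg) auto
      thus "(\<integral>\<^sup>+ x. sq_norm w0 T c x \<partial>lborel) \<le> ennreal ((sqrt (sq_int w0 T c))\<^sup>2)"
        unfolding sq_norm_def sq_int_def using nn_integral_eq_integral[OF W0(2)[OF that, of c]] w_nonneg by simp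
    qed
    \<comment> \<open>The pointwise bounds hold for every \<open>B\<close> dominating the norm;
      \<open>B = sqrt (sq_int w0 T c)\<close> turns them into bounds by the quadratic form, which
      squares \<open>C1\<close> but not \<open>C2\<close>.\<close>
    interpret comparable_weights w0 w1 \<rho> K "C1\<^sup>2" C2
    proof
      fix T :: "(real ^ 'n) set" and c and x :: "real ^ 'n"
      assume T: "finite T" "T \<subseteq> cball 0 \<rho>"
      show "(norm (trig_poly T c x))\<^sup>2 \<le> C1\<^sup>2 * (norm x)\<^sup>2 * sq_int w0 T c" if "norm x \<le> K"
      proof -
        have "norm (trig_poly T c x) \<le> C1 * norm x * sqrt (sq_int w0 T c)"
          using sq[OF T(1)] by (intro C1(2)[OF T(2) _ _ that]) auto
        hence "(norm (trig_poly T c x))\<^sup>2 \<le> (C1 * norm x * sqrt (sq_int w0 T c))\<^sup>2" by (intro power_mono) auto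
        thus ?thesis using sq(2)[OF T(1)] by (simp add: power_mult_distrib)
      qed
      show "(norm (trig_poly T c x))\<^sup>2 * w0 x \<le> C2 * sq_int w0 T c" if "norm x > K"
      proof -
        have "norm x > R" using that K by linarith
        hence "(norm (trig_poly T c x))\<^sup>2 * w0 x \<le> C2 * (sqrt (sq_int w0 T c))\<^sup>2"
          using sq[OF T(1)] by (intro C2(2)[OF T(2)]) auto
        thus ?thesis using sq(2)[OF T(1)] by simp
      qed
    qed (use W0 W1 w_nonneg w_pos K C2(1) near_int far_int in auto)
    show "equivalent_on D M0 X0 M1 X1"
      using assms(10,11) by (intro equivalent_on_gaussian_fields W0(3) W1(3) \<rho>(2)) (auto simp: stationary_increments_GRF_def)
  qed
qed

end
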